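(* Let $\sigma:A\to A^+$ be an aperiodic substitution on a finite alphabet $A$ (with $X_\sigma$ uncountable) that has the nesting property. Then the substitutional dynamical system $(X_\sigma,T_\sigma)$ is homeomorphic to the Vershik map of a stationary ordered Bratteli diagram; that is, there exist a stationary ordered Bratteli diagram $B$ and a Vershik homeomorphism $\varphi_B:X_B\to X_B$ such that $(X_\sigma,T_\sigma)$ and $(X_B,\varphi_B)$ are homeomorphic.
   Context: $A^+$ is the set of nonempty words over $A$; a substitution $\sigma:A\to A^+$ is extended to $A^+$ by concatenation. $L(\sigma)$ is the set of all factors of the words $\sigma^n(a)$, $a\in A$, $n\ge1$. The substitutional dynamical system of $\sigma$ is $(X_\sigma,T_\sigma)$ with $X_\sigma=\{x\in A^{\mathbb Z}:x[-n,n]\in L(\sigma)\text{ for all }n\}$ and $T_\sigma$ the left shift. $\sigma$ is aperiodic if $(X_\sigma,T_\sigma)$ has no periodic points. Standing assumption of the paper: $X_\sigma$ is uncountable. Let $A_l$ be the set of letters $a\in A$ with $|\sigma^n(a)|\to\infty$ as $n\to\infty$. $\sigma$ has the nesting property if either (1) for every $a\in A_l$ the word $\sigma(a)$ starts with a letter from $A_l$, or (2) for every $a\in A_l$ the word $\sigma(a)$ ends with a letter from $A_l$. A Bratteli diagram is an infinite graph $B=(V,E)$ whose vertex set $V=\bigcup_{i\ge 0}V_i$ and edge set $E=\bigcup_{i\ge 1}E_i$ are partitioned into disjoint finite sets $V_i$, $E_i$, with $V_0=\{v_0\}$ a single point, together with a range map $r$ and a source map $s$ from $E$ to $V$ such that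 $r(E_i)=V_i$, $s(E_i)=V_{i-1}$, $s^{-1}(v)\ne\emptyset$ for all $v\in V$ and $r^{-1}(v')\neq\emptyset$ for all $v'\in V\setminus V_0$. $X_B$ is the set of infinite paths $x=(x_1,x_2,\dots)$, $x_i\in E_i$, $r(x_i)=s(x_{i+1})$, with the topology generated by the cylinder sets $\{x: x_1=e_1,\dots,x_n=e_n\}$. $E(v_0,v)$ is the set of finite paths from $v_0$ to $v$. An ordered Bratteli diagram $B=(V,E,\le)$ is a Bratteli diagram with a partial order on each $E_i$ such that $e,e'$ are comparable if and only if $r(e)=r(e')$. A path is maximal (minimal) if each of its edges $e$ is maximal (minimal) in $r^{-1}(r(e))$; $X_{\max}$, $X_{\min}$ are the sets of maximal and minimal infinite paths. A Vershik homeomorphism (map) is a homeomorphism $\varphi_B:X_B\to X_B$ such that $\varphi_B(X_{\max})=X_{\min}$ and, for $x\notin X_{\max}$, $\varphi_B(x)=(x_1^0,\dots,x_{k-1}^0,\overline{x_k},x_{k+1},x_{k+2},\dots)$, where $k=\min\{n\ge1: x_n \text{ is not maximal}\}$, $\overline{x_k}$ is the successor of $x_k$ in $r^{-1}(r(x_k))$, and $(x_1^0,\dots,x_{k-1}^0)$ is the minimal path in $E(v_0,s(\overline{x_k}))$. $B$ is stationary if $|V_1|=|V_2|=\dots=k$ and, for an appropriate labeling of the vertices $V_n=\{V_n(c): c\in C\}$, $n\ge1$, by an alphabet $C$ of $k$ symbols, the incidence matrix between levels $n$ and $n+1$ is the same $k\times k$ matrix for all $n\geq 1$. An ordered diagram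 $B$ is stationary ordered if moreover the ordering on the edges with range $V_n(c)$ does not depend on $n\ge2$, for every $c\in C$. Two systems are homeomorphic if there is a homeomorphism between the spaces intertwining the two maps. *)

theory Defs
  imports "HOL-Analysis.Analysis" "HOL-Library.Sublist"
begin

section \<open>Substitutional dynamical systems\<close>

text \<open>The alphabet is a finite type, so all of its elements are letters.\<close>

definition is_substitution :: "('a \<Rightarrow> 'a list) \<Rightarrow> bool" where
  "is_substitution \<sigma> \<longleftrightarrow> (\<forall>a. \<sigma> a \<noteq> [])"

definition subst_ext :: "('a \<Rightarrow> 'a list) \<Rightarrow> 'a list \<Rightarrow> 'a list" where
  "subst_ext \<sigma> w = concat (map \<sigma> w)"

definition subst_iter :: "('a \<Rightarrow> 'a list) \<Rightarrow> nat \<Rightarrow> 'a \<Rightarrow> 'a list" where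
  "subst_iter \<sigma> n a = (subst_ext \<sigma> ^^ n) [a]"

definition language :: "('a \<Rightarrow> 'a list) \<Rightarrow> 'a list set" where
  "language \<sigma> = {w. \<exists>a. \<exists>n\<ge>1. sublist w (subst_iter \<sigma> n a)}"

definition subst_space :: "('a \<Rightarrow> 'a list) \<Rightarrow> (int \<Rightarrow> 'a) set" where
  "subst_space \<sigma> = {x. \<forall>n::nat. map x [- int n..int n] \<in> language \<sigma>}"

definition subst_topology :: "('a \<Rightarrow> 'a list) \<Rightarrow> (int \<Rightarrow> 'a) topology" where
  "subst_topology \<sigma> =
     subtopology (product_topology (\<lambda>_. discrete_topology UNIV) UNIV) (subst_space \<sigma>)"

definition left_shift :: "(int \<Rightarrow> 'a) \<Rightarrow> int \<Rightarrow> 'a" where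
  "left_shift x = (\<lambda>i. x (i + 1))"

definition aperiodic_subst :: "('a \<Rightarrow> 'a list) \<Rightarrow> bool" where
  "aperiodic_subst \<sigma> \<longleftrightarrow> \<not> (\<exists>x\<in>subst_space \<sigma>. \<exists>p\<ge>1. (left_shift ^^ p) x = x)"

definition growing_letters :: "('a \<Rightarrow> 'a list) \<Rightarrow> 'a set" where
  "growing_letters \<sigma> = {a. filterlim (\<lambda>n. length (subst_iter \<sigma> n a)) at_top sequentially}"

definition nesting_property :: "('a \<Rightarrow> 'a list) \<Rightarrow> bool" where
  "nesting_property \<sigma> \<longleftrightarrow>
     (\<forall>a\<in>growing_letters \<sigma>. hd (\<sigma> a) \<in> growing_letters \<sigma>) \<or>
     (\<forall>a\<in>growing_letters \<sigma>. last (\<sigma> a) \<in> growing_letters \<sigma>)"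


section \<open>Ordered Bratteli diagrams\<close>

text \<open>The edge sets are \<open>edges i\<close> for \<open>i \<ge> 1\<close>; the value of \<open>edges 0\<close> is irrelevant.
  The relation \<open>edge_le\<close> is only meaningful between edges of the same level.\<close>

record ('v, 'e) bratteli =
  verts :: "nat \<Rightarrow> 'v set"
  edges :: "nat \<Rightarrow> 'e set"
  rng :: "'e \<Rightarrow> 'v"
  src :: "'e \<Rightarrow> 'v"

record ('v, 'e) ord_bratteli = "('v, 'e) bratteli" +
  edge_le :: "'e rel"

definition all_verts :: "('v, 'e, 'm) bratteli_scheme \<Rightarrow> 'v set" where
  "all_verts B = (\<Union>i. verts B i)"

definition all_edges :: "('v, 'e, 'm) bratteli_scheme \<Rightarrow> 'e set" where
  "all_edges B = (\<Union>i\<in>{1..}. edges B i)"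

definition in_edges :: "('v, 'e, 'm) bratteli_scheme \<Rightarrow> 'v \<Rightarrow> 'e set" where
  "in_edges B v = {e \<in> all_edges B. rng B e = v}"

definition out_edges :: "('v, 'e, 'm) bratteli_scheme \<Rightarrow> 'v \<Rightarrow> 'e set" where
  "out_edges B v = {e \<in> all_edges B. src B e = v}"

definition bratteli_diagram :: "('v, 'e, 'm) bratteli_scheme \<Rightarrow> bool" where
  "bratteli_diagram B \<longleftrightarrow>
     (\<forall>i. finite (verts B i)) \<and>
     (\<forall>i\<ge>1. finite (edges B i)) \<and>
     (\<forall>i j. i \<noteq> j \<longrightarrow> verts B i \<inter> verts B j = {}) \<and>
     (\<forall>i\<ge>1. \<forall>j\<ge>1. i \<noteq> j \<longrightarrow> edges B i \<inter> edges B j = {}) \<and>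
     (\<exists>v0. verts B 0 = {v0}) \<and>
     (\<forall>i\<ge>1. rng B ` edges B i = verts B i) \<and>
     (\<forall>i\<ge>1. src B ` edges B i = verts B (i - 1)) \<and>
     (\<forall>v\<in>all_verts B. out_edges B v \<noteq> {}) \<and>
     (\<forall>v\<in>all_verts B - verts B 0. in_edges B v \<noteq> {})"

text \<open>Infinite paths are indexed from 0: the entry \<open>x n\<close> is the edge $x_{n+1} \in E_{n+1}$.
  Likewise for finite paths, which are lists of edges.\<close>

definition inf_paths :: "('v, 'e, 'm) bratteli_scheme \<Rightarrow> (nat \<Rightarrow> 'e) set" where
  "inf_paths B = {x. \<forall>n. x n \<in> edges B (Suc n) \<and> rng B (x n) = src B (x (Suc n))}"

definition cylinder :: "('v, 'e, 'm) bratteli_scheme \<Rightarrow> 'e list \<Rightarrow> (nat \<Rightarrow> 'e) set" where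
  "cylinder B p = {x \<in> inf_paths B. \<forall>i<length p. x i = p ! i}"

definition path_topology :: "('v, 'e, 'm) bratteli_scheme \<Rightarrow> (nat \<Rightarrow> 'e) topology" where
  "path_topology B = topology_generated_by (range (cylinder B))"

definition fin_paths :: "('v, 'e, 'm) bratteli_scheme \<Rightarrow> 'v \<Rightarrow> 'e list set" where
  "fin_paths B v =
     {p. (\<forall>i<length p. p ! i \<in> edges B (Suc i)) \<and>
         (\<forall>i. Suc i < length p \<longrightarrow> rng B (p ! i) = src B (p ! Suc i)) \<and>
         (if p = [] then v \<in> verts B 0 else rng B (last p) = v)}"

definition ordered_bratteli_diagram :: "('v, 'e, 'm) ord_bratteli_scheme \<Rightarrow> bool" where
  "ordered_bratteli_diagram B \<longleftrightarrow>
     bratteli_diagram B \<and>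
     (\<forall>i\<ge>1. partial_order_on (edges B i) (edge_le B \<inter> edges B i \<times> edges B i)) \<and>
     (\<forall>i\<ge>1. \<forall>e\<in>edges B i. \<forall>e'\<in>edges B i.
        ((e, e') \<in> edge_le B \<or> (e', e) \<in> edge_le B) \<longleftrightarrow> rng B e = rng B e')"

definition max_edge :: "('v, 'e, 'm) ord_bratteli_scheme \<Rightarrow> 'e \<Rightarrow> bool" where
  "max_edge B e \<longleftrightarrow> (\<forall>e'\<in>in_edges B (rng B e). (e, e') \<in> edge_le B \<longrightarrow> e' = e)"

definition min_edge :: "('v, 'e, 'm) ord_bratteli_scheme \<Rightarrow> 'e \<Rightarrow> bool" where
  "min_edge B e \<longleftrightarrow> (\<forall>e'\<in>in_edges B (rng B e). (e', e) \<in> edge_le B \<longrightarrow> e' = e)"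

definition succ_edge :: "('v, 'e, 'm) ord_bratteli_scheme \<Rightarrow> 'e \<Rightarrow> 'e \<Rightarrow> bool" where
  "succ_edge B e e' \<longleftrightarrow>
     e' \<in> in_edges B (rng B e) \<and> (e, e') \<in> edge_le B \<and> e' \<noteq> e \<and>
     (\<forall>d\<in>in_edges B (rng B e). (e, d) \<in> edge_le B \<and> (d, e') \<in> edge_le B \<longrightarrow> d = e \<or> d = e')"

definition max_paths :: "('v, 'e, 'm) ord_bratteli_scheme \<Rightarrow> (nat \<Rightarrow> 'e) set" where
  "max_paths B = {x \<in> inf_paths B. \<forall>n. max_edge B (x n)}"

definition min_paths :: "('v, 'e, 'm) ord_bratteli_scheme \<Rightarrow> (nat \<Rightarrow> 'e) set" where
  "min_paths B = {x \<in> inf_paths B. \<forall>n. min_edge B (x n)}"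

text \<open>\<open>vershik_step B x y\<close>: \<open>y\<close> is the image prescribed by the Vershik rule for a
  non-maximal path \<open>x\<close>. Here \<open>k\<close> is 0-based and \<open>p\<close> automatically has length \<open>k\<close>.\<close>

definition vershik_step ::
    "('v, 'e, 'm) ord_bratteli_scheme \<Rightarrow> (nat \<Rightarrow> 'e) \<Rightarrow> (nat \<Rightarrow> 'e) \<Rightarrow> bool" where
  "vershik_step B x y \<longleftrightarrow>
     (let k = (LEAST n. \<not> max_edge B (x n)) in
       \<exists>e p. succ_edge B (x k) e \<and>
             p \<in> fin_paths B (src B e) \<and> (\<forall>d\<in>set p. min_edge B d) \<and>
             y = (\<lambda>i. if i < k then p ! i else if i = k then e else x i))"

definition vershik_homeomorphism ::
    "('v, 'e, 'm) ord_bratteli_scheme \<Rightarrow> ((nat \<Rightarrow> 'e) \<Rightarrow> (nat \<Rightarrow> 'e)) \<Rightarrow> bool" where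
  "vershik_homeomorphism B \<phi> \<longleftrightarrow>
     homeomorphic_map (path_topology B) (path_topology B) \<phi> \<and>
     \<phi> ` max_paths B = min_paths B \<and>
     (\<forall>x\<in>inf_paths B - max_paths B. vershik_step B x (\<phi> x))"


section \<open>Stationary diagrams\<close>

text \<open>The entry of the incidence matrix between levels \<open>n\<close> and \<open>n + 1\<close> in row \<open>c\<close>
  and column \<open>d\<close>, for the labeling \<open>lab\<close> (so \<open>lab n c\<close> is the vertex $V_n(c)$).\<close>

definition incidence ::
    "('v, 'e, 'm) bratteli_scheme \<Rightarrow> (nat \<Rightarrow> 'c \<Rightarrow> 'v) \<Rightarrow> nat \<Rightarrow> 'c \<Rightarrow> 'c \<Rightarrow> nat" where
  "incidence B lab n c d =
     card {e \<in> edges B (n + 1). rng B e = lab (n + 1) c \<and> src B e = lab n d}"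

definition stationary_labeling ::
    "('v, 'e, 'm) bratteli_scheme \<Rightarrow> 'c set \<Rightarrow> (nat \<Rightarrow> 'c \<Rightarrow> 'v) \<Rightarrow> bool" where
  "stationary_labeling B C lab \<longleftrightarrow>
     finite C \<and>
     (\<forall>n\<ge>1. bij_betw (lab n) C (verts B n)) \<and>
     (\<forall>m\<ge>1. \<forall>n\<ge>1. \<forall>c\<in>C. \<forall>d\<in>C. incidence B lab m c d = incidence B lab n c d)"

text \<open>Independence of the order from the level: the ordered sets of edges into
  \<open>lab (m + 1) c\<close> and \<open>lab (n + 1) c\<close> (both levels at least 2) are isomorphic by a map
  preserving the labels of the sources, i.e. both list the same word of source labels.\<close>

definition stationary_order_labeling ::
    "('v, 'e, 'm) ord_bratteli_scheme \<Rightarrow> 'c set \<Rightarrow> (nat \<Rightarrow> 'c \<Rightarrow> 'v) \<Rightarrow> bool" where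
  "stationary_order_labeling B C lab \<longleftrightarrow>
     (\<forall>c\<in>C. \<forall>m\<ge>1. \<forall>n\<ge>1. \<exists>f.
        bij_betw f (in_edges B (lab (m + 1) c)) (in_edges B (lab (n + 1) c)) \<and>
        (\<forall>e\<in>in_edges B (lab (m + 1) c). \<forall>e'\<in>in_edges B (lab (m + 1) c).
           (e, e') \<in> edge_le B \<longleftrightarrow> (f e, f e') \<in> edge_le B) \<and>
        (\<forall>e\<in>in_edges B (lab (m + 1) c). \<forall>d\<in>C. src B e = lab m d \<longleftrightarrow> src B (f e) = lab n d))"

text \<open>Labels can be taken to be natural numbers, since the label set is finite.\<close>

definition stationary_ordered_bratteli_diagram :: "('v, 'e, 'm) ord_bratteli_scheme \<Rightarrow> bool" where
  "stationary_ordered_bratteli_diagram B \<longleftrightarrow>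
     ordered_bratteli_diagram B \<and>
     (\<exists>(C :: nat set) lab. stationary_labeling B C lab \<and> stationary_order_labeling B C lab)"


section \<open>Homeomorphic dynamical systems\<close>

definition homeomorphic_systems ::
    "'x topology \<Rightarrow> ('x \<Rightarrow> 'x) \<Rightarrow> 'y topology \<Rightarrow> ('y \<Rightarrow> 'y) \<Rightarrow> bool" where
  "homeomorphic_systems X f Y g \<longleftrightarrow>
     (\<exists>h. homeomorphic_map X Y h \<and> (\<forall>x\<in>topspace X. h (f x) = g (h x)))"

end

theory Submission
  imports Defs "HOL-Library.Stream"
begin

text \<open>
  A point of \<open>X_\<sigma>\<close> is a shifted image \<open>T\<^sup>k(\<sigma>(y))\<close> of
  another point \<open>y\<close>. Desubstituting again and again, and recording at each stage which part
  of the preimage covers the origin and where in its image the origin lies, yields an infinite path in a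
  diagram whose edges are the pairs (a letter, a position in its image). Shifting the point by one moves
  the position at the lowest stage that is not at the end of its image, and resets the stages below.
  This is the Vershik rule. For this to define a homeomorphism three problems have to be solved.

  Desubstitution has to be unique. This is recognizability (\<open>aperiodic_recognizable\<close>),
  proved as follows. A substitution is called elementary if it does not factor through a smaller
  alphabet. The defect lemma (\<open>defect\<close>) turns coincidences between images of different
  infinite words into factorizations. Hence an elementary substitution is injective on one-sided
  infinite words, and, with the overlap of two parsings regarded as the image of an additional letter,
  two parsings of the same point without a common cut are governed by a deterministic process on
  finitely many overlaps. So the point is periodic (\<open>parse_unique_aperiodic\<close>). If
  \<open>\<sigma> = f g\<close> factors through a smaller alphabet, recognizability of
  \<open>g f\<close> implies that of \<open>\<sigma>\<close> (\<open>recognizable_conjugate\<close>),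
  and induction on the size of the alphabet applies.

  There may be letters whose iterated images stay bounded. Aperiodicity implies that runs of such
  letters are bounded (\<open>bounded_runs\<close>): otherwise some growing letter \<open>h\<close>
  satisfies \<open>\<rho>(h) = u h \<dots>\<close>, or the mirror image of this, for a power
  \<open>\<rho>\<close> of \<open>\<sigma>\<close> and a nonempty word \<open>u\<close> of bounded
  letters, and powers of \<open>\<rho>(u)\<close> appear in the language. So points are concatenations
  of blocks from a finite set, each of them a growing letter followed by bounded letters. If the images
  of growing letters start with growing letters, then the image of a block is a concatenation of blocks,
  and blocks can take over the role of letters. The other half of the nesting property is the mirror
  image; there the order of the diagram is reversed and the Vershik map is replaced by its inverse
  (\<open>vershik_homeomorphism_reverse\<close>).

  With blocks as vertices, a path whose edges are maximal from some level on, or minimal from some level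
  on, would determine a point on one side only. The vertices of the diagram are therefore blocks
  together with the adjacent growing letters. With these a path determines longer and longer windows on
  both sides of the origin (\<open>same_path_window\<close>), which makes the correspondence injective
  (\<open>path_inj\<close>) and its inverse continuous. Limits of points that realise longer and longer
  initial segments show that every path occurs (\<open>realize\<close>). Since the path space is
  compact, the correspondence is a homeomorphism.
\<close>

section \<open>Cutting biinfinite words\<close>

definition window :: "(int \<Rightarrow> 'a) \<Rightarrow> int \<Rightarrow> int \<Rightarrow> 'a list" where
  "window x i j = map x [i..j - 1]"

lemma length_window [simp]: "length (window x i j) = nat (j - i)"
  by (simp add: window_def)

lemma window_empty [simp]: "j \<le> i \<Longrightarrow> window x i j = []"
  by (simp add: window_def)

lemma window_eq_Nil_iff: "window x i j = [] \<longleftrightarrow> j \<le> i"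
  by (metis length_0_conv length_window nat_0_iff diff_le_0_iff_le)

lemma nth_window: "n < nat (j - i) \<Longrightarrow> window x i j ! n = x (i + int n)"
  by (simp add: window_def nth_upto)

lemma set_window: "set (window x i j) = x ` {i..<j}"
  by (auto simp: window_def)

lemma window_append: "i \<le> j \<Longrightarrow> j \<le> k \<Longrightarrow> window x i j @ window x j k = window x i k"
  by (cases "j = k") (simp_all add: window_def upto_split1[of i j "k - 1"])

lemma window_single [simp]: "window x i (i + 1) = [x i]"
  by (simp add: window_def)

lemma window_Cons: "i < j \<Longrightarrow> window x i j = x i # window x (i + 1) j"
  by (simp add: window_def upto_rec1)

lemma window_eq_iff:
  "window x i j = window x' i' j' \<longleftrightarrow>
     nat (j - i) = nat (j' - i') \<and> (\<forall>k. 0 \<le> k \<and> k < j - i \<longrightarrow> x (i + k) = x' (i' + k))"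
  (is "?L \<longleftrightarrow> ?R")
proof
  assume L: ?L
  then have len: "nat (j - i) = nat (j' - i')" by (metis length_window)
  have "x (i + k) = x' (i' + k)" if "0 \<le> k" "k < j - i" for k
  proof -
    have k: "nat k < nat (j - i)" using that by simp
    then have "nat k < nat (j' - i')" using len by simp
    with k have "window x i j ! nat k = x (i + k)" "window x' i' j' ! nat k = x' (i' + k)"
      using \<open>0 \<le> k\<close> by (simp_all add: nth_window)
    then show ?thesis using L by simp
  qed
  with len show ?R by blast
next
  assume ?R then show ?L
    by (intro nth_equalityI) (auto simp: nth_window simp del: nat_diff_distrib)
qed

lemma window_eqD: "window x i j = window x' i j \<Longrightarrow> i \<le> k \<Longrightarrow> k < j \<Longrightarrow> x k = x' k"
  by (simp add: window_def)

lemma window_cong: "(\<And>k. i \<le> k \<Longrightarrow> k < j \<Longrightarrow> x k = x' k) \<Longrightarrow> window x i j = window x' i j"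
  by (simp add: window_def)

lemma window_shift: "window (\<lambda>i. x (i + d)) i j = window x (i + d) (j + d)"
  by (simp add: window_eq_iff algebra_simps)

lemma window_subinterval:
  assumes "i \<le> i'" "i' \<le> j'" "j' \<le> j"
  shows "window x i j = window x i i' @ window x i' j' @ window x j' j"
  using assms by (simp add: window_append)

lemma sublist_window:
  assumes "i \<le> i'" "j' \<le> j"
  shows "sublist (window x i' j') (window x i j)"
proof (cases "i' \<le> j'")
  case True
  then show ?thesis using window_subinterval[OF assms(1) True assms(2), of x]
    by (auto simp: sublist_def)
qed simp

lemma window_reflect: "window (\<lambda>i. x (- 1 - i)) i j = rev (window x (- j) (- i))"
  by (rule nth_equalityI) (auto simp: nth_window rev_nth algebra_simps)

definition word_image :: "('a \<Rightarrow> 'b list) \<Rightarrow> 'a list \<Rightarrow> 'b list" where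
  "word_image s w = concat (map s w)"

lemma subst_ext_eq: "subst_ext = word_image"
  by (intro ext) (simp add: subst_ext_def word_image_def)

lemma word_image_simps [simp]:
  "word_image s [] = []" "word_image s (a # w) = s a @ word_image s w"
  "word_image s (v @ w) = word_image s v @ word_image s w"
  by (simp_all add: word_image_def)

lemma word_image_comp: "word_image f (word_image g w) = word_image (\<lambda>a. word_image f (g a)) w"
  by (induction w) auto

lemma word_image_cong: "(\<And>a. a \<in> set w \<Longrightarrow> f a = g a) \<Longrightarrow> word_image f w = word_image g w"
  by (induction w) auto

lemma rev_word_image: "rev (word_image s w) = word_image (\<lambda>a. rev (s a)) (rev w)"
  by (induction w) auto

text \<open>A parsing records where the images of the letters of \<open>y\<close> sit in \<open>x\<close>: a point \<open>x\<close> is a shift of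
  the image of \<open>y\<close> exactly when a suitable \<open>c\<close> exists. The cut function \<open>c\<close> is kept explicit and is
  not normalised by \<open>c 0 = 0\<close>, so that shifting and composing parsings amount to shifting and
  composing cut functions.\<close>

definition parse :: "('a \<Rightarrow> 'b list) \<Rightarrow> (int \<Rightarrow> 'b) \<Rightarrow> (int \<Rightarrow> 'a) \<Rightarrow> (int \<Rightarrow> int) \<Rightarrow> bool" where
  "parse s x y c \<longleftrightarrow> (\<forall>m. c m < c (m + 1) \<and> window x (c m) (c (m + 1)) = s (y m))"

lemma parse_less: "parse s x y c \<Longrightarrow> c m < c (m + 1)"
  by (simp add: parse_def)

lemma parse_step: "parse s x y c \<Longrightarrow> c (m + 1) = c m + int (length (s (y m)))"
  unfolding parse_def by (metis length_window diff_add_cancel add.commute diff_gt_0_iff_gt int_nat_eq less_le)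

lemma parse_nonempty: "parse s x y c \<Longrightarrow> s (y m) \<noteq> []"
  unfolding parse_def by (metis window_eq_Nil_iff not_less)

lemma parse_strict_mono:
  assumes "parse s x y c" shows "strict_mono c"
proof (rule strict_monoI)
  fix i j :: int assume "i < j"
  then show "c i < c j"
  proof (induction j rule: int_gr_induct)
    case base then show ?case using parse_less[OF assms] by simp
  next
    case (step j) then show ?case using parse_less[OF assms, of j] by simp
  qed
qed

lemma parse_le_iff: "parse s x y c \<Longrightarrow> c i \<le> c j \<longleftrightarrow> i \<le> j"
  using parse_strict_mono strict_mono_less_eq by blast

lemma parse_less_iff: "parse s x y c \<Longrightarrow> c i < c j \<longleftrightarrow> i < j"
  using parse_strict_mono strict_mono_less by blast

lemma parse_inj: "parse s x y c \<Longrightarrow> c i = c j \<longleftrightarrow> i = j"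
  by (meson parse_strict_mono strict_mono_eq)

lemma parse_expand:
  assumes p: "parse s x y c" and "i \<le> j" shows "j - i \<le> c j - c i"
  using \<open>i \<le> j\<close>
proof (induction j rule: int_ge_induct)
  case (step j) then show ?case using parse_less[OF p, of j] by simp
qed simp

lemma parse_window:
  assumes p: "parse s x y c" and "i \<le> j"
  shows "window x (c i) (c j) = word_image s (window y i j)"
  using \<open>i \<le> j\<close>
proof (induction j rule: int_ge_induct)
  case (step j)
  have "window x (c i) (c (j + 1)) = window x (c i) (c j) @ window x (c j) (c (j + 1))"
    using p step(1) by (simp add: window_append parse_le_iff)
  also have "\<dots> = word_image s (window y i j @ [y j])"
    using step p by (simp add: parse_def)
  also have "window y i j @ [y j] = window y i (j + 1)"
    using step(1) by (metis window_append window_single zle_add1_eq_le less_add_one order_less_imp_le)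
  finally show ?case .
qed simp

lemma parse_covers:
  assumes p: "parse s x y c" shows "\<exists>m. c m \<le> i \<and> i < c (m + 1)"
proof -
  have lower: "c m \<le> i" if "m \<le> - \<bar>i\<bar> - \<bar>c 0\<bar>" for m
    using parse_expand[OF p, of m 0] that by linarith
  have upper: "i < c m" if "\<bar>i\<bar> + \<bar>c 0\<bar> + 1 \<le> m" for m
    using parse_expand[OF p, of 0 m] that by linarith
  have bdd: "m \<le> \<bar>i\<bar> + \<bar>c 0\<bar> + 1" if "c m \<le> i" for m
    using upper[of m] that by linarith
  define S where "S = {m. c m \<le> i} \<inter> {- \<bar>i\<bar> - \<bar>c 0\<bar>..}"
  have fin: "finite S"
    by (rule finite_subset[of _ "{- \<bar>i\<bar> - \<bar>c 0\<bar>..\<bar>i\<bar> + \<bar>c 0\<bar> + 1}"]) (auto simp: S_def bdd)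
  have ne: "S \<noteq> {}" using lower[of "- \<bar>i\<bar> - \<bar>c 0\<bar>"] by (auto simp: S_def)
  let ?m = "Max S"
  have "?m \<in> S" using fin ne by (rule Max_in)
  moreover have "?m + 1 \<notin> S" using Max_ge[OF fin, of "?m + 1"] by auto
  ultimately have "c ?m \<le> i \<and> i < c (?m + 1)" by (auto simp: S_def)
  then show ?thesis by blast
qed

lemma parse_reindex: "parse s x y c \<Longrightarrow> parse s x (\<lambda>m. y (m + d)) (\<lambda>m. c (m + d))"
  unfolding parse_def by (metis add.commute add.left_commute)

lemma parse_translate: "parse s x y c \<Longrightarrow> parse s (\<lambda>i. x (i + k)) y (\<lambda>m. c m - k)"
  by (simp add: parse_def window_shift)

lemma parse_reflect:
  assumes "parse s x y c"
  shows "parse (\<lambda>a. rev (s a)) (\<lambda>i. x (- 1 - i)) (\<lambda>m. y (- 1 - m)) (\<lambda>m. - c (- m))"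
  unfolding parse_def
proof
  fix m :: int
  have eq: "- 1 - m + 1 = - m" "- (m + 1) = - 1 - m" by simp_all
  show "- c (- m) < - c (- (m + 1)) \<and>
    window (\<lambda>i. x (- 1 - i)) (- c (- m)) (- c (- (m + 1))) = rev (s (y (- 1 - m)))"
    using assms[unfolded parse_def, rule_format, of "- 1 - m"]
    unfolding window_reflect eq by simp
qed

lemma parse_agree_aux:
  assumes "parse s x y c" "parse s x' y' c'" "c i = c' i"
    and "i \<le> j" "\<And>m. i \<le> m \<Longrightarrow> m < j \<Longrightarrow> y m = y' m"
  shows "c j = c' j"
  using assms(4,5)
proof (induction j rule: int_ge_induct)
  case base then show ?case using assms(3) by simp
next
  case (step j)
  then show ?case using parse_step[OF assms(1), of j] parse_step[OF assms(2), of j] by auto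
qed

lemma parse_agree_aux':
  assumes "parse s x y c" "parse s x' y' c'" "c i = c' i"
    and "j \<le> i" "\<And>m. j \<le> m \<Longrightarrow> m < i \<Longrightarrow> y m = y' m"
  shows "c j = c' j"
  using assms(4,5)
proof (induction j rule: int_le_induct)
  case base then show ?case using assms(3) by simp
next
  case (step j)
  then show ?case using parse_step[OF assms(1), of "j - 1"] parse_step[OF assms(2), of "j - 1"] by auto
qed

text \<open>Cuts are determined from a base point outwards, so only the letters in between matter. Because of
  this locality finite labels can stand for points, and limits may be taken on both sides of a
  parsing.\<close>

lemma parse_agree_cut:
  assumes "parse s x y c" "parse s x' y' c'" "c k = c' k" "i \<le> k" "k \<le> j" "i \<le> m" "m \<le> j"
    and "\<And>m. i \<le> m \<Longrightarrow> m < j \<Longrightarrow> y m = y' m"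
  shows "c m = c' m"
proof (cases "k \<le> m")
  case True then show ?thesis using parse_agree_aux[OF assms(1-3) True] assms by auto
next
  case False
  then have "m \<le> k" by simp
  then show ?thesis using parse_agree_aux'[OF assms(1-3)] assms by auto
qed

lemma parse_agree_image:
  assumes "parse s x y c" "parse s x' y' c'" "c k = c' k" "i \<le> k" "k \<le> j"
    and "\<And>m. i \<le> m \<Longrightarrow> m < j \<Longrightarrow> y m = y' m" and "c i \<le> n" "n < c j"
  shows "x n = x' n"
proof -
  obtain m where m: "c m \<le> n" "n < c (m + 1)" using parse_covers[OF assms(1)] by blast
  have "i < m + 1" "m < j" using m assms(7,8) parse_less_iff[OF assms(1)] by (meson order.strict_trans1)+
  then have im: "i \<le> m" "m < j" by simp_all
  have eq: "c m = c' m" "c (m + 1) = c' (m + 1)"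
    by (rule parse_agree_cut[OF assms(1-5)], use im assms(6) in auto)+
  have "window x (c m) (c (m + 1)) = window x' (c m) (c (m + 1))"
    using assms(1,2) im assms(6)[of m] eq unfolding parse_def by metis
  then have "x (c m + (n - c m)) = x' (c m + (n - c m))" using m unfolding window_eq_iff
    by (metis diff_ge_0_iff_ge diff_strict_right_mono)
  then show ?thesis by simp
qed

lemma parse_unique:
  assumes "parse s x y c" "parse s x' y c'" "c k = c' k"
  shows "c = c'" "x = x'"
proof -
  show "c = c'"
  proof
    fix m show "c m = c' m"
      by (rule parse_agree_cut[OF assms, where i="min k m" and j="max k m"]) auto
  qed
  show "x = x'"
  proof
    fix n
    obtain m where "c m \<le> n" "n < c (m + 1)" using parse_covers[OF assms(1)] by blast
    moreover have "c (min k m) \<le> c m" "c (m + 1) \<le> c (max k (m + 1))"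
      using assms(1) by (auto simp: parse_le_iff)
    ultimately show "x n = x' n"
      by (intro parse_agree_image[OF assms, where i="min k m" and j="max k (m+1)"]) auto
  qed
qed

lemma parse_exists:
  assumes ne: "\<And>m. s (y m) \<noteq> []"
  shows "\<exists>x c. parse s x y c \<and> c 0 = k"
proof -
  define len where "len m = int (length (s (y m)))" for m
  define c where "c m = k + (if m \<ge> 0 then sum len {0..<m} else - sum len {m..<0})" for m :: int
  have step: "c (m + 1) = c m + len m" for m
  proof (cases "m \<ge> 0")
    case True
    have "{0..<m+1} = insert m {0..<m}" using True by auto
    then show ?thesis using True by (simp add: c_def)
  next
    case False
    then have "{m..<0} = insert m {m+1..<0}" by auto
    then have "sum len {m..<0} = len m + sum len {m+1..<0}" by simp
    then show ?thesis using False by (cases "m = -1") (auto simp: c_def)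
  qed
  have pos: "len m > 0" for m using ne[of m] by (simp add: len_def)
  have less: "c m < c (m + 1)" for m using step[of m] pos[of m] by simp
  have mono: "c i < c j" if "i < j" for i j using that
  proof (induction j rule: int_gr_induct)
    case base then show ?case using less by simp
  next
    case (step j) then show ?case using less[of j] by simp
  qed
  define x where "x i = (let m = (SOME m. c m \<le> i \<and> i < c (m + 1)) in s (y m) ! nat (i - c m))" for i
  have x: "x i = s (y m) ! nat (i - c m)" if "c m \<le> i" "i < c (m + 1)" for i m
  proof -
    have "m' = m" if "c m' \<le> i \<and> i < c (m' + 1)" for m'
    proof -
      have "\<not> m' + 1 \<le> m" "\<not> m + 1 \<le> m'"
        using mono[of "m' + 1" m] mono[of "m + 1" m'] that \<open>c m \<le> i\<close> \<open>i < c (m + 1)\<close>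
        by (fastforce simp: le_less)+
      then show ?thesis by simp
    qed
    then have "(SOME m. c m \<le> i \<and> i < c (m + 1)) = m" using that by (metis (mono_tags, lifting) someI)
    then show ?thesis by (simp add: x_def)
  qed
  have "parse s x y c"
    unfolding parse_def
  proof (intro allI conjI less)
    fix m
    show "window x (c m) (c (m + 1)) = s (y m)"
    proof (rule nth_equalityI)
      show "length (window x (c m) (c (m + 1))) = length (s (y m))"
        using step[of m] by (simp add: len_def)
      fix n assume "n < length (window x (c m) (c (m + 1)))"
      then show "window x (c m) (c (m + 1)) ! n = s (y m) ! n"
        using x[of m "c m + int n"] by (simp add: nth_window)
    qed
  qed
  moreover have "c 0 = k" by (simp add: c_def)
  ultimately show ?thesis by blast
qed

lemma parse_compose:
  assumes "parse g z y c" "parse f x z d"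
  shows "parse (\<lambda>a. word_image f (g a)) x y (\<lambda>m. d (c m))"
  unfolding parse_def
proof (intro allI conjI)
  fix m
  have "c m < c (m + 1)" using parse_less[OF assms(1)] .
  then show "d (c m) < d (c (m + 1))" using assms(2) by (simp add: parse_less_iff)
  show "window x (d (c m)) (d (c (m + 1))) = word_image f (g (y m))"
    using parse_window[OF assms(2), of "c m" "c (m + 1)"] parse_less[OF assms(1), of m] assms(1)
    by (simp add: parse_def)
qed

lemma parse_decompose:
  assumes p: "parse (\<lambda>a. word_image f (g a)) x y e" and f: "\<And>b. f b \<noteq> []"
  shows "\<exists>z c d. parse g z y c \<and> parse f x z d \<and> e = (\<lambda>m. d (c m)) \<and> c 0 = 0"
proof -
  have "g (y m) \<noteq> []" for m using parse_nonempty[OF p, of m] by auto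
  then obtain z c where zc: "parse g z y c" "c 0 = 0" using parse_exists[of g y 0] by blast
  obtain x' d where xd: "parse f x' z d" "d 0 = e 0" using parse_exists[of f z "e 0"] f by blast
  have "parse (\<lambda>a. word_image f (g a)) x' y (\<lambda>m. d (c m))" by (rule parse_compose[OF zc(1) xd(1)])
  then have "e = (\<lambda>m. d (c m))" "x = x'" using parse_unique[OF p _, of x' _ 0] xd(2) zc(2) by metis+
  with zc xd show ?thesis by blast
qed

lemma parse_cong:
  "parse s x y c \<Longrightarrow> (\<And>m. s (y m) = s' (y m)) \<Longrightarrow> parse s' x y c"
  by (simp add: parse_def)

section \<open>A defect theorem for infinite words\<close>

definition subst_stream :: "('a \<Rightarrow> 'b list) \<Rightarrow> 'a stream \<Rightarrow> 'b stream" where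
  "subst_stream s u = flat (smap s u)"

lemma subst_stream_unfold: "s (shd u) \<noteq> [] \<Longrightarrow> subst_stream s u = s (shd u) @- subst_stream s (stl u)"
  unfolding subst_stream_def by (subst flat_unfold) auto

lemma subst_stream_Stream [simp]: "s a \<noteq> [] \<Longrightarrow> subst_stream s (a ## u) = s a @- subst_stream s u"
  by (simp add: subst_stream_def)

lemma subst_stream_shift:
  "(\<forall>a\<in>set w. s a \<noteq> []) \<Longrightarrow> subst_stream s (w @- u) = word_image s w @- subst_stream s u"
  by (induction w) auto

lemma subst_stream_smap: "subst_stream s (smap f u) = subst_stream (\<lambda>a. s (f a)) u"
  by (simp add: subst_stream_def stream.map_comp o_def)

lemma sset_subst_stream: "(\<forall>a\<in>sset u. s a \<noteq> []) \<Longrightarrow> sset (subst_stream s u) = (\<Union>a\<in>sset u. set (s a))"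
  unfolding subst_stream_def by (subst sset_flat) (auto simp: stream.set_map)

lemma subst_stream_comp:
  assumes "\<forall>a\<in>sset u. g a \<noteq> []" "\<forall>a\<in>sset u. \<forall>b\<in>set (g a). f b \<noteq> []"
  shows "subst_stream f (subst_stream g u) = subst_stream (\<lambda>a. word_image f (g a)) u"
proof -
  have ne: "word_image f w \<noteq> []" if "w \<noteq> []" "\<forall>b\<in>set w. f b \<noteq> []" for w
    using that by (cases w) auto
  have "subst_stream f (subst_stream g u) !! n = subst_stream (\<lambda>a. word_image f (g a)) u !! n" for n
    using assms
  proof (induction n arbitrary: u rule: less_induct)
    case (less n)
    let ?a = "shd u"
    let ?w = "word_image f (g ?a)"
    have a: "?a \<in> sset u" "sset (stl u) \<subseteq> sset u" by (simp_all add: shd_sset stl_sset subsetI)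
    then have w: "?w \<noteq> []" using less.prems ne by blast
    have "subst_stream f (subst_stream g u) = ?w @- subst_stream f (subst_stream g (stl u))"
      using less.prems a by (subst subst_stream_unfold) (auto simp: subst_stream_shift)
    moreover have "subst_stream (\<lambda>a. word_image f (g a)) u = ?w @- subst_stream (\<lambda>a. word_image f (g a)) (stl u)"
      using w by (subst subst_stream_unfold) auto
    moreover have "subst_stream f (subst_stream g (stl u)) !! (n - length ?w) =
        subst_stream (\<lambda>a. word_image f (g a)) (stl u) !! (n - length ?w)" if "n \<ge> length ?w"
    proof (rule less.IH)
      show "n - length ?w < n" using w that by (metis diff_less length_greater_0_conv order.strict_trans2)
    qed (use less.prems a in auto)
    ultimately show ?case by (simp add: shift_snth)
  qed
  then show ?thesis by (metis ext stream_smap_nats)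
qed

lemma shift_eq_prefix:
  assumes "v @- s = w @- t" "length v \<le> length w" shows "\<exists>w'. w = v @ w'"
proof -
  have "take (length v) w = stake (length v) (w @- t)" using assms(2) by (simp add: stake_shift)
  also have "\<dots> = v" unfolding assms(1)[symmetric] by (simp add: stake_shift)
  finally show ?thesis by (metis append_take_drop_id)
qed

text \<open>The alphabet \<open>A\<close> of a substitution with values in nonempty words \<open>factors through\<close> \<open>k\<close>
  letters if the substitution is a composition \<open>A\<^sup>+ \<rightarrow> {0..<k}\<^sup>+ \<rightarrow> B\<^sup>+\<close>.\<close>

definition factors_through :: "('a \<Rightarrow> 'b list) \<Rightarrow> 'a set \<Rightarrow> nat \<Rightarrow> bool" where
  "factors_through s A k \<longleftrightarrow> (\<exists>g f. (\<forall>a\<in>A. g a \<noteq> [] \<and> set (g a) \<subseteq> {..<k} \<and> s a = word_image f (g a)) \<and>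
     (\<forall>i::nat. f i \<noteq> []))"

definition start_related :: "('a \<Rightarrow> 'b list) \<Rightarrow> 'a set \<Rightarrow> 'a rel" where
  "start_related s A = {(shd u, shd v) |u v. sset u \<subseteq> A \<and> sset v \<subseteq> A \<and> subst_stream s u = subst_stream s v}"

lemma start_relatedI:
  "sset u \<subseteq> A \<Longrightarrow> sset v \<subseteq> A \<Longrightarrow> subst_stream s u = subst_stream s v \<Longrightarrow>
    (shd u, shd v) \<in> start_related s A"
  unfolding start_related_def by blast

lemma start_relatedE:
  assumes "(a, b) \<in> start_related s A"
  obtains u v where "sset u \<subseteq> A" "sset v \<subseteq> A" "shd u = a" "shd v = b"
    "subst_stream s u = subst_stream s v"
  using assms unfolding start_related_def by auto

lemma start_related_sym: "(a, b) \<in> start_related s A \<Longrightarrow> (b, a) \<in> start_related s A"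
  unfolding start_related_def by (auto, metis)

lemma start_related_in: "(a, b) \<in> start_related s A \<Longrightarrow> a \<in> A \<and> b \<in> A"
  unfolding start_related_def by (auto simp: shd_sset subsetD)

lemma factors_through_trivial:
  assumes "finite A" "\<And>a. a \<in> A \<Longrightarrow> s a \<noteq> []"
  shows "factors_through s A (card A)"
proof -
  obtain h where h: "bij_betw h A {..<card A}"
    using ex_bij_betw_finite_nat[OF assms(1)] by (auto simp: atLeast0LessThan)
  define f where "f i = (if i < card A then s (inv_into A h i) else [undefined])" for i
  have "s a = f (h a)" if "a \<in> A" for a
    using h that by (auto simp: f_def bij_betw_def inv_into_f_f)
  moreover have "h a < card A" if "a \<in> A" for a using h that by (auto simp: bij_betw_def)
  moreover have "f i \<noteq> []" for i
    using h assms(2) by (auto simp: f_def bij_betw_def inv_into_into)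
  ultimately show ?thesis unfolding factors_through_def
    by (intro exI[of _ "\<lambda>a. [h a]"] exI[of _ f]) auto
qed

lemma factors_through_mono: "factors_through s A k \<Longrightarrow> k \<le> l \<Longrightarrow> factors_through s A l"
  unfolding factors_through_def by (meson lessThan_subset_iff order_trans)

lemma factors_through_comp:
  assumes "factors_through s' A' k"
    and "\<And>a. a \<in> A \<Longrightarrow> h a \<noteq> [] \<and> set (h a) \<subseteq> A' \<and> s a = word_image s' (h a)"
  shows "factors_through s A k"
proof -
  obtain g f where gf: "\<forall>a\<in>A'. g a \<noteq> [] \<and> set (g a) \<subseteq> {..<k} \<and> s' a = word_image f (g a)"
      "\<forall>i::nat. f i \<noteq> []"
    using assms(1) unfolding factors_through_def by blast
  have "word_image g (h a) \<noteq> [] \<and> set (word_image g (h a)) \<subseteq> {..<k} \<and> s a = word_image f (word_image g (h a))"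
    if "a \<in> A" for a
  proof -
    note h = assms(2)[OF that]
    have "word_image g (h a) \<noteq> []" using h gf(1) by (cases "h a") auto
    moreover have "set (word_image g (h a)) \<subseteq> {..<k}"
      using h gf(1) by (fastforce simp: word_image_def)
    moreover have "word_image f (word_image g (h a)) = word_image s' (h a)"
      unfolding word_image_comp by (rule word_image_cong) (use h gf(1) in auto)
    ultimately show ?thesis using h by simp
  qed
  then show ?thesis unfolding factors_through_def using gf(2)
    by (intro exI[of _ "\<lambda>a. word_image g (h a)"] exI[of _ f]) simp
qed

text \<open>Suppose the images of two streams agree, and call their first letters related. If every letter
  is connected, through related letters, to one in \<open>S\<close>, then \<open>card S\<close> letters suffice. Indeed, of two
  related letters \<open>a \<noteq> b\<close> the image of one, say \<open>a\<close>, is a prefix of the image of the other. If the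
  images are equal, \<open>b\<close> may be replaced by \<open>a\<close>; otherwise \<open>s b = s a @ w\<close>, and \<open>s\<close> factors as
  \<open>b \<mapsto> ab\<close> followed by the substitution that has \<open>w\<close> as image of \<open>b\<close>. The new substitution is
  shorter. Relations survive with \<open>b\<close> replaced by \<open>a\<close> as first letter, and cancelling the
  common first letter \<open>a\<close> shows that \<open>b\<close> is related to a letter other than \<open>b\<close>.\<close>

lemma defect:
  assumes "finite A" "\<And>a. a \<in> A \<Longrightarrow> s a \<noteq> []" "S \<subseteq> A"
    and "\<And>a. a \<in> A \<Longrightarrow> \<exists>b\<in>S. (a, b) \<in> (start_related s A)\<^sup>*"
  shows "factors_through s A (card S)"
  using assms
proof (induction "\<Sum>a\<in>A. length (s a)" arbitrary: s A S rule: less_induct)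
  case less
  note fin = less.prems(1) and ne = less.prems(2) and SA = less.prems(3) and conn = less.prems(4)
  show ?case
  proof (cases "S = A")
    case True
    then show ?thesis using factors_through_trivial fin ne by auto
  next
    case False
    then obtain a0 where a0: "a0 \<in> A" "a0 \<notin> S" using SA by blast
    then obtain b0 where b0: "b0 \<in> S" "(a0, b0) \<in> (start_related s A)\<^sup>*" using conn by blast
    have "\<exists>a b. (a, b) \<in> start_related s A \<and> a \<noteq> b"
    proof (rule ccontr)
      assume no: "\<not> ?thesis"
      have "(a0, c) \<in> (start_related s A)\<^sup>* \<Longrightarrow> c = a0" for c
        by (induction rule: rtrancl_induct) (use no in auto)
      then show False using a0 b0 by auto
    qed
    then obtain a1 b1 where ab1: "(a1, b1) \<in> start_related s A" "a1 \<noteq> b1" by blast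
    obtain a b where ab: "(a, b) \<in> start_related s A" "a \<noteq> b" "length (s a) \<le> length (s b)"
      using ab1 start_related_sym[OF ab1(1)] nat_le_linear by metis
    obtain u v where uv: "sset u \<subseteq> A" "sset v \<subseteq> A" "shd u = a" "shd v = b"
        "subst_stream s u = subst_stream s v"
      using ab(1) by (rule start_relatedE)
    have aA: "a \<in> A" and bA: "b \<in> A" using start_related_in[OF ab(1)] by auto
    have "s a @- subst_stream s (stl u) = s b @- subst_stream s (stl v)"
      using uv ne aA bA by (metis subst_stream_unfold)
    then obtain w where w: "s b = s a @ w" using shift_eq_prefix ab(3) by metis
    define h where "h c = (if c = b then a else c)" for c
    have hA: "h c \<in> A - {b}" if "c \<in> A" for c using that aA ab(2) by (auto simp: h_def)
    have card_hS: "card (h ` S) \<le> card S" using SA fin by (meson card_image_le finite_subset)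
    show ?thesis
    proof (cases "w = []")
      case True
      then have sh: "s (h c) = s c" for c using w by (auto simp: h_def)
      let ?A = "A - {b}"
      have "factors_through s ?A (card (h ` S))"
      proof (rule less.hyps)
        have "(\<Sum>c\<in>?A. length (s c)) + length (s b) = (\<Sum>c\<in>A. length (s c))"
          using fin bA by (simp add: sum.remove)
        then show "(\<Sum>c\<in>?A. length (s c)) < (\<Sum>c\<in>A. length (s c))" using ne[OF bA]
          by (metis length_greater_0_conv less_add_same_cancel1)
        show "finite ?A" "h ` S \<subseteq> ?A" using fin SA hA by auto
        show "s c \<noteq> []" if "c \<in> ?A" for c using that ne by auto
        have edge: "(h c, h d) \<in> start_related s ?A" if cd: "(c, d) \<in> start_related s A" for c d
        proof -
          obtain u v where "sset u \<subseteq> A" "sset v \<subseteq> A" "shd u = c" "shd v = d"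
              "subst_stream s u = subst_stream s v"
            using cd by (rule start_relatedE)
          then show ?thesis using start_relatedI[of "smap h u" ?A "smap h v" s] hA
            by (auto simp: subst_stream_smap sh stream.set_map)
        qed
        have path: "(h c, h d) \<in> (start_related s ?A)\<^sup>*" if "(c, d) \<in> (start_related s A)\<^sup>*" for c d
          using that by (induction rule: rtrancl_induct) (auto intro: edge rtrancl.rtrancl_into_rtrancl)
        show "\<exists>d\<in>h ` S. (c, d) \<in> (start_related s ?A)\<^sup>*" if c: "c \<in> ?A" for c
        proof -
          obtain d where "d \<in> S" "(c, d) \<in> (start_related s A)\<^sup>*" using conn c by blast
          moreover have "h c = c" using c by (auto simp: h_def)
          ultimately show ?thesis using path by (metis imageI)
        qed
      qed
      then have "factors_through s A (card (h ` S))"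
        by (rule factors_through_comp[where h = "\<lambda>c. [h c]"]) (use hA sh in auto)
      then show ?thesis using card_hS factors_through_mono by blast
    next
      case False
      define s' where "s' = s(b := w)"
      define g where "g c = (if c = b then [a, b] else [c])" for c
      have gs: "word_image s' (g c) = s c" for c using w ab(2) by (auto simp: g_def s'_def)
      have gA: "set (g c) \<subseteq> A" "g c \<noteq> []" if "c \<in> A" for c using that aA by (auto simp: g_def)
      have ne': "s' c \<noteq> []" if "c \<in> A" for c using that ne False by (auto simp: s'_def)
      have gstr: "subst_stream s' (subst_stream g u) = subst_stream s u" "sset (subst_stream g u) \<subseteq> A"
          "shd (subst_stream g u) = h (shd u)" if "sset u \<subseteq> A" for u
      proof -
        have "\<forall>c\<in>sset u. g c \<noteq> []" "\<forall>c\<in>sset u. \<forall>d\<in>set (g c). s' d \<noteq> []"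
          using that gA ne' by (meson subsetD)+
        from subst_stream_comp[OF this] show "subst_stream s' (subst_stream g u) = subst_stream s u"
          by (simp add: gs)
        show "sset (subst_stream g u) \<subseteq> A" using that gA by (subst sset_subst_stream) (blast, blast)
        show "shd (subst_stream g u) = h (shd u)"
          by (subst subst_stream_unfold) (auto simp: g_def h_def)
      qed
      have "factors_through s' A (card (h ` S))"
      proof (rule less.hyps)
        have "(\<Sum>c\<in>A - {b}. length (s' c)) = (\<Sum>c\<in>A - {b}. length (s c))"
          by (rule sum.cong) (auto simp: s'_def)
        moreover have "length w < length (s b)" using w ne[OF aA] by simp
        ultimately show "(\<Sum>c\<in>A. length (s' c)) < (\<Sum>c\<in>A. length (s c))"
          using fin bA by (simp add: sum.remove s'_def)
        show "finite A" "h ` S \<subseteq> A" using fin SA hA by auto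
        show "s' c \<noteq> []" if "c \<in> A" for c using ne'[OF that] .
        have edge: "(h c, h d) \<in> start_related s' A" if cd: "(c, d) \<in> start_related s A" for c d
        proof -
          obtain u v where "sset u \<subseteq> A" "sset v \<subseteq> A" "shd u = c" "shd v = d"
              "subst_stream s u = subst_stream s v"
            using cd by (rule start_relatedE)
          then show ?thesis using start_relatedI[of "subst_stream g u" A "subst_stream g v" s']
            by (simp add: gstr)
        qed
        have path: "(h c, h d) \<in> (start_related s' A)\<^sup>*" if "(c, d) \<in> (start_related s A)\<^sup>*" for c d
          using that by (induction rule: rtrancl_induct) (auto intro: edge rtrancl.rtrancl_into_rtrancl)
        have conn': "\<exists>d\<in>h ` S. (c, d) \<in> (start_related s' A)\<^sup>*" if c: "c \<in> A" "c \<noteq> b" for c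
        proof -
          obtain d where "d \<in> S" "(c, d) \<in> (start_related s A)\<^sup>*" using conn c by blast
          moreover have "h c = c" using c by (auto simp: h_def)
          ultimately show ?thesis using path by (metis imageI)
        qed
        \<comment> \<open>cancelling \<open>a\<close> relates \<open>b\<close> to the first letter of the rest of \<open>g u\<close>\<close>
        let ?u = "subst_stream g (stl u)" and ?v = "b ## subst_stream g (stl v)"
        have su: "sset (stl u) \<subseteq> A" "sset (stl v) \<subseteq> A" using uv by (meson stl_sset subset_iff)+
        have "subst_stream g u = a ## ?u" using uv ab(2) by (subst subst_stream_unfold) (auto simp: g_def)
        moreover have "subst_stream g v = a ## ?v"
          using uv by (subst subst_stream_unfold) (auto simp: g_def)
        ultimately have "subst_stream s' (a ## ?u) = subst_stream s' (a ## ?v)"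
          using uv gstr(1) by metis
        then have "subst_stream s' ?u = subst_stream s' ?v" using ne'[OF aA] by simp
        then have "(b, h (shd (stl u))) \<in> start_related s' A"
          using start_relatedI[of ?v A ?u s'] gstr[OF su(1)] gstr[OF su(2)] bA by simp
        moreover have "h (shd (stl u)) \<in> A - {b}" using hA su(1) shd_sset by (metis subsetD)
        ultimately show "\<exists>d\<in>h ` S. (c, d) \<in> (start_related s' A)\<^sup>*" if "c \<in> A" for c
          using that conn' by (cases "c = b") (auto, meson converse_rtrancl_into_rtrancl)
      qed
      then have "factors_through s A (card (h ` S))"
        by (rule factors_through_comp[where h = g]) (use gA gs in auto)
      then show ?thesis using card_hS factors_through_mono by blast
    qed
  qed
qed

section \<open>Elementary substitutions\<close>

definition elementary :: "('a \<Rightarrow> 'b list) \<Rightarrow> 'a set \<Rightarrow> bool" where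
  "elementary s A \<longleftrightarrow> (\<forall>k<card A. \<not> factors_through s A k)"

lemma elementary_rev:
  assumes "elementary s A" shows "elementary (\<lambda>a. rev (s a)) A"
proof -
  have "factors_through s A k" if F: "factors_through (\<lambda>a. rev (s a)) A k" for k
  proof -
    obtain g f where gf: "\<forall>a\<in>A. g a \<noteq> [] \<and> set (g a) \<subseteq> {..<k} \<and> rev (s a) = word_image f (g a)"
        "\<forall>i::nat. f i \<noteq> []"
      using F unfolding factors_through_def by blast
    have "s a = word_image (\<lambda>i. rev (f i)) (rev (g a))" if "a \<in> A" for a
      using gf(1) that by (metis rev_word_image rev_rev_ident)
    then show ?thesis unfolding factors_through_def using gf
      by (intro exI[of _ "\<lambda>a. rev (g a)"] exI[of _ "\<lambda>i. rev (f i)"]) simp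
  qed
  then show ?thesis using assms unfolding elementary_def by blast
qed

locale elementary_subst =
  fixes s :: "'a \<Rightarrow> 'b list" and A :: "'a set"
  assumes fin: "finite A" and ne: "a \<in> A \<Longrightarrow> s a \<noteq> []" and elem: "elementary s A"
begin

lemma unfold:
  assumes "sset u \<subseteq> A" shows "subst_stream s u = s (shd u) @- subst_stream s (stl u)"
  using assms ne by (intro subst_stream_unfold) (meson shd_sset subsetD)

lemma sset_stl: "sset u \<subseteq> A \<Longrightarrow> sset (stl u) \<subseteq> A"
  by (meson stl_sset subset_iff)

lemma shd_in: "sset u \<subseteq> A \<Longrightarrow> shd u \<in> A"
  by (meson shd_sset subsetD)

lemma shd_eq:
  assumes "sset u \<subseteq> A" "sset v \<subseteq> A" "subst_stream s u = subst_stream s v"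
  shows "shd u = shd v"
proof (rule ccontr)
  assume neq: "shd u \<noteq> shd v"
  have rel: "(shd u, shd v) \<in> start_related s A" by (rule start_relatedI[OF assms])
  have "factors_through s A (card (A - {shd u}))"
  proof (rule defect[OF fin ne])
    show "\<exists>b\<in>A - {shd u}. (a, b) \<in> (start_related s A)\<^sup>*" if "a \<in> A" for a
      using that rel neq shd_in[OF assms(2)] by (cases "a = shd u") auto
  qed auto
  moreover have "card (A - {shd u}) < card A"
    using fin shd_in[OF assms(1)] by (rule card_Diff1_less)
  ultimately show False using elem unfolding elementary_def by blast
qed

lemma stream_inj:
  assumes "sset u \<subseteq> A" "sset v \<subseteq> A" "subst_stream s u = subst_stream s v"
  shows "u = v"
proof -
  have "u !! n = v !! n" for n
    using assms
  proof (induction n arbitrary: u v)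
    case 0 then show ?case using shd_eq[OF 0] by simp
  next
    case (Suc n)
    have "s (shd u) @- subst_stream s (stl u) = s (shd v) @- subst_stream s (stl v)"
      using Suc.prems(3) unfold[OF Suc.prems(1)] unfold[OF Suc.prems(2)] by argo
    then have "subst_stream s (stl u) = subst_stream s (stl v)" unfolding shd_eq[OF Suc.prems] by simp
    then have "stl u !! n = stl v !! n" using Suc.prems sset_stl by (intro Suc.IH)
    then show ?case by simp
  qed
  then show ?thesis by (metis ext stream_smap_nats)
qed

text \<open>If a word \<open>w\<close> can be completed to two coincidences with images of streams starting with different
  letters \<open>c\<close> and \<open>d\<close>, then \<open>w\<close>, as the image of a new letter, is related to both \<open>c\<close> and \<open>d\<close>.
  This one extra letter costs less than the two letters that it makes superfluous.\<close>

lemma overlap_shd_eq: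
  assumes u: "sset u \<subseteq> A" "sset t \<subseteq> A" "subst_stream s u = w @- subst_stream s t"
    and u': "sset u' \<subseteq> A" "sset t' \<subseteq> A" "subst_stream s u' = w @- subst_stream s t'"
    and w: "w \<noteq> []"
  shows "shd u = shd u'"
proof (rule ccontr)
  assume neq: "shd u \<noteq> shd u'"
  let ?A = "insert None (Some ` A)" and ?s = "case_option w s"
  let ?S = "?A - {Some (shd u), Some (shd u')}"
  have rel: "(None, Some (shd u)) \<in> start_related ?s ?A"
    if "sset u \<subseteq> A" "sset t \<subseteq> A" "subst_stream s u = w @- subst_stream s t" for u t
    using start_relatedI[of "None ## smap Some t" ?A "smap Some u" ?s] that w
    by (auto simp: stream.set_map subst_stream_smap)
  have "factors_through ?s ?A (card ?S)"
  proof (rule defect)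
    show "finite ?A" "?S \<subseteq> ?A" using fin by auto
    show "?s a \<noteq> []" if "a \<in> ?A" for a using that w ne by auto
    show "\<exists>b\<in>?S. (a, b) \<in> (start_related ?s ?A)\<^sup>*" if "a \<in> ?A" for a
    proof (cases "a \<in> ?S")
      case False
      then have "(a, None) \<in> start_related ?s ?A"
        using that rel[OF u] rel[OF u'] start_related_sym by auto
      then show ?thesis by blast
    qed blast
  qed
  then have "factors_through s A (card ?S)"
    by (rule factors_through_comp[where h = "\<lambda>a. [Some a]"]) auto
  moreover have "card ?S < card A"
  proof -
    \<comment> \<open>one letter more, two letters less\<close>
    have "card ?A = Suc (card A)" using fin by (simp add: card_image)
    moreover have "{Some (shd u), Some (shd u')} \<subseteq> ?A" using shd_in[OF u(1)] shd_in[OF u'(1)] by auto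
    moreover have "card {Some (shd u), Some (shd u')} = 2" using neq by simp
    moreover have "0 < card A" using fin shd_in[OF u(1)] card_gt_0_iff by blast
    ultimately show ?thesis using fin by (simp add: card_Diff_subset)
  qed
  ultimately show False using elem unfolding elementary_def by blast
qed

text \<open>Two parsings of a one-sided word without a common cut, the second one starting after \<open>w\<close>.\<close>

definition overlap :: "'b list \<Rightarrow> 'a stream \<Rightarrow> 'a stream \<Rightarrow> bool" where
  "overlap w u t \<longleftrightarrow> sset u \<subseteq> A \<and> sset t \<subseteq> A \<and> subst_stream s u = w @- subst_stream s t \<and>
     (\<forall>n k. length w + length (word_image s (stake n t)) \<noteq> length (word_image s (stake k u)))"

lemma overlap_nonempty: "overlap w u t \<Longrightarrow> w \<noteq> []"
  unfolding overlap_def by (metis add_0 list.size(3) stake.simps(1) word_image_simps(1))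

lemma overlap_shorter:
  assumes "overlap (s (shd u) @ w) u t" shows "overlap w (stl u) t"
proof -
  have A: "sset u \<subseteq> A" "sset t \<subseteq> A" using assms by (auto simp: overlap_def)
  have "s (shd u) @- subst_stream s (stl u) = s (shd u) @- (w @- subst_stream s t)"
    using assms unfold[OF A(1)] by (simp add: overlap_def)
  moreover have "length w + length (word_image s (stake n t)) \<noteq> length (word_image s (stake k (stl u)))" for n k
  proof -
    have "length (s (shd u) @ w) + length (word_image s (stake n t)) \<noteq>
        length (word_image s (stake (Suc k) u))"
      using assms unfolding overlap_def by blast
    then show ?thesis by simp
  qed
  ultimately show ?thesis using A sset_stl by (simp add: overlap_def)
qed

lemma overlap_swap:
  assumes "overlap w u t" "s (shd u) = w @ w'" shows "overlap w' t (stl u)"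
proof -
  have A: "sset u \<subseteq> A" "sset t \<subseteq> A" using assms by (auto simp: overlap_def)
  have "w @- (w' @- subst_stream s (stl u)) = w @- subst_stream s t"
    using assms unfold[OF A(1)] by (simp add: overlap_def)
  moreover have "length w' + length (word_image s (stake n (stl u))) \<noteq> length (word_image s (stake k t))" for n k
  proof -
    have "length w + length (word_image s (stake k t)) \<noteq> length (word_image s (stake (Suc n) u))"
      using assms(1) unfolding overlap_def by blast
    then show ?thesis using assms(2) by simp
  qed
  ultimately show ?thesis using A sset_stl by (simp add: overlap_def)
qed

text \<open>The overlap determines the next letter, hence the next overlap, hence everything to the right.\<close>

lemma overlap_determines:
  assumes "overlap w u t" "overlap w u' t'"
  shows "subst_stream s u !! n = subst_stream s u' !! n"
  using assms
proof (induction n arbitrary: w u t u' t' rule: less_induct)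
  case (less n)
  have A: "sset u \<subseteq> A" "sset u' \<subseteq> A" using less.prems by (auto simp: overlap_def)
  have w: "w \<noteq> []" using overlap_nonempty[OF less.prems(1)] .
  have c: "shd u = shd u'"
    using less.prems w overlap_shd_eq[of u t w u' t'] by (auto simp: overlap_def)
  have eqs: "s (shd u) @- subst_stream s (stl u) = w @- subst_stream s t"
    using less.prems(1) unfold[OF A(1)] by (simp add: overlap_def)
  have sc: "s (shd u) \<noteq> []" using ne shd_in[OF A(1)] by blast
  show ?case
  proof (cases "length (s (shd u)) \<le> length w")
    case True
    then obtain w' where w': "w = s (shd u) @ w'" using shift_eq_prefix[OF eqs] by blast
    have "subst_stream s (stl u) !! (n - length (s (shd u))) = subst_stream s (stl u') !! (n - length (s (shd u)))"
      if "n \<ge> length (s (shd u))"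
    proof (rule less.IH)
      show "n - length (s (shd u)) < n"
        using that sc by (metis diff_less length_greater_0_conv order.strict_trans2)
      show "overlap w' (stl u) t" "overlap w' (stl u') t'"
        using less.prems unfolding w' using c by (auto intro: overlap_shorter)
    qed
    then show ?thesis unfolding unfold[OF A(1)] unfold[OF A(2)] using c by (simp add: shift_snth)
  next
    case False
    then obtain w' where w': "s (shd u) = w @ w'" using shift_eq_prefix[OF eqs[symmetric]] by auto
    have "subst_stream s t !! (n - length w) = subst_stream s t' !! (n - length w)"
      if "n \<ge> length w"
    proof (rule less.IH)
      show "n - length w < n"
        using that w by (metis diff_less length_greater_0_conv order.strict_trans2)
      show "overlap w' t (stl u)" "overlap w' t' (stl u')"
        using overlap_swap[OF less.prems(1) w'] overlap_swap[OF less.prems(2), of w'] c w' by auto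
    qed
    moreover have "subst_stream s u = w @- subst_stream s t" "subst_stream s u' = w @- subst_stream s t'"
      using less.prems by (auto simp: overlap_def)
    ultimately show ?thesis by (simp add: shift_snth)
  qed
qed

end

subsection \<open>Uniqueness of parsings\<close>

definition tail :: "(int \<Rightarrow> 'a) \<Rightarrow> int \<Rightarrow> 'a stream" where
  "tail x i = smap (\<lambda>n. x (i + int n)) nats"

lemma snth_tail [simp]: "tail x i !! n = x (i + int n)"
  by (simp add: tail_def)

lemma stream_eqI: "(\<And>n. u !! n = v !! n) \<Longrightarrow> u = v"
  by (metis ext stream_smap_nats)

lemma shd_tail [simp]: "shd (tail x i) = x i"
  using snth_tail[of x i 0] by simp

lemma stl_tail [simp]: "stl (tail x i) = tail x (i + 1)"
proof (rule stream_eqI)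
  fix n show "stl (tail x i) !! n = tail x (i + 1) !! n"
    using snth_tail[of x i "Suc n"] by (simp add: algebra_simps del: snth_tail) (simp add: algebra_simps)
qed

lemma sset_tail: "sset (tail x i) \<subseteq> range x"
  by (auto simp: tail_def stream.set_map)

lemma stake_tail: "stake n (tail x i) = window x i (i + int n)"
  by (rule nth_equalityI) (simp_all add: nth_window)

lemma shift_tail: "i \<le> j \<Longrightarrow> window x i j @- tail x j = tail x i"
  by (rule stream_eqI) (auto simp: shift_snth nth_window algebra_simps)

lemma subst_stream_tail:
  assumes p: "parse s x y c" shows "subst_stream s (tail y i) = tail x (c i)"
proof -
  have "subst_stream s (tail y i) !! n = tail x (c i) !! n" for n
  proof (induction n arbitrary: i rule: less_induct)
    case (less n)
    let ?w = "s (y i)"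
    have ne: "?w \<noteq> []" using parse_nonempty[OF p] .
    have c: "c (i + 1) = c i + int (length ?w)" using parse_step[OF p] .
    have "tail x (c i) = ?w @- tail x (c (i + 1))"
      using shift_tail[of "c i" "c (i + 1)" x] p by (simp add: parse_def less_imp_le)
    moreover have "subst_stream s (tail y i) = ?w @- subst_stream s (tail y (i + 1))"
      using subst_stream_unfold[of s "tail y i"] ne by simp
    moreover have "subst_stream s (tail y (i + 1)) !! (n - length ?w) = tail x (c (i + 1)) !! (n - length ?w)"
      if "length ?w \<le> n"
      using ne that by (intro less.IH) (metis diff_less length_greater_0_conv order.strict_trans2)
    ultimately show ?case by (simp add: shift_snth del: snth_tail)
  qed
  then show ?thesis by (rule stream_eqI)
qed

definition periodic :: "(int \<Rightarrow> 'a) \<Rightarrow> bool" where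
  "periodic x \<longleftrightarrow> (\<exists>p>0. \<forall>i. x (i + p) = x i)"

context elementary_subst
begin

lemma parse_shared_cut_right:
  assumes p: "parse s x y c" "parse s x y' c'" and r: "range y \<subseteq> A" "range y' \<subseteq> A" and "c i = c' j"
    and "k \<ge> 0"
  shows "y (i + k) = y' (j + k)"
proof -
  have "tail y i = tail y' j"
  proof (rule stream_inj)
    show "subst_stream s (tail y i) = subst_stream s (tail y' j)"
      using subst_stream_tail[OF p(1), of i] subst_stream_tail[OF p(2), of j] \<open>c i = c' j\<close> by simp
  qed (rule order_trans[OF sset_tail r(1)], rule order_trans[OF sset_tail r(2)])
  then have "tail y i !! nat k = tail y' j !! nat k" by simp
  then show ?thesis using \<open>k \<ge> 0\<close> by simp
qed

text \<open>Two parsings with a common cut agree to the right of it and, by reversal, to the left. If there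
  is no common cut, two cuts with the same overlap are followed by the same right-infinite word.
  As there are finitely many overlaps, some overlap recurs arbitrarily far to the left, which
  makes the point periodic.\<close>

lemma parse_unique_aperiodic:
  assumes p: "parse s x y c" "parse s x y' c'" and r: "range y \<subseteq> A" "range y' \<subseteq> A"
    and aper: "\<not> periodic x"
  shows "\<exists>d. \<forall>m. y' m = y (m + d) \<and> c' m = c (m + d)"
proof (cases "\<exists>i j. c i = c' j")
  case True
  then obtain i j where ij: "c i = c' j" by blast
  interpret rv: elementary_subst "\<lambda>a. rev (s a)" A
    by standard (use fin ne elementary_rev[OF elem] in auto)
  have eq: "y (i + k) = y' (j + k)" for k
  proof (cases "k \<ge> 0")
    case True then show ?thesis using parse_shared_cut_right[OF p r ij] by simp
  next
    case False
    have "(\<lambda>m. y (- 1 - m)) (- i + (- 1 - k)) = (\<lambda>m. y' (- 1 - m)) (- j + (- 1 - k))"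
      by (rule rv.parse_shared_cut_right[OF parse_reflect[OF p(1)] parse_reflect[OF p(2)]])
        (use r ij False in auto)
    then show ?thesis by (simp add: algebra_simps)
  qed
  have y': "y' = (\<lambda>m. y (m + (i - j)))"
  proof
    fix m show "y' m = y (m + (i - j))" using eq[of "m - j"] by (simp add: algebra_simps)
  qed
  have "c' = (\<lambda>m. c (m + (i - j)))"
    using parse_unique(1)[OF p(2)[unfolded y'] parse_reindex[OF p(1), of "i - j"], of j] ij by simp
  then show ?thesis using y' by metis
next
  case False
  have "\<forall>m. \<exists>j. c' j < c m \<and> c m < c' (j + 1)"
  proof
    fix m
    obtain j where "c' j \<le> c m" "c m < c' (j + 1)" using parse_covers[OF p(2)] by blast
    moreover have "c' j \<noteq> c m" using False by metis
    ultimately show "\<exists>j. c' j < c m \<and> c m < c' (j + 1)" by (metis order_le_less)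
  qed
  then obtain j where j: "\<And>m. c' (j m) < c m \<and> c m < c' (j m + 1)" by metis
  define w where "w m = window x (c m) (c' (j m + 1))" for m
  have ov: "overlap (w m) (tail y m) (tail y' (j m + 1))" for m
    unfolding overlap_def
  proof (intro conjI allI)
    show "sset (tail y m) \<subseteq> A" "sset (tail y' (j m + 1)) \<subseteq> A"
      by (rule order_trans[OF sset_tail r(1)], rule order_trans[OF sset_tail r(2)])
    show "subst_stream s (tail y m) = w m @- subst_stream s (tail y' (j m + 1))"
      using j[of m] by (simp add: subst_stream_tail[OF p(1)] subst_stream_tail[OF p(2)] w_def shift_tail)
    fix n k
    have "int (length (word_image s (stake n (tail y' (j m + 1))))) = c' (j m + 1 + int n) - c' (j m + 1)"
      using parse_window[OF p(2), of "j m + 1" "j m + 1 + int n", symmetric] parse_le_iff[OF p(2)]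
      by (simp add: stake_tail)
    moreover have "int (length (word_image s (stake k (tail y m)))) = c (m + int k) - c m"
      using parse_window[OF p(1), of m "m + int k", symmetric] parse_le_iff[OF p(1)]
      by (simp add: stake_tail)
    moreover have "int (length (w m)) = c' (j m + 1) - c m" using j[of m] by (simp add: w_def)
    moreover have "c (m + int k) \<noteq> c' (j m + 1 + int n)" using False by metis
    ultimately show "length (w m) + length (word_image s (stake n (tail y' (j m + 1)))) \<noteq>
        length (word_image s (stake k (tail y m)))" by linarith
  qed
  have "finite (w ` {..<0})"
  proof (rule finite_subset)
    let ?F = "\<Union>a\<in>A. set (s a)" and ?L = "Max ((\<lambda>a. length (s a)) ` A)"
    show "w ` {..<0} \<subseteq> {v. set v \<subseteq> ?F \<and> length v \<le> ?L}"
    proof safe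
      fix m a assume "a \<in> set (w m)"
      then obtain i where i: "a = x i" by (auto simp: w_def set_window)
      obtain k where k: "c k \<le> i" "i < c (k + 1)" using parse_covers[OF p(1)] by blast
      then have "a \<in> set (window x (c k) (c (k + 1)))" using i by (simp add: set_window)
      then have "a \<in> set (s (y k))" using p(1) by (simp add: parse_def)
      then show "a \<in> ?F" using r(1) by blast
    next
      fix m
      have "length (w m) \<le> length (s (y' (j m)))"
        using j[of m] parse_step[OF p(2), of "j m"] by (simp add: w_def nat_le_iff)
      also have "\<dots> \<le> ?L" using r(2) fin by (intro Max_ge finite_imageI imageI) auto
      finally show "length (w m) \<le> ?L" .
    qed
    show "finite {v. set v \<subseteq> ?F \<and> length v \<le> ?L}" using fin by (intro finite_lists_length_le) auto
  qed
  then obtain m0 where inf: "infinite {m \<in> {..<0}. w m = w m0}"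
    using pigeonhole_infinite[of "{..<0::int}" w] infinite_Iio by blast
  have far: "\<exists>m<b. w m = w m0" for b
  proof -
    have "\<not> {m \<in> {..<0}. w m = w m0} \<subseteq> {b..<0}" using inf finite_subset by blast
    then obtain m where "m < 0" "w m = w m0" "m \<notin> {b..<0}" by blast
    then show ?thesis by (intro exI[of _ m]) auto
  qed
  have rep: "x (c m + n) = x (c m0 + n)" if "w m = w m0" "n \<ge> 0" for m n
  proof -
    have "tail x (c m) !! nat n = tail x (c m0) !! nat n"
      using overlap_determines[of "w m0" "tail y m" "tail y' (j m + 1)" "tail y m0" "tail y' (j m0 + 1)" "nat n"]
        ov[of m] ov[of m0] that(1) by (simp only: subst_stream_tail[OF p(1)])
    then show ?thesis using that(2) by simp
  qed
  \<comment> \<open>two occurrences of the recurring overlap give the period\<close>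
  obtain m1 where m1: "m1 < m0" "w m1 = w m0" using far by blast
  define q where "q = c m0 - c m1"
  have "q > 0" using m1 parse_less_iff[OF p(1)] by (simp add: q_def)
  moreover have "x (i + q) = x i" for i
  proof -
    obtain m where m: "m < - \<bar>i\<bar> - \<bar>c 0\<bar>" "w m = w m0" using far by blast
    then have "c m \<le> i" using parse_expand[OF p(1), of m 0] by linarith
    define n where "n = i - c m"
    have n: "n \<ge> 0" "i = c m + n" using \<open>c m \<le> i\<close> by (auto simp: n_def)
    have "x (i + q) = x (c m + (n + q))" using n by (simp add: algebra_simps)
    also have "\<dots> = x (c m0 + (n + q))" using rep[OF m(2), of "n + q"] n \<open>q > 0\<close> by simp
    also have "\<dots> = x (c m1 + (n + q))" using rep[OF m1(2), of "n + q"] n \<open>q > 0\<close> by simp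
    also have "c m1 + (n + q) = c m0 + n" by (simp add: q_def)
    also have "x (c m0 + n) = x i" using rep[OF m(2), of n] n by simp
    finally show ?thesis .
  qed
  ultimately show ?thesis using aper unfolding periodic_def by blast
qed

end

section \<open>Recognizability\<close>

text \<open>Recognizability is proved for all sets with this invariance, and not only for substitution
  spaces, because of the induction on the alphabet: for \<open>s = f g\<close> the images under \<open>g\<close> of the points of
  the substitution space of \<open>s\<close> need not lie in the substitution space of \<open>g f\<close>, but they form a
  set invariant under \<open>g f\<close>.\<close>

definition subst_invariant :: "('a \<Rightarrow> 'a list) \<Rightarrow> (int \<Rightarrow> 'a) set \<Rightarrow> bool" where
  "subst_invariant s Y \<longleftrightarrow> (\<forall>y\<in>Y. \<forall>x c. parse s x y c \<longrightarrow> x \<in> Y) \<and> (\<forall>x\<in>Y. \<exists>y\<in>Y. \<exists>c. parse s x y c)"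

definition recognizable :: "('a \<Rightarrow> 'a list) \<Rightarrow> (int \<Rightarrow> 'a) set \<Rightarrow> bool" where
  "recognizable s Y \<longleftrightarrow> (\<forall>y\<in>Y. \<forall>y'\<in>Y. \<forall>x c c'. parse s x y c \<longrightarrow> parse s x y' c' \<longrightarrow>
     (\<exists>d. \<forall>m. y' m = y (m + d) \<and> c' m = c (m + d)))"

lemma subst_invariantD:
  assumes "subst_invariant s Y"
  shows "y \<in> Y \<Longrightarrow> parse s x y c \<Longrightarrow> x \<in> Y" "x \<in> Y \<Longrightarrow> \<exists>y\<in>Y. \<exists>c. parse s x y c"
  using assms unfolding subst_invariant_def by blast+

lemma recognizableD:
  assumes "recognizable s Y" "y \<in> Y" "y' \<in> Y" "parse s x y c" "parse s x y' c'"
  obtains d where "\<And>m. y' m = y (m + d)" "\<And>m. c' m = c (m + d)"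
  using assms unfolding recognizable_def by meson

lemma parse_periodic:
  assumes p: "parse s x y c" and y: "periodic y" shows "periodic x"
proof -
  obtain q where q: "q > 0" "\<And>i. y (i + q) = y i" using y unfolding periodic_def by blast
  define P where "P = c (0 + q) - c 0"
  have "parse s x y (\<lambda>m. c (m + q))" using parse_reindex[OF p, of q] q(2) by simp
  then have "parse s (\<lambda>i. x (i + P)) y (\<lambda>m. c (m + q) - P)" by (rule parse_translate)
  from parse_unique(2)[OF this p, of 0] have "x (i + P) = x i" for i by (simp add: P_def fun_eq_iff)
  moreover have "P > 0" using q(1) parse_less_iff[OF p, of 0 "0 + q"] by (simp add: P_def)
  ultimately show ?thesis unfolding periodic_def by blast
qed

lemma parse_letters: assumes p: "parse s x y c" shows "\<exists>m. x i \<in> set (s (y m))"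
proof -
  obtain m where "c m \<le> i" "i < c (m + 1)" using parse_covers[OF p] by blast
  then have "x i \<in> set (window x (c m) (c (m + 1)))" by (simp add: set_window)
  then show ?thesis using p by (auto simp: parse_def)
qed

text \<open>Suppose \<open>s = f g\<close> and consider \<open>t = g f\<close> on the images under \<open>g\<close> of the points of \<open>Y\<close>.
  Every point of \<open>Y\<close> is an image under \<open>f\<close>, so applying \<open>g\<close> to two parsings of \<open>x\<close>
  by \<open>s\<close> gives two parsings of the image of \<open>x\<close> by \<open>t\<^sup>2 = g s f\<close>. If those agree up to a shift,
  then so do the given parsings, which are read off between the cuts.\<close>

lemma recognizable_conjugate:
  fixes s :: "'a \<Rightarrow> 'a list" and g :: "'a \<Rightarrow> 'b list" and f :: "'b \<Rightarrow> 'a list"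
  defines "t \<equiv> \<lambda>b. word_image g (f b)"
    and "Z \<equiv> \<lambda>Y. {z. \<exists>y\<in>Y. \<exists>c. parse g z y c}"
  assumes ne: "\<And>a. g a \<noteq> []" "\<And>b. f b \<noteq> []"
    and sfg: "\<forall>y\<in>Y. \<forall>m. s (y m) = word_image f (g (y m))"
    and inv: "subst_invariant s Y"
  shows "subst_invariant t (Z Y)"
    and "(\<forall>y\<in>Y. \<not> periodic y) \<Longrightarrow> z \<in> Z Y \<Longrightarrow> \<not> periodic z"
    and "recognizable t (Z Y) \<Longrightarrow> recognizable s Y"
proof -
  have split: "\<exists>z c d. parse g z y c \<and> parse f x z d \<and> e = (\<lambda>m. d (c m)) \<and> z \<in> Z Y"
    if "parse s x y e" "y \<in> Y" for x y e
  proof -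
    have "parse (\<lambda>a. word_image f (g a)) x y e"
      by (rule parse_cong[OF that(1)]) (simp add: sfg that(2))
    from parse_decompose[OF this] ne(2) obtain z c d
      where "parse g z y c" "parse f x z d" "e = (\<lambda>m. d (c m))" by metis
    then show ?thesis using that(2) unfolding Z_def by blast
  qed
  have fZ: "x \<in> Y" if z: "z \<in> Z Y" "parse f x z d" for x z d
  proof -
    obtain y c where y: "y \<in> Y" "parse g z y c" using z(1) unfolding Z_def by blast
    have "parse (\<lambda>a. word_image f (g a)) x y (\<lambda>m. d (c m))"
      by (rule parse_compose[OF y(2) z(2)])
    then have "parse s x y (\<lambda>m. d (c m))" by (rule parse_cong) (simp add: sfg y(1))
    then show ?thesis using subst_invariantD(1)[OF inv y(1)] by blast
  qed
  have pre: "\<exists>v\<in>Z Y. \<exists>c. parse f y v c" if "y \<in> Y" for y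
    using subst_invariantD(2)[OF inv that] split by blast
  show invt: "subst_invariant t (Z Y)"
    unfolding subst_invariant_def
  proof (intro conjI ballI allI impI)
    fix z z' e assume z: "z \<in> Z Y" and "parse t z' z e"
    then obtain x d1 d2 where x: "parse f x z d1" "parse g z' x d2"
      using parse_decompose[of g f z' z e] ne(1) unfolding t_def by metis
    then show "z' \<in> Z Y" using fZ[OF z x(1)] unfolding Z_def by blast
  next
    fix z assume "z \<in> Z Y"
    then obtain y c where y: "y \<in> Y" "parse g z y c" unfolding Z_def by blast
    obtain v d where v: "v \<in> Z Y" "parse f y v d" using pre[OF y(1)] by blast
    have "parse t z v (\<lambda>m. c (d m))" unfolding t_def by (rule parse_compose[OF v(2) y(2)])
    then show "\<exists>y\<in>Z Y. \<exists>c. parse t z y c" using v by blast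
  qed
  show "\<not> periodic z" if aper: "\<forall>y\<in>Y. \<not> periodic y" and z: "z \<in> Z Y"
  proof
    assume "periodic z"
    moreover obtain x d where x: "parse f x z d" using parse_exists[of f z 0] ne(2) by blast
    ultimately show False using parse_periodic fZ[OF z x] aper by blast
  qed
  show "recognizable s Y" if rec: "recognizable t (Z Y)"
    unfolding recognizable_def
  proof (intro ballI allI impI)
    fix y y' x e e'
    assume yY: "y \<in> Y" "y' \<in> Y" and p: "parse s x y e" and p': "parse s x y' e'"
    obtain v c where v: "v \<in> Z Y" "parse f y v c" using pre[OF yY(1)] by blast
    obtain v' c' where v': "v' \<in> Z Y" "parse f y' v' c'" using pre[OF yY(2)] by blast
    obtain z h where zh: "parse g z x h" using parse_exists[of g x 0] ne(1) by blast
    obtain w a b where w: "parse g w y a" "parse f x w b" "e = (\<lambda>m. b (a m))" "w \<in> Z Y"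
      using split[OF p yY(1)] by blast
    obtain w' a' b' where w': "parse g w' y' a'" "parse f x w' b'" "e' = (\<lambda>m. b' (a' m))" "w' \<in> Z Y"
      using split[OF p' yY(2)] by blast
    have t1: "parse t z w (\<lambda>m. h (b m))" "parse t z w' (\<lambda>m. h (b' m))"
      unfolding t_def by (rule parse_compose[OF w(2) zh], rule parse_compose[OF w'(2) zh])
    obtain d where d: "\<And>m. w' m = w (m + d)" "\<And>m. h (b' m) = h (b (m + d))"
      using recognizableD[OF rec w(4) w'(4) t1] by metis
    then have b': "b' m = b (m + d)" for m by (simp add: parse_inj[OF zh])
    have t2: "parse t w v (\<lambda>m. a (c m))" "parse t w' v' (\<lambda>m. a' (c' m))"
      unfolding t_def by (rule parse_compose[OF v(2) w(1)], rule parse_compose[OF v'(2) w'(1)])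
    have "parse t (\<lambda>i. w' (i + - d)) v' (\<lambda>m. a' (c' m) - (- d))" by (rule parse_translate[OF t2(2)])
    moreover have "(\<lambda>i. w' (i + - d)) = w" by (simp add: d(1))
    ultimately have "parse t w v' (\<lambda>m. a' (c' m) - (- d))" by simp
    from recognizableD[OF rec v(1) v'(1) t2(1) this] obtain k
      where k: "\<And>m. v' m = v (m + k)" "\<And>m. a' (c' m) - (- d) = a (c (m + k))" by metis
    have v'_eq: "v' = (\<lambda>m. v (m + k))" using k(1) by blast
    define D where "D = c (0 + k) - c' 0"
    have shifted: "parse f (\<lambda>i. y (i + D)) v' (\<lambda>m. c (m + k) - D)"
      unfolding v'_eq by (rule parse_translate[OF parse_reindex[OF v(2)]])
    have "c' 0 = c (0 + k) - D" by (simp add: D_def)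
    note unique = parse_unique[OF v'(2) shifted this]
    have c': "c' m = c (m + k) - D" for m using fun_cong[OF unique(1)] .
    have y': "y' = (\<lambda>i. y (i + D))" using unique(2) .
    have ee: "e' (c' m) = e (c' m + D)" for m
    proof -
      have "e' (c' m) = b (a' (c' m) + d)" using w'(3) b' by simp
      also have "a' (c' m) + d = a (c (m + k))" using k(2)[of m] by simp
      also have "c (m + k) = c' m + D" using c' by simp
      finally show ?thesis using w(3) by simp
    qed
    have "e' = (\<lambda>i. e (i + D))"
      by (rule parse_unique(1)[OF p'[unfolded y'] parse_reindex[OF p, of D], of "c' 0"]) (rule ee)
    then show "\<exists>d. \<forall>m. y' m = y (m + d) \<and> e' m = e (m + d)" using y' by (intro exI[of _ D]) simp
  qed
qed

text \<open>A substitution on \<open>n\<close> letters is either elementary, or conjugate to one on fewer letters. The value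
  \<open>[0]\<close> of \<open>g\<close> outside the alphabet only serves to keep \<open>g\<close> free of empty words.\<close>

lemma recognizable_initial_segment:
  fixes s :: "nat \<Rightarrow> nat list"
  assumes "\<And>a. s a \<noteq> []" "\<And>y. y \<in> Y \<Longrightarrow> range y \<subseteq> {..<n}" "subst_invariant s Y" "\<forall>y\<in>Y. \<not> periodic y"
  shows "recognizable s Y"
  using assms
proof (induction n arbitrary: s Y rule: less_induct)
  case (less n)
  show ?case
  proof (cases "elementary s {..<n}")
    case True
    interpret elementary_subst s "{..<n}" using less.prems(1) True by unfold_locales auto
    show ?thesis unfolding recognizable_def
    proof (intro ballI allI impI)
      fix y y' x c c' assume "y \<in> Y" "y' \<in> Y" "parse s x y c" "parse s x y' c'"
      moreover from this have "x \<in> Y" using subst_invariantD(1)[OF less.prems(3)] by blast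
      ultimately show "\<exists>d. \<forall>m. y' m = y (m + d) \<and> c' m = c (m + d)"
        using parse_unique_aperiodic less.prems(2,4) by blast
    qed
  next
    case False
    then obtain k where k: "k < n" "factors_through s {..<n} k" unfolding elementary_def by auto
    then obtain g0 and f :: "nat \<Rightarrow> nat list" where gf: "\<forall>a\<in>{..<n}. g0 a \<noteq> [] \<and> set (g0 a) \<subseteq> {..<k} \<and> s a = word_image f (g0 a)"
        "\<forall>i. f i \<noteq> []"
      unfolding factors_through_def by blast
    define g where "g a = (if a < n then g0 a else [0])" for a
    have g: "g a \<noteq> []" for a using gf(1) by (simp add: g_def)
    have f: "f a \<noteq> []" for a using gf(2) by simp
    have lt: "y m < n" if "y \<in> Y" for y m using less.prems(2)[OF that] by blast
    have sfg: "\<forall>y\<in>Y. \<forall>m. s (y m) = word_image f (g (y m))"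
      using lt gf(1) by (simp add: g_def)
    note conj = recognizable_conjugate[where s = s and Y = Y and f = f and g = g, OF g f sfg less.prems(3)]
    have "recognizable (\<lambda>b. word_image g (f b)) {z. \<exists>y\<in>Y. \<exists>c. parse g z y c}"
    proof (rule less.IH[OF k(1)])
      show "word_image g (f b) \<noteq> []" for b using f[of b] g by (cases "f b") auto
      show "range z \<subseteq> {..<k}" if z: "z \<in> {z. \<exists>y\<in>Y. \<exists>c. parse g z y c}" for z
      proof -
        obtain y c where y: "y \<in> Y" "parse g z y c" using z by blast
        have "z i < k" for i
        proof -
          obtain m where "z i \<in> set (g (y m))" using parse_letters[OF y(2)] by blast
          moreover have "set (g (y m)) \<subseteq> {..<k}" using gf(1) lt[OF y(1), of m] by (simp add: g_def)
          ultimately show ?thesis by blast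
        qed
        then show ?thesis by blast
      qed
      show "subst_invariant (\<lambda>b. word_image g (f b)) {z. \<exists>y\<in>Y. \<exists>c. parse g z y c}"
        by (rule conj(1))
      show "\<forall>z\<in>{z. \<exists>y\<in>Y. \<exists>c. parse g z y c}. \<not> periodic z"
        using conj(2) less.prems(4) by blast
    qed
    then show ?thesis by (rule conj(3))
  qed
qed

text \<open>The coding of the letters by natural numbers is a conjugation too.\<close>

theorem aperiodic_recognizable:
  fixes s :: "'a::finite \<Rightarrow> 'a list"
  assumes "\<And>a. s a \<noteq> []" "subst_invariant s Y" "\<forall>y\<in>Y. \<not> periodic y"
  shows "recognizable s Y"
proof -
  define g :: "'a \<Rightarrow> nat list" where "g a = [to_nat a]" for a
  define f :: "nat \<Rightarrow> 'a list" where "f b = s (from_nat b)" for b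
  have g: "g a \<noteq> []" for a by (simp add: g_def)
  have f: "f b \<noteq> []" for b using assms(1) by (simp add: f_def)
  have sfg: "\<forall>y\<in>Y. \<forall>m. s (y m) = word_image f (g (y m))" by (simp add: f_def g_def)
  note conj = recognizable_conjugate[where s = s and Y = Y and f = f and g = g, OF g f sfg assms(2)]
  have "recognizable (\<lambda>b. word_image g (f b)) {z. \<exists>y\<in>Y. \<exists>c. parse g z y c}"
  proof (rule recognizable_initial_segment)
    show "word_image g (f b) \<noteq> []" for b using f[of b] g by (cases "f b") auto
    show "range z \<subseteq> {..<Suc (Max (range (to_nat :: 'a \<Rightarrow> nat)))}"
      if z: "z \<in> {z. \<exists>y\<in>Y. \<exists>c. parse g z y c}" for z
    proof -
      obtain y c where y: "y \<in> Y" "parse g z y c" using z by blast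
      have "z i \<le> Max (range (to_nat :: 'a \<Rightarrow> nat))" for i
        using parse_letters[OF y(2), of i] by (auto simp: g_def)
      then show ?thesis by (auto simp: less_Suc_eq_le)
    qed
    show "subst_invariant (\<lambda>b. word_image g (f b)) {z. \<exists>y\<in>Y. \<exists>c. parse g z y c}"
      by (rule conj(1))
    show "\<forall>z\<in>{z. \<exists>y\<in>Y. \<exists>c. parse g z y c}. \<not> periodic z"
      using conj(2) assms(3) by blast
  qed
  then show ?thesis by (rule conj(3))
qed

section \<open>The substitution space\<close>

lemma sublist_word_image: "sublist v w \<Longrightarrow> sublist (word_image s v) (word_image s w)"
  unfolding sublist_def by (metis word_image_simps(3))

lemma word_image_nonempty: "(\<And>a. s a \<noteq> []) \<Longrightarrow> w \<noteq> [] \<Longrightarrow> word_image s w \<noteq> []"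
  by (cases w) auto

lemma length_word_image_le: "(\<And>a. a \<in> set w \<Longrightarrow> length (s a) \<le> R) \<Longrightarrow> length (word_image s w) \<le> R * length w"
proof (induction w)
  case (Cons a w)
  then show ?case using add_mono[of "length (s a)" R "length (word_image s w)" "R * length w"] by simp
qed simp

lemma length_word_image_ge: "(\<And>a. s a \<noteq> []) \<Longrightarrow> length w \<le> length (word_image s w)"
proof (induction w)
  case (Cons a w)
  then have "1 \<le> length (s a)" by (simp add: Suc_le_eq)
  with Cons show ?case by simp
qed simp

lemma length_word_image_member: "a \<in> set w \<Longrightarrow> length (s a) \<le> length (word_image s w)"
  by (induction w) auto

lemma subst_iter_simps:
  "subst_iter s 0 a = [a]" "subst_iter s (Suc n) a = word_image s (subst_iter s n a)"
  by (simp_all add: subst_iter_def subst_ext_eq)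

lemma funpow_word_image: "(word_image s ^^ n) w = word_image (subst_iter s n) w"
proof (induction n)
  case 0 show ?case by (induction w) (auto simp: subst_iter_simps)
next
  case (Suc n)
  then show ?case by (simp add: word_image_comp subst_iter_simps)
qed

lemma subst_iter_add: "subst_iter s (m + n) a = word_image (subst_iter s m) (subst_iter s n a)"
  by (simp add: subst_iter_def subst_ext_eq funpow_add flip: funpow_word_image)

lemma subst_iter_1 [simp]: "subst_iter s (Suc 0) a = s a"
  by (simp add: subst_iter_simps)

lemma subst_iter_Suc': "subst_iter s (Suc n) a = word_image (subst_iter s n) (s a)"
  using subst_iter_add[of s n 1 a] by simp

lemma subst_iter_rev: "subst_iter (\<lambda>a. rev (s a)) n a = rev (subst_iter s n a)"
  by (induction n) (simp_all add: subst_iter_simps rev_word_image)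

lemma language_rev: "w \<in> language (\<lambda>a. rev (s a)) \<longleftrightarrow> rev w \<in> language s"
  by (auto simp: language_def subst_iter_rev sublist_rev_left)

lemma growing_letters_rev: "growing_letters (\<lambda>a. rev (s a)) = growing_letters s"
  by (simp add: growing_letters_def subst_iter_rev)

lemma language_sublist: "w \<in> language s \<Longrightarrow> sublist v w \<Longrightarrow> v \<in> language s"
  unfolding language_def using sublist_order.order.trans by blast

lemma subst_iter_in_language: "n \<ge> 1 \<Longrightarrow> subst_iter s n a \<in> language s"
  unfolding language_def by blast

lemma word_image_in_language: "w \<in> language s \<Longrightarrow> word_image s w \<in> language s"
proof -
  assume "w \<in> language s"
  then obtain a n where "n \<ge> 1" "sublist w (subst_iter s n a)" unfolding language_def by blast
  then have "sublist (word_image s w) (subst_iter s (Suc n) a)"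
    by (simp add: subst_iter_simps sublist_word_image)
  then show ?thesis unfolding language_def by (metis (mono_tags) le_add1 mem_Collect_eq plus_1_eq_Suc)
qed

lemma subst_space_iff: "x \<in> subst_space s \<longleftrightarrow> (\<forall>i j. window x i j \<in> language s)"
proof
  assume x: "x \<in> subst_space s"
  show "\<forall>i j. window x i j \<in> language s"
  proof (intro allI)
    fix i j
    let ?n = "nat (\<bar>i\<bar> + \<bar>j\<bar>)"
    have "window x (- int n) (int n + 1) \<in> language s" for n
      using x by (simp add: subst_space_def window_def)
    from this[of ?n] show "window x i j \<in> language s"
      by (rule language_sublist) (rule sublist_window; linarith)
  qed
next
  assume "\<forall>i j. window x i j \<in> language s"
  then have "window x (- int n) (int n + 1) \<in> language s" for n by blast
  then show "x \<in> subst_space s" by (simp add: subst_space_def window_def)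
qed

lemma subst_spaceI:
  assumes "\<And>M. \<exists>i j. i \<le> - int M \<and> int M \<le> j \<and> window x i j \<in> language s"
  shows "x \<in> subst_space s"
  unfolding subst_space_iff
proof (intro allI)
  fix i j
  obtain i' j' where "i' \<le> - int (nat (\<bar>i\<bar> + \<bar>j\<bar>))" "int (nat (\<bar>i\<bar> + \<bar>j\<bar>)) \<le> j'" "window x i' j' \<in> language s"
    using assms by blast
  moreover from this have "sublist (window x i j) (window x i' j')"
    by (intro sublist_window) linarith+
  ultimately show "window x i j \<in> language s" using language_sublist by blast
qed

lemma subst_space_shift: "x \<in> subst_space s \<Longrightarrow> (\<lambda>i. x (i + k)) \<in> subst_space s"
  by (simp add: subst_space_iff window_shift)

lemma subst_space_rev: "x \<in> subst_space (\<lambda>a. rev (s a)) \<longleftrightarrow> (\<lambda>i. x (- 1 - i)) \<in> subst_space s"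
proof
  show "(\<lambda>i. x (- 1 - i)) \<in> subst_space s" if "x \<in> subst_space (\<lambda>a. rev (s a))"
    using that by (auto simp: subst_space_iff window_reflect language_rev)
  assume "(\<lambda>i. x (- 1 - i)) \<in> subst_space s"
  then have "rev (window x (- j) (- i)) \<in> language s" for i j
    by (simp add: subst_space_iff window_reflect)
  from this[of "- _" "- _"] show "x \<in> subst_space (\<lambda>a. rev (s a))"
    by (simp add: subst_space_iff language_rev)
qed

lemma funpow_left_shift: "(left_shift ^^ n) x = (\<lambda>i. x (i + int n))"
  by (induction n arbitrary: x) (simp_all add: left_shift_def fun_eq_iff algebra_simps)

lemma aperiodic_substD: "aperiodic_subst s \<Longrightarrow> x \<in> subst_space s \<Longrightarrow> \<not> periodic x"
  unfolding aperiodic_subst_def periodic_def funpow_left_shift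
proof
  assume ap: "\<not> (\<exists>x\<in>subst_space s. \<exists>p\<ge>1. (\<lambda>i. x (i + int p)) = x)" and x: "x \<in> subst_space s"
    and "\<exists>p>0. \<forall>i. x (i + p) = x i"
  then obtain p where p: "p > 0" "\<forall>i. x (i + p) = x i" by blast
  then have "nat p \<ge> 1" "(\<lambda>i. x (i + int (nat p))) = x" by auto
  with ap x show False by blast
qed

lemma aperiodic_subst_rev:
  assumes "aperiodic_subst s" shows "aperiodic_subst (\<lambda>a. rev (s a))"
  unfolding aperiodic_subst_def
proof safe
  fix x p assume x: "x \<in> subst_space (\<lambda>a. rev (s a))" and p: "p \<ge> 1" "(left_shift ^^ p) x = x"
  let ?y = "\<lambda>i. x (- 1 - i)"
  have "?y (i + int p) = ?y i" for i
    using fun_cong[OF p(2), of "- 1 - i - int p"] by (simp add: funpow_left_shift algebra_simps)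
  then have "periodic ?y" unfolding periodic_def using p(1) by (intro exI[of _ "int p"]) simp
  then show False using aperiodic_substD[OF assms] x subst_space_rev by blast
qed

text \<open>Sequential compactness of \<open>F\<^sup>\<int>\<close> for finite \<open>F\<close>.\<close>

lemma cluster_point:
  fixes f :: "nat \<Rightarrow> int \<Rightarrow> 'b"
  assumes F: "finite F" "\<And>n i. f n i \<in> F"
  shows "\<exists>g. \<forall>M::nat. infinite {n. \<forall>i. \<bar>i\<bar> \<le> int M \<longrightarrow> f n i = g i}"
proof -
  define agree where "agree I M \<longleftrightarrow> (\<forall>n\<in>I. \<forall>n'\<in>I. \<forall>i. \<bar>i\<bar> \<le> int M \<longrightarrow> f n i = f n' i)" for I M
  have refine: "\<exists>I'. infinite I' \<and> agree I' M \<and> I' \<subseteq> I" if I: "infinite I" for I M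
  proof -
    let ?w = "\<lambda>n. window (f n) (- int M) (int M + 1)"
    have "?w ` I \<subseteq> {v. set v \<subseteq> F \<and> length v = nat (2 * int M + 1)}" using F(2) by (auto simp: set_window)
    then have "finite (?w ` I)" by (rule finite_subset) (intro finite_lists_length_eq F(1))
    then obtain n0 where "infinite {n \<in> I. ?w n = ?w n0}" using pigeonhole_infinite[OF I] by blast
    moreover have "agree {n \<in> I. ?w n = ?w n0} M" unfolding agree_def
    proof safe
      fix n n' i assume "?w n = ?w n0" "?w n' = ?w n0" and i: "\<bar>i\<bar> \<le> int M"
      then have "?w n = ?w n'" by simp
      then show "f n i = f n' i" by (rule window_eqD) (use i in linarith)+
    qed
    ultimately show ?thesis by blast
  qed
  have "\<exists>I. \<forall>M. (infinite (I M) \<and> agree (I M) M) \<and> I (Suc M) \<subseteq> I M"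
  proof (rule dependent_nat_choice)
    show "\<exists>I. infinite I \<and> agree I 0" using refine[of UNIV 0] by blast
    show "\<exists>I'. (infinite I' \<and> agree I' (Suc M)) \<and> I' \<subseteq> I" if "infinite I \<and> agree I M" for I M
      using refine[of I "Suc M"] that by blast
  qed
  then obtain I where I: "\<And>M. infinite (I M)" "\<And>M. agree (I M) M" "\<And>M. I (Suc M) \<subseteq> I M" by blast
  have dec: "I M \<subseteq> I k" if "k \<le> M" for k M using lift_Suc_antimono_le[of I, OF I(3) that] .
  have "\<exists>n. n \<in> I M" for M using I(1)[of M] by (metis finite.emptyI ex_in_conv)
  then obtain r where r: "\<And>M. r M \<in> I M" by metis
  define g where "g i = f (r (nat \<bar>i\<bar>)) i" for i
  have "f n i = g i" if "n \<in> I M" "\<bar>i\<bar> \<le> int M" for n M i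
  proof -
    define k where "k = nat \<bar>i\<bar>"
    have k: "k \<le> M" "\<bar>i\<bar> \<le> int k" using that(2) by (simp_all add: k_def)
    have "n \<in> I k" using dec[OF k(1)] that(1) by blast
    moreover have "\<forall>n\<in>I k. \<forall>n'\<in>I k. \<forall>i. \<bar>i\<bar> \<le> int k \<longrightarrow> f n i = f n' i"
      using I(2)[of k] by (simp only: agree_def)
    ultimately have "f n i = f (r k) i" using r[of k] k(2) by blast
    then show ?thesis by (simp add: g_def k_def)
  qed
  then have "I M \<subseteq> {n. \<forall>i. \<bar>i\<bar> \<le> int M \<longrightarrow> f n i = g i}" for M
    by (intro subsetI CollectI allI impI)
  then have "infinite {n. \<forall>i. \<bar>i\<bar> \<le> int M \<longrightarrow> f n i = g i}" for M
    by (rule infinite_super[OF _ I(1)])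
  then show ?thesis by (intro exI[of _ g] allI)
qed

locale substitution =
  fixes \<sigma> :: "'a::finite \<Rightarrow> 'a list"
  assumes nonempty [simp]: "\<sigma> a \<noteq> []"
begin

abbreviation "X \<equiv> subst_space \<sigma>"
abbreviation "L \<equiv> language \<sigma>"

definition maxlen :: nat where "maxlen = Max (range (\<lambda>a. length (\<sigma> a)))"

lemma length_le_maxlen: "length (\<sigma> a) \<le> maxlen"
  unfolding maxlen_def by (rule Max_ge) auto

lemma maxlen_pos: "maxlen > 0"
  using length_le_maxlen[of undefined] nonempty[of undefined] by (metis length_greater_0_conv order.strict_trans2)

lemma subst_iter_nonempty [simp]: "subst_iter \<sigma> n a \<noteq> []"
  by (induction n) (simp_all add: subst_iter_simps word_image_nonempty)

lemma image_in_space: "y \<in> X \<Longrightarrow> parse \<sigma> x y c \<Longrightarrow> x \<in> X"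
proof (rule subst_spaceI)
  fix M assume y: "y \<in> X" and p: "parse \<sigma> x y c"
  let ?k = "int M + \<bar>c 0\<bar>"
  have "window y (- ?k) ?k \<in> L" using y by (simp add: subst_space_iff)
  then have "window x (c (- ?k)) (c ?k) \<in> L"
    by (subst parse_window[OF p]) (simp_all add: word_image_in_language)
  moreover have "c (- ?k) \<le> - int M" "int M \<le> c ?k"
    using parse_expand[OF p, of "- ?k" 0] parse_expand[OF p, of 0 ?k] by linarith+
  ultimately show "\<exists>i j. i \<le> - int M \<and> int M \<le> j \<and> window x i j \<in> L" by blast
qed

lemma parse_expand_le:
  assumes p: "parse \<sigma> x y c" and "i \<le> j" shows "c j - c i \<le> int maxlen * (j - i)"
  using \<open>i \<le> j\<close>
proof (induction j rule: int_ge_induct)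
  case (step j)
  have "c (j + 1) \<le> c j + int maxlen" using parse_step[OF p, of j] length_le_maxlen[of "y j"] by simp
  with step show ?case by (simp add: algebra_simps)
qed simp

text \<open>A long window of \<open>x\<close> is a factor of the image of a word \<open>v\<close> of the language. Its radius
  \<open>maxlen * (n + 2)\<close> forces \<open>v\<close> to have more than \<open>n\<close> letters on either side of the letter whose image
  covers the origin. Outside \<open>v\<close> the preimage is filled up arbitrarily.\<close>

lemma local_preimage:
  assumes x: "x \<in> X"
  shows "\<exists>x' y c. parse \<sigma> x' y c \<and> c 0 \<le> 0 \<and> 0 < c 1 \<and> window y (- int n) (int n + 1) \<in> L \<and>
    (\<forall>i. \<bar>i\<bar> \<le> int n \<longrightarrow> x' i = x i)"
proof -
  define M where "M = maxlen * (n + 2)"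
  have "1 * (n + 2) \<le> M" unfolding M_def using maxlen_pos by (intro mult_le_mono1) simp
  then have Mn: "M > n" by simp
  have "window x (- int M) (int M) \<in> L" using x by (simp add: subst_space_iff)
  then obtain a k where k: "k \<ge> 1" "sublist (window x (- int M) (int M)) (subst_iter \<sigma> k a)"
    unfolding language_def by blast
  define v where "v = subst_iter \<sigma> (k - 1) a"
  have v: "subst_iter \<sigma> k a = word_image \<sigma> v" using k(1) by (cases k) (simp_all add: v_def subst_iter_simps)
  have "k \<noteq> 1"
  proof
    assume "k = 1"
    then have "length (window x (- int M) (int M)) \<le> length (\<sigma> a)"
      using sublist_length_le[OF k(2)] by simp
    then have "2 * M \<le> maxlen" using length_le_maxlen[of a] by simp
    then show False using maxlen_pos by (simp add: M_def)
  qed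
  then have vL: "v \<in> L" unfolding v_def using k(1) by (intro subst_iter_in_language) simp
  obtain p q where pq: "word_image \<sigma> v = p @ window x (- int M) (int M) @ q"
    using k(2) v by (auto simp: sublist_def)
  define y0 where "y0 i = (if 0 \<le> i \<and> i < int (length v) then v ! nat i else undefined)" for i :: int
  obtain x0 c0 where p0: "parse \<sigma> x0 y0 c0" "c0 0 = 0" using parse_exists[of \<sigma> y0 0] by auto
  have y0v: "window y0 0 (int (length v)) = v" by (rule nth_equalityI) (auto simp: nth_window y0_def)
  have im: "window x0 0 (c0 (int (length v))) = word_image \<sigma> v"
    using parse_window[OF p0(1), of 0 "int (length v)"] p0(2) y0v by simp
  then have c0v: "c0 (int (length v)) = int (length (word_image \<sigma> v))"
    using parse_le_iff[OF p0(1), of 0 "int (length v)"] p0(2) by (metis length_window diff_zero int_nat_eq of_nat_0_le_iff)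
  define t where "t = int (length p + M)"
  have x0: "x0 (t + i) = x i" if "- int M \<le> i" "i < int M" for i
  proof -
    let ?n = "nat (t + i)"
    have "word_image \<sigma> v ! ?n = window x (- int M) (int M) ! nat (i + int M)"
      using that by (simp add: pq t_def nth_append nat_diff_distrib) (auto simp: nat_add_distrib intro!: arg_cong2[where f=nth])
    moreover have "?n < length (word_image \<sigma> v)" using that by (auto simp: pq t_def)
    then have "window x0 0 (c0 (int (length v))) ! ?n = x0 (t + i)"
      using that by (subst nth_window) (auto simp: c0v t_def)
    ultimately show ?thesis using im that by (simp add: nth_window)
  qed
  obtain m where m: "c0 m \<le> t" "t < c0 (m + 1)" using parse_covers[OF p0(1)] by blast
  have tM: "t \<ge> int M" by (simp add: t_def)
  have m0: "m \<ge> 0"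
  proof (rule ccontr)
    assume "\<not> m \<ge> 0"
    then have "c0 (m + 1) \<le> c0 0" using parse_le_iff[OF p0(1)] by simp
    then show False using m(2) tM p0(2) by simp
  qed
  have "int maxlen * (int n + 2) < int maxlen * (m + 1)"
    using parse_expand_le[OF p0(1), of 0 "m + 1"] m0 m(2) p0(2) tM by (simp add: M_def algebra_simps)
  then have mn: "m \<ge> int n" using maxlen_pos by (simp add: mult_less_cancel_left)
  have tv: "t + int M \<le> c0 (int (length v))" by (simp add: c0v pq t_def)
  have mv: "m < int (length v)"
  proof (rule ccontr)
    assume "\<not> m < int (length v)"
    then have "c0 (int (length v)) \<le> c0 m" using parse_le_iff[OF p0(1)] by simp
    then show False using m(1) tv Mn by simp
  qed
  have "int maxlen * (int n + 2) \<le> int maxlen * (int (length v) - m)"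
    using parse_expand_le[OF p0(1), of m "int (length v)"] mv m(1) tv by (simp add: M_def algebra_simps)
  then have mv': "m + int n + 2 \<le> int (length v)" using maxlen_pos by (simp add: mult_le_cancel_left)
  have par: "parse \<sigma> (\<lambda>i. x0 (i + t)) (\<lambda>i. y0 (i + m)) (\<lambda>i. c0 (i + m) - t)"
    by (rule parse_translate[OF parse_reindex[OF p0(1)]])
  have "sublist (window y0 (- int n + m) (int n + 1 + m)) (window y0 0 (int (length v)))"
    using mn mv' by (intro sublist_window) auto
  then have "window (\<lambda>i. y0 (i + m)) (- int n) (int n + 1) \<in> L"
    using language_sublist[OF vL] y0v by (simp add: window_shift)
  moreover have "\<forall>i. \<bar>i\<bar> \<le> int n \<longrightarrow> x0 (i + t) = x i" using x0 Mn by (auto simp: add.commute)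
  ultimately show ?thesis using par m by (intro exI[of _ "\<lambda>i. x0 (i + t)"] exI[of _ "\<lambda>i. y0 (i + m)"]
        exI[of _ "\<lambda>i. c0 (i + m) - t"]) (auto simp: add.commute)
qed

text \<open>The preimage is a cluster point of local preimages. The position of the first cut is carried
  along as a second coordinate, so that it becomes constant along the converging subsequence.\<close>

lemma preimage_exists:
  assumes x: "x \<in> X" shows "\<exists>y\<in>X. \<exists>c. parse \<sigma> x y c"
proof -
  from local_preimage[OF x] obtain x' y c where
    par: "\<And>n. parse \<sigma> (x' n) (y n) (c n)" and c01: "\<And>n. c n 0 \<le> 0" "\<And>n. 0 < c n 1" and
    win: "\<And>n. window (y n) (- int n) (int n + 1) \<in> L" and xx: "\<And>n i. \<bar>i\<bar> \<le> int n \<Longrightarrow> x' n i = x i"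
    by metis
  define f where "f n i = (y n i, c n 0)" for n i
  have "f n i \<in> UNIV \<times> {- int maxlen..0}" for n i
    using parse_expand_le[OF par, of 0 1 n] c01[of n] by (simp add: f_def)
  then obtain g where g: "\<And>M::nat. infinite {n. \<forall>i. \<bar>i\<bar> \<le> int M \<longrightarrow> f n i = g i}"
    using cluster_point[of "UNIV \<times> {- int maxlen..0}" f] by auto
  define z where "z i = fst (g i)" for i
  define k where "k = snd (g 0)"
  have ex: "\<exists>n\<ge>M. c n 0 = k \<and> (\<forall>i. \<bar>i\<bar> \<le> int M \<longrightarrow> y n i = z i)" for M
  proof -
    have "\<not> {n. \<forall>i. \<bar>i\<bar> \<le> int M \<longrightarrow> f n i = g i} \<subseteq> {..<M}" using g finite_subset by blast
    then obtain n where n: "\<forall>i. \<bar>i\<bar> \<le> int M \<longrightarrow> f n i = g i" "n \<ge> M" by force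
    then have "c n 0 = k" "\<forall>i. \<bar>i\<bar> \<le> int M \<longrightarrow> y n i = z i"
      unfolding f_def k_def z_def by (metis abs_zero of_nat_0_le_iff snd_conv, metis fst_conv)
    then show ?thesis using n(2) by blast
  qed
  have "z \<in> X"
  proof (rule subst_spaceI)
    fix M
    obtain n where n: "n \<ge> M" "\<forall>i. \<bar>i\<bar> \<le> int M \<longrightarrow> y n i = z i" using ex by blast
    have "window (y n) (- int M) (int M) \<in> L"
      by (rule language_sublist[OF win[of n]]) (rule sublist_window, use n in auto)
    moreover have "window (y n) (- int M) (int M) = window z (- int M) (int M)"
      by (rule window_cong) (use n(2) in auto)
    ultimately show "\<exists>i j. i \<le> - int M \<and> int M \<le> j \<and> window z i j \<in> L" by auto
  qed
  moreover obtain w d where wd: "parse \<sigma> w z d" "d 0 = k" using parse_exists[of \<sigma> z k] by auto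
  have "w = x"
  proof
    fix i
    define M where "M = nat (\<bar>i\<bar> + \<bar>k\<bar> + 1)"
    obtain n where n: "n \<ge> M" "c n 0 = k" "\<forall>i. \<bar>i\<bar> \<le> int M \<longrightarrow> y n i = z i" using ex by blast
    have "w i = x' n i"
    proof (rule parse_agree_image[OF wd(1) par, where k = 0 and i = "- int M" and j = "int M"])
      show "d 0 = c n 0" using wd n by simp
      show "z m = y n m" if "- int M \<le> m" "m < int M" for m using n(3) that by auto
      have M: "int M = \<bar>i\<bar> + \<bar>k\<bar> + 1" by (simp add: M_def)
      have "0 - (- int M) \<le> d 0 - d (- int M)" "int M - 0 \<le> d (int M) - d 0"
        by (rule parse_expand[OF wd(1)]; simp)+
      then show "d (- int M) \<le> i" "i < d (int M)" using M wd(2) by linarith+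
    qed auto
    then show "w i = x i" using xx[of i n] n(1) by (simp add: M_def)
  qed
  ultimately show ?thesis using wd by blast
qed

lemma subst_invariant: "subst_invariant \<sigma> X"
  unfolding subst_invariant_def using image_in_space preimage_exists by blast

end

section \<open>Bounded gaps between growing letters\<close>

text \<open>Pigeonhole: an iterate of a self-map of a finite set is idempotent, and a factorial serves as
  a common exponent for all self-maps of sets of bounded size.\<close>

lemma idempotent_power:
  assumes "finite S" "f ` S \<subseteq> S" "card S \<le> N" "x \<in> S"
  shows "(f ^^ (fact N + fact N)) x = (f ^^ fact N) x"
proof -
  have inS: "(f ^^ n) x \<in> S" for n using assms(2,4) by (induction n) auto
  have "\<not> inj_on (\<lambda>n. (f ^^ n) x) {..N}"
  proof
    assume "inj_on (\<lambda>n. (f ^^ n) x) {..N}"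
    then have "card {..N} \<le> card S" using inS assms(1) by (intro card_inj_on_le) auto
    then show False using assms(3) by simp
  qed
  then obtain i j where ij: "i < j" "j \<le> N" "(f ^^ i) x = (f ^^ j) x"
    unfolding inj_on_def by (metis atMost_iff linorder_neqE_nat)
  define q where "q = j - i"
  have per1: "(f ^^ (n + q)) x = (f ^^ n) x" if "i \<le> n" for n
  proof -
    have "(f ^^ (n + q)) x = (f ^^ (n - i)) ((f ^^ j) x)"
      using that ij(1) by (simp add: q_def flip: funpow_add[unfolded o_def, THEN fun_cong] comp_apply[of "f ^^ _" "f ^^ _"])
    also have "\<dots> = (f ^^ (n - i)) ((f ^^ i) x)" using ij(3) by simp
    also have "\<dots> = (f ^^ n) x" using that by (metis comp_apply funpow_add le_add_diff_inverse2)
    finally show ?thesis .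
  qed
  have per: "(f ^^ (n + t * q)) x = (f ^^ n) x" if "i \<le> n" for n t
  proof (induction t)
    case (Suc t)
    have "(f ^^ (n + Suc t * q)) x = (f ^^ ((n + t * q) + q)) x" by (simp add: algebra_simps)
    also have "\<dots> = (f ^^ (n + t * q)) x" using that by (intro per1) simp
    finally show ?case using Suc by simp
  qed simp
  have "q dvd fact N" using ij by (intro dvd_fact) (auto simp: q_def)
  then obtain t where t: "fact N = t * q" by (metis dvd_def mult.commute)
  have "i \<le> fact N" using ij fact_ge_self[of N] by linarith
  from per[OF this, of t] show ?thesis using t by simp
qed

lemma takeWhile_decomp:
  assumes "\<exists>a\<in>set w. P a"
  obtains h r where "w = takeWhile (\<lambda>a. \<not> P a) w @ h # r" "P h"
  using assms by (metis takeWhile_dropWhile_id dropWhile_eq_Nil_conv list.exhaust list.sel(1) hd_dropWhile)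

lemma concat_replicate_snoc: "concat (replicate n v) @ v = concat (replicate (Suc n) v)"
  by (induction n) simp_all

lemma subst_iter_1_fun [simp]: "subst_iter s (Suc 0) = s"
  by (rule ext) simp

context substitution
begin

abbreviation "G \<equiv> growing_letters \<sigma>"

text \<open>Aperiodicity is used against runs of bounded letters through this lemma.\<close>

lemma periodic_if_powers:
  assumes v: "v \<noteq> []" and pow: "\<And>n. concat (replicate n v) \<in> L"
  shows "\<exists>x\<in>X. periodic x"
proof -
  define l where "l = int (length v)"
  have l: "l > 0" using v by (simp add: l_def)
  define x where "x i = v ! nat (i mod l)" for i
  have one: "window x (k * l) (k * l + l) = v" for k
  proof (rule nth_equalityI)
    fix n assume "n < length (window x (k * l) (k * l + l))"
    then have "int n < l" "n < length v" by (auto simp: l_def)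
    then show "window x (k * l) (k * l + l) ! n = v ! n" by (simp add: nth_window x_def l_def)
  qed (simp add: l_def)
  have "window x (k * l) (k * l + int n * l) = concat (replicate n v)" for k n
  proof (induction n)
    case (Suc n)
    have "window x (k * l) (k * l + int (Suc n) * l) =
        window x (k * l) (k * l + int n * l) @ window x ((k + int n) * l) ((k + int n) * l + l)"
      using l by (subst window_append[symmetric, where j = "k * l + int n * l"]) (auto simp: algebra_simps)
    also have "\<dots> = concat (replicate n v) @ v" using Suc one by simp
    also have "\<dots> = concat (replicate (Suc n) v)" by (rule concat_replicate_snoc)
    finally show ?case .
  qed simp
  from this[of "- int M" "2 * M" for M] have win: "window x (- int M * l) (int M * l) = concat (replicate (2 * M) v)" for M
    by (simp add: algebra_simps)
  have "x \<in> X"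
  proof (rule subst_spaceI)
    fix M
    have "int M \<le> int M * l" using l by (simp add: mult_le_cancel_left1)
    then show "\<exists>i j. i \<le> - int M \<and> int M \<le> j \<and> window x i j \<in> L"
      using win[of M] pow[of "2 * M"] by (intro exI[of _ "- int M * l"] exI[of _ "int M * l"]) simp
  qed
  moreover have "periodic x" unfolding periodic_def using l by (intro exI[of _ l]) (simp add: x_def)
  ultimately show ?thesis by blast
qed

lemma length_subst_iter_mono: "m \<le> n \<Longrightarrow> length (subst_iter \<sigma> m a) \<le> length (subst_iter \<sigma> n a)"
  by (induction n rule: dec_induct) (auto simp: subst_iter_simps intro!: order_trans[OF _ length_word_image_ge])

lemma growing_iff_unbounded: "a \<in> G \<longleftrightarrow> (\<forall>K. \<exists>n. K < length (subst_iter \<sigma> n a))"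
proof
  assume "a \<in> G"
  then show "\<forall>K. \<exists>n. K < length (subst_iter \<sigma> n a)"
    unfolding growing_letters_def mem_Collect_eq filterlim_at_top
    by (meson eventually_sequentially Suc_le_eq order_refl)
next
  assume *: "\<forall>K. \<exists>n. K < length (subst_iter \<sigma> n a)"
  show "a \<in> G" unfolding growing_letters_def mem_Collect_eq filterlim_at_top eventually_sequentially
    using * length_subst_iter_mono by (meson order.strict_implies_order order_trans)
qed

lemma bounded_letters: "\<exists>K\<ge>1. \<forall>a\<in>- G. \<forall>n. length (subst_iter \<sigma> n a) \<le> K"
proof -
  have "\<forall>a\<in>- G. \<exists>K. \<forall>n. length (subst_iter \<sigma> n a) \<le> K"
    using growing_iff_unbounded by (metis ComplD not_less)
  then obtain K where K: "\<And>a n. a \<in> - G \<Longrightarrow> length (subst_iter \<sigma> n a) \<le> K a" by metis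
  show ?thesis
  proof (intro exI[of _ "Suc (Max (range K))"] conjI ballI allI)
    fix a n assume "a \<in> - G"
    then have "length (subst_iter \<sigma> n a) \<le> K a" by (rule K)
    also have "K a \<le> Max (range K)" by (rule Max_ge) auto
    finally show "length (subst_iter \<sigma> n a) \<le> Suc (Max (range K))" by simp
  qed simp
qed

lemma bounded_image:
  assumes "a \<notin> G" shows "set (subst_iter \<sigma> n a) \<inter> G = {}"
proof -
  obtain K where K: "\<And>m. length (subst_iter \<sigma> m a) \<le> K" using bounded_letters assms by blast
  have "b \<notin> G" if "b \<in> set (subst_iter \<sigma> n a)" for b
  proof -
    have "length (subst_iter \<sigma> m b) \<le> K" for m
      using length_word_image_member[OF that, of "subst_iter \<sigma> m"] K[of "m + n"] by (simp add: subst_iter_add)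
    then show ?thesis using growing_iff_unbounded by (meson not_less)
  qed
  then show ?thesis by blast
qed

lemma bounded_word_image: "set w \<inter> G = {} \<Longrightarrow> set (word_image (subst_iter \<sigma> n) w) \<inter> G = {}"
  using bounded_image by (induction w) auto

lemma growing_image:
  assumes "a \<in> G" shows "\<exists>b\<in>set (subst_iter \<sigma> n a). b \<in> G"
proof (rule ccontr)
  assume no: "\<not> ?thesis"
  obtain K where K: "\<And>b m. b \<notin> G \<Longrightarrow> length (subst_iter \<sigma> m b) \<le> K" using bounded_letters by blast
  have "length (subst_iter \<sigma> m a) \<le> K * length (subst_iter \<sigma> n a)" for m
  proof -
    have "length (subst_iter \<sigma> m a) \<le> length (subst_iter \<sigma> (m + n) a)" by (rule length_subst_iter_mono) simp
    also have "\<dots> = length (word_image (subst_iter \<sigma> m) (subst_iter \<sigma> n a))" by (simp add: subst_iter_add)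
    also have "\<dots> \<le> K * length (subst_iter \<sigma> n a)" using no K by (intro length_word_image_le) blast
    finally show ?thesis .
  qed
  then show False using assms growing_iff_unbounded by (meson not_less)
qed

definition lead :: "'a list \<Rightarrow> 'a list" where
  "lead w = takeWhile (\<lambda>a. a \<notin> G) w"

lemma lead_append: "set u \<inter> G = {} \<Longrightarrow> h \<in> G \<Longrightarrow> lead (u @ h # r) = u"
  unfolding lead_def by (subst takeWhile_append2) auto

lemma lead_append2: "set u \<inter> G = {} \<Longrightarrow> lead (u @ v) = u @ lead v"
  unfolding lead_def by (subst takeWhile_append2) auto

lemma lead_append1: "\<exists>b\<in>set v. b \<in> G \<Longrightarrow> lead (v @ r) = lead v"
  unfolding lead_def by (metis takeWhile_append1)

lemma set_lead: "set (lead w) \<inter> G = {}"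
  unfolding lead_def using set_takeWhileD by fastforce

definition first_growing :: "'a \<Rightarrow> 'a" where
  "first_growing a = hd (dropWhile (\<lambda>b. b \<notin> G) (\<sigma> a))"

lemma image_first_growing:
  assumes "g \<in> G"
  shows "\<exists>r. subst_iter \<sigma> n g = lead (subst_iter \<sigma> n g) @ (first_growing ^^ n) g # r"
    and "(first_growing ^^ n) g \<in> G"
proof -
  have "(\<exists>r. subst_iter \<sigma> n g = lead (subst_iter \<sigma> n g) @ (first_growing ^^ n) g # r) \<and>
    (first_growing ^^ n) g \<in> G"
  proof (induction n)
    case 0
    then show ?case using assms by (auto simp: subst_iter_simps lead_def)
  next
    case (Suc n)
    then obtain r where r: "subst_iter \<sigma> n g = lead (subst_iter \<sigma> n g) @ (first_growing ^^ n) g # r"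
      and hG: "(first_growing ^^ n) g \<in> G" by blast
    let ?h = "(first_growing ^^ n) g" and ?u = "lead (subst_iter \<sigma> n g)"
    have ex: "\<exists>b\<in>set (\<sigma> ?h). b \<in> G" using growing_image[OF hG, of 1] by simp
    obtain h' r' where h': "\<sigma> ?h = lead (\<sigma> ?h) @ h' # r'" "h' \<in> G"
      using takeWhile_decomp[OF ex] unfolding lead_def by blast
    have "dropWhile (\<lambda>b. b \<notin> G) (\<sigma> ?h) = h' # r'"
      using h' by (metis lead_def append_same_eq takeWhile_dropWhile_id same_append_eq)
    then have fg: "first_growing ?h = h'" by (simp add: first_growing_def)
    have u: "set (word_image \<sigma> ?u) \<inter> G = {}"
      using bounded_word_image[OF set_lead, of 1 "subst_iter \<sigma> n g"] by simp
    have "subst_iter \<sigma> (Suc n) g = word_image \<sigma> ?u @ \<sigma> ?h @ word_image \<sigma> r"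
      by (subst subst_iter_simps(2), subst r) simp
    also have "\<dots> = (word_image \<sigma> ?u @ lead (\<sigma> ?h)) @ h' # (r' @ word_image \<sigma> r)"
      by (subst h'(1)) simp
    finally have eq: "subst_iter \<sigma> (Suc n) g = (word_image \<sigma> ?u @ lead (\<sigma> ?h)) @ h' # (r' @ word_image \<sigma> r)" .
    moreover have "lead (subst_iter \<sigma> (Suc n) g) = word_image \<sigma> ?u @ lead (\<sigma> ?h)"
      unfolding eq using u set_lead h'(2) by (intro lead_append) auto
    ultimately show ?case using fg h'(2) by auto
  qed
  then show "\<exists>r. subst_iter \<sigma> n g = lead (subst_iter \<sigma> n g) @ (first_growing ^^ n) g # r"
    and "(first_growing ^^ n) g \<in> G" by blast+
qed

lemma lead_subst_iter_add:
  assumes "g \<in> G"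
  shows "lead (subst_iter \<sigma> (m + n) g) =
    word_image (subst_iter \<sigma> m) (lead (subst_iter \<sigma> n g)) @ lead (subst_iter \<sigma> m ((first_growing ^^ n) g))"
proof -
  let ?h = "(first_growing ^^ n) g"
  obtain r where r: "subst_iter \<sigma> n g = lead (subst_iter \<sigma> n g) @ ?h # r"
    using image_first_growing(1)[OF assms] by blast
  have "subst_iter \<sigma> (m + n) g = word_image (subst_iter \<sigma> m) (lead (subst_iter \<sigma> n g)) @
      subst_iter \<sigma> m ?h @ word_image (subst_iter \<sigma> m) r"
    by (subst subst_iter_add, subst r) simp
  then show ?thesis
    using bounded_word_image[OF set_lead] lead_append2 lead_append1
      growing_image[OF image_first_growing(2)[OF assms]] by metis
qed

text \<open>Take a power \<open>\<rho> = \<sigma>\<^sup>P\<close> that is idempotent on bounded letters and for which the map sending a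
  growing letter to the first growing letter of its image is idempotent as well. If that letter \<open>h\<close> is
  fixed and \<open>\<rho>(h) = u h \<dots>\<close> with \<open>u\<close> bounded and nonempty, then \<open>\<rho>\<^sup>n\<^sup>+\<^sup>1(h)\<close> starts with
  \<open>\<rho>(u)\<^sup>n\<close>, and there is a periodic point. So \<open>u\<close> is empty, and no bounded letters accumulate at
  the left end of the images of a growing letter.\<close>

lemma lead_bounded:
  assumes aper: "\<forall>x\<in>X. \<not> periodic x"
  shows "\<exists>K. \<forall>g\<in>G. \<forall>n. length (lead (subst_iter \<sigma> n g)) \<le> K"
proof -
  obtain K where K1: "K \<ge> 1" and K: "\<And>b n. b \<notin> G \<Longrightarrow> length (subst_iter \<sigma> n b) \<le> K"
    using bounded_letters by blast
  define W where "W = {subst_iter \<sigma> n b |n b. b \<notin> G}"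
  have "W \<subseteq> {w. set w \<subseteq> UNIV \<and> length w \<le> K}" using K by (auto simp: W_def)
  then have finW: "finite W" by (rule finite_subset) (intro finite_lists_length_le finite)
  define N where "N = max (card G) (card W)"
  define P :: nat where "P = fact N"
  have fgG: "first_growing ` G \<subseteq> G" using image_first_growing(2)[of _ 1] by auto
  have idG: "(first_growing ^^ (P + P)) g = (first_growing ^^ P) g" if "g \<in> G" for g
    unfolding P_def by (rule idempotent_power[OF _ fgG _ that]) (auto simp: N_def)
  have idD: "subst_iter \<sigma> (P + P) b = subst_iter \<sigma> P b" if "b \<notin> G" for b
  proof -
    have "word_image \<sigma> ` W \<subseteq> W"
      unfolding W_def by (auto, metis subst_iter_simps(2))
    moreover have "[b] \<in> W" using that subst_iter_simps(1)[of \<sigma> b] unfolding W_def by (metis (mono_tags, lifting) mem_Collect_eq)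
    ultimately have "(word_image \<sigma> ^^ (P + P)) [b] = (word_image \<sigma> ^^ P) [b]"
      unfolding P_def by (intro idempotent_power[OF finW]) (auto simp: N_def)
    then show ?thesis by (simp add: subst_iter_def subst_ext_eq)
  qed
  have fixed: "lead (subst_iter \<sigma> P h) = []" if h: "h \<in> G" "(first_growing ^^ P) h = h" for h
  proof (rule ccontr)
    assume "lead (subst_iter \<sigma> P h) \<noteq> []"
    moreover obtain r0 where "subst_iter \<sigma> P h = lead (subst_iter \<sigma> P h) @ h # r0"
      using image_first_growing(1)[OF h(1), of P] unfolding h(2) by blast
    ultimately obtain u where u: "u \<noteq> []" "set u \<inter> G = {}" and r0: "subst_iter \<sigma> P h = u @ h # r0"
      using set_lead by blast
    define v where "v = word_image (subst_iter \<sigma> P) u"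
    have v: "v \<noteq> []" using u unfolding v_def by (intro word_image_nonempty) auto
    have vv: "word_image (subst_iter \<sigma> P) v = v"
    proof -
      have "word_image (subst_iter \<sigma> P) v = word_image (subst_iter \<sigma> (P + P)) u"
        by (simp add: v_def word_image_comp flip: subst_iter_add)
      also have "\<dots> = v" unfolding v_def using u idD by (intro word_image_cong) blast
      finally show ?thesis .
    qed
    have rep: "word_image (subst_iter \<sigma> P) (concat (replicate n v)) = concat (replicate n v)" for n
      by (induction n) (simp_all add: vv)
    have ex: "\<exists>r. subst_iter \<sigma> (P * Suc n) h = concat (replicate n v) @ u @ h # r" for n
    proof (induction n)
      case 0 then show ?case using r0 by simp
    next
      case (Suc n)
      then obtain r where r: "subst_iter \<sigma> (P * Suc n) h = concat (replicate n v) @ u @ h # r" by blast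
      have "subst_iter \<sigma> (P * Suc (Suc n)) h = word_image (subst_iter \<sigma> P) (subst_iter \<sigma> (P * Suc n) h)"
        by (simp flip: subst_iter_add)
      also have "\<dots> = (concat (replicate n v) @ v) @ u @ h # (r0 @ word_image (subst_iter \<sigma> P) r)"
        unfolding r by (simp add: rep r0 flip: v_def)
      finally show ?case unfolding concat_replicate_snoc by blast
    qed
    have "concat (replicate n v) \<in> L" for n
    proof (rule language_sublist[OF subst_iter_in_language])
      show "P * Suc n \<ge> 1" by (simp add: P_def Suc_le_eq)
      show "sublist (concat (replicate n v)) (subst_iter \<sigma> (P * Suc n) h)"
        using ex[of n] unfolding sublist_def by (metis append.left_neutral)
    qed
    then show False using periodic_if_powers[OF v] aper by blast
  qed
  \<comment> \<open>what remains are the iterates below \<open>P\<close>, of which there are finitely many\<close>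
  define C where "C = Max ((\<lambda>(r, h). length (lead (subst_iter \<sigma> r h))) ` ({..P} \<times> UNIV))"
  have C: "length (lead (subst_iter \<sigma> r h)) \<le> C" if "r \<le> P" for r h
    unfolding C_def using that by (intro Max_ge) (auto intro!: image_eqI[of _ _ "(r, h)"])
  have lenK: "length (word_image (subst_iter \<sigma> m) (lead w)) \<le> K * length (lead w)" for m w
    using set_lead K by (intro length_word_image_le) blast
  have fixn: "lead (subst_iter \<sigma> (P * m) h) = []" if h: "h \<in> G" "(first_growing ^^ P) h = h" for h m
  proof (induction m)
    case 0 then show ?case using h(1) by (simp add: subst_iter_simps lead_def)
  next
    case (Suc m)
    have "lead (subst_iter \<sigma> (P * m + P) h) = []"
      unfolding lead_subst_iter_add[OF h(1)] using fixed[OF h] h(2) Suc by simp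
    then show ?case by (simp add: add.commute)
  qed
  have fixfg: "(first_growing ^^ (P * m)) h = h" if "(first_growing ^^ P) h = h" for h m
    using that by (induction m) (simp_all add: funpow_add)
  have boundh: "length (lead (subst_iter \<sigma> n h)) \<le> C" if h: "h \<in> G" "(first_growing ^^ P) h = h" for h n
  proof -
    have "n = n mod P + P * (n div P)" by simp
    then have "lead (subst_iter \<sigma> n h) = lead (subst_iter \<sigma> (n mod P) h)"
      using lead_subst_iter_add[OF h(1), of "n mod P" "P * (n div P)"] fixn[OF h] fixfg[OF h(2)] by simp
    moreover have "n mod P \<le> P" by (simp add: P_def order_less_imp_le)
    ultimately show ?thesis using C by simp
  qed
  have "length (lead (subst_iter \<sigma> n g)) \<le> K * C + C" if g: "g \<in> G" for n g
  proof (cases "n \<le> P")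
    case True then show ?thesis using C[OF True, of g] by simp
  next
    case False
    then have n: "n = (n - P) + P" by simp
    let ?h = "(first_growing ^^ P) g"
    have "?h \<in> G" "(first_growing ^^ P) ?h = ?h"
      using image_first_growing(2)[OF g] idG[OF g] by (simp_all add: funpow_add)
    then have "length (lead (subst_iter \<sigma> (n - P) ?h)) \<le> C" by (rule boundh)
    moreover have "length (word_image (subst_iter \<sigma> (n - P)) (lead (subst_iter \<sigma> P g))) \<le> K * C"
      using lenK[of "n - P" "subst_iter \<sigma> P g"] C[of P g] by (meson mult_le_mono2 order_refl order_trans)
    ultimately show ?thesis using lead_subst_iter_add[OF g, of "n - P" P] n by simp
  qed
  then show ?thesis by blast
qed

text \<open>Inside \<open>\<sigma>\<^sup>n(w)\<close> such a prefix extends over images of bounded letters, each of bounded length, and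
  ends at the latest in the image of the first growing letter of \<open>w\<close>.\<close>

lemma bounded_prefix:
  assumes aper: "\<forall>x\<in>X. \<not> periodic x"
  shows "\<exists>K. \<forall>n w u r. word_image (subst_iter \<sigma> n) w = u @ r \<longrightarrow> set u \<inter> G = {} \<longrightarrow> length u \<le> K * length w"
proof -
  obtain K1 where K1: "\<And>b n. b \<notin> G \<Longrightarrow> length (subst_iter \<sigma> n b) \<le> K1" using bounded_letters by blast
  obtain K2 where K2: "\<And>g n. g \<in> G \<Longrightarrow> length (lead (subst_iter \<sigma> n g)) \<le> K2" using lead_bounded[OF aper] by blast
  let ?K = "K1 + K2"
  have "length u \<le> ?K * length w"
    if "word_image (subst_iter \<sigma> n) w = u @ r" "set u \<inter> G = {}" for n w u r
    using that
  proof (induction w arbitrary: u)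
    case (Cons a w)
    show ?case
    proof (cases "a \<in> G")
      case True
      have "lead (u @ r) = u @ lead r" using Cons.prems(2) by (rule lead_append2)
      moreover have "lead (u @ r) = lead (subst_iter \<sigma> n a)"
        using Cons.prems(1) lead_append1[OF growing_image[OF True, of n]] by (metis word_image_simps(2))
      ultimately have "length u \<le> K2" using K2[OF True, of n] by simp
      then show ?thesis by simp
    next
      case False
      have la: "length (subst_iter \<sigma> n a) \<le> K1" by (rule K1[OF False])
      show ?thesis
      proof (cases "length u \<le> length (subst_iter \<sigma> n a)")
        case True then show ?thesis using la by simp
      next
        case F: False
        then obtain u' where u': "u = subst_iter \<sigma> n a @ u'" "word_image (subst_iter \<sigma> n) w = u' @ r"
          using Cons.prems(1) by (auto simp: append_eq_append_conv2)
        then have "length u' \<le> ?K * length w" using Cons.IH[of u'] Cons.prems(2) by auto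
        then show ?thesis using u' la by simp
      qed
    qed
  qed simp
  then show ?thesis by blast
qed

end

text \<open>A run of bounded letters in \<open>\<sigma>\<^sup>n\<^sup>+\<^sup>1(a) = \<sigma>\<^sup>n(\<sigma>(a))\<close> lies in the image of one letter of \<open>\<sigma>(a)\<close>, or
  it straddles a boundary between two letters; then its parts are controlled by the prefix
  bound and its mirror image.\<close>

lemma (in substitution) bounded_runs:
  assumes aper: "aperiodic_subst \<sigma>"
  shows "\<exists>Q. \<forall>u\<in>L. set u \<inter> G = {} \<longrightarrow> length u \<le> Q"
proof -
  interpret R: substitution "\<lambda>a. rev (\<sigma> a)" by standard simp
  have "\<forall>x\<in>X. \<not> periodic x" "\<forall>x\<in>subst_space (\<lambda>a. rev (\<sigma> a)). \<not> periodic x"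
    using aper aperiodic_subst_rev[OF aper] aperiodic_substD by blast+
  from bounded_prefix[OF this(1)] R.bounded_prefix[OF this(2)] obtain K1 K2
    where K1: "\<And>n w u r. word_image (subst_iter \<sigma> n) w = u @ r \<Longrightarrow> set u \<inter> G = {} \<Longrightarrow> length u \<le> K1 * length w"
      and K2: "\<And>n w u r. word_image (subst_iter (\<lambda>a. rev (\<sigma> a)) n) w = u @ r \<Longrightarrow> set u \<inter> G = {} \<Longrightarrow> length u \<le> K2 * length w"
    unfolding growing_letters_rev by meson
  have pre: "length u \<le> K1 * length w" if "prefix u (word_image (subst_iter \<sigma> n) w)" "set u \<inter> G = {}" for n w u
    using that K1 by (auto simp: prefix_def)
  have suf: "length u \<le> K2 * length w" if su: "suffix u (word_image (subst_iter \<sigma> n) w)" "set u \<inter> G = {}" for n w u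
  proof -
    obtain r where r: "word_image (subst_iter \<sigma> n) w = r @ u" using su(1) by (auto simp: suffix_def)
    have "word_image (subst_iter (\<lambda>a. rev (\<sigma> a)) n) (rev w) = rev u @ rev r"
      using arg_cong[OF r, of rev] unfolding subst_iter_rev[abs_def] by (simp add: rev_word_image)
    from K2[OF this] show ?thesis using that(2) by simp
  qed
  let ?K = "K1 + K2"
  define Q where "Q = max 1 (?K * maxlen)"
  have word: "length u \<le> max q (?K * length w)"
    if "\<And>a u. sublist u (subst_iter \<sigma> n a) \<Longrightarrow> set u \<inter> G = {} \<Longrightarrow> length u \<le> q"
      "sublist u (word_image (subst_iter \<sigma> n) w)" "set u \<inter> G = {}" for n w u q
    using that(2,3)
  proof (induction w arbitrary: u)
    case (Cons a w)
    from Cons.prems(1) consider "sublist u (subst_iter \<sigma> n a)" | "sublist u (word_image (subst_iter \<sigma> n) w)"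
      | u1 u2 where "u = u1 @ u2" "suffix u1 (subst_iter \<sigma> n a)" "prefix u2 (word_image (subst_iter \<sigma> n) w)"
      by (auto simp: sublist_append)
    then show ?case
    proof cases
      case 1 then show ?thesis using that(1) Cons.prems(2) by (meson le_max_iff_disj)
    next
      case 2 then have "length u \<le> max q (?K * length w)" using Cons by blast
      then show ?thesis by auto
    next
      case 3
      have "length u1 \<le> K2 * length [a]" using 3 Cons.prems(2) suf[of u1 n "[a]"] by auto
      moreover have "length u2 \<le> K1 * length w" using 3 Cons.prems(2) pre[of u2 n w] by auto
      ultimately have "length u \<le> K2 + K1 * length w" using 3(1) by simp
      also have "\<dots> \<le> ?K * length (a # w)" by (simp add: algebra_simps)
      finally show ?thesis by simp
    qed
  qed simp
  have letter: "length u \<le> Q" if "sublist u (subst_iter \<sigma> n a)" "set u \<inter> G = {}" for n a u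
    using that
  proof (induction n arbitrary: a u)
    case 0
    then have "length u \<le> 1" using sublist_length_le[OF 0(1)] by (simp add: subst_iter_simps)
    then show ?case by (simp add: Q_def)
  next
    case (Suc n)
    have "length u \<le> max Q (?K * length (\<sigma> a))"
      by (rule word[OF Suc.IH]) (use Suc.prems in \<open>simp_all add: subst_iter_Suc'\<close>)
    moreover have "?K * length (\<sigma> a) \<le> Q"
      using length_le_maxlen[of a] by (simp add: Q_def le_max_iff_disj mult_le_mono2)
    ultimately show ?case by simp
  qed
  then show ?thesis unfolding language_def by blast
qed

section \<open>Towers over growing letters\<close>

lemma parse_single_iff: "parse (\<lambda>a. [a]) x y c \<longleftrightarrow> (\<exists>k. c = (\<lambda>m. m + k) \<and> x = (\<lambda>i. y (i - k)))"
proof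
  assume p: "parse (\<lambda>a. [a]) x y c"
  have "c 0 = 0 + c 0" by simp
  have q: "parse (\<lambda>a. [a]) (\<lambda>i. y (i - c 0)) y (\<lambda>m. m + c 0)"
    by (simp add: parse_def window_Cons add.commute add.left_commute)
  have "c = (\<lambda>m. m + c 0)" "x = (\<lambda>i. y (i - c 0))"
    by (rule parse_unique[OF p q, of 0]; simp)+
  then show "\<exists>k. c = (\<lambda>m. m + k) \<and> x = (\<lambda>i. y (i - k))" by blast
next
  assume "\<exists>k. c = (\<lambda>m. m + k) \<and> x = (\<lambda>i. y (i - k))"
  then show "parse (\<lambda>a. [a]) x y c" by (auto simp: parse_def window_Cons add.commute add.left_commute)
qed

locale nested_substitution = substitution \<sigma> for \<sigma> :: "'a::finite \<Rightarrow> 'a list" +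
  assumes aperiodic: "aperiodic_subst \<sigma>"
    and hd_growing: "a \<in> growing_letters \<sigma> \<Longrightarrow> hd (\<sigma> a) \<in> growing_letters \<sigma>"
begin

definition gap :: nat where
  "gap = (SOME Q. \<forall>x\<in>X. \<forall>i. \<exists>j. i < j \<and> j \<le> i + int Q \<and> x j \<in> G)"

lemma gap:
  assumes "x \<in> X" shows "\<exists>j. i < j \<and> j \<le> i + int gap \<and> x j \<in> G"
proof -
  obtain Q where Q: "\<And>u. u \<in> L \<Longrightarrow> set u \<inter> G = {} \<Longrightarrow> length u \<le> Q" using bounded_runs[OF aperiodic] by blast
  have "\<exists>j. i < j \<and> j \<le> i + int (Suc Q) \<and> x j \<in> G" if "x \<in> X" for x i
  proof -
    have "window x (i + 1) (i + int (Suc Q) + 1) \<in> L" using that by (simp add: subst_space_iff)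
    moreover have "\<not> length (window x (i + 1) (i + int (Suc Q) + 1)) \<le> Q" by simp
    ultimately have "set (window x (i + 1) (i + int (Suc Q) + 1)) \<inter> G \<noteq> {}" using Q by blast
    then show ?thesis by (force simp: set_window)
  qed
  then have "\<exists>Q. \<forall>x\<in>X. \<forall>i. \<exists>j. i < j \<and> j \<le> i + int Q \<and> x j \<in> G" by blast
  from someI_ex[OF this] assms show ?thesis unfolding gap_def by blast
qed

definition nxt :: "(int \<Rightarrow> 'a) \<Rightarrow> int" where
  "nxt x = int (LEAST k. 0 < k \<and> x (int k) \<in> G)"

definition prv :: "(int \<Rightarrow> 'a) \<Rightarrow> int" where
  "prv x = - int (LEAST k. 0 < k \<and> x (- int k) \<in> G)"

lemma nxt_le: "0 < i \<Longrightarrow> x i \<in> G \<Longrightarrow> nxt x \<le> i"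
  using Least_le[of "\<lambda>k. 0 < k \<and> x (int k) \<in> G" "nat i"] unfolding nxt_def by simp

lemma prv_ge: "i < 0 \<Longrightarrow> x i \<in> G \<Longrightarrow> i \<le> prv x"
  using Least_le[of "\<lambda>k. 0 < k \<and> x (- int k) \<in> G" "nat (- i)"] unfolding prv_def by simp

lemma nxt:
  assumes "x \<in> X" shows "0 < nxt x" "nxt x \<le> int gap" "x (nxt x) \<in> G"
proof -
  obtain j where j: "0 < j" "j \<le> 0 + int gap" "x j \<in> G" using gap[OF assms, of 0] by blast
  then have "0 < nat j \<and> x (int (nat j)) \<in> G" by simp
  from LeastI[of "\<lambda>k. 0 < k \<and> x (int k) \<in> G", OF this] show "0 < nxt x" "x (nxt x) \<in> G"
    unfolding nxt_def by simp_all
  show "nxt x \<le> int gap" using nxt_le[of j x] j by simp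
qed

lemma prv:
  assumes "x \<in> X" shows "prv x < 0" "- int gap - 1 \<le> prv x" "x (prv x) \<in> G"
proof -
  obtain j where j: "- int gap - 1 < j" "j \<le> - int gap - 1 + int gap" "x j \<in> G" using gap[OF assms] by blast
  then have "0 < nat (- j) \<and> x (- int (nat (- j))) \<in> G" by simp
  from LeastI[of "\<lambda>k. 0 < k \<and> x (- int k) \<in> G", OF this] show "prv x < 0" "x (prv x) \<in> G"
    unfolding prv_def by simp_all
  show "- int gap - 1 \<le> prv x" using prv_ge[of j x] j by simp
qed

text \<open>A point with a growing letter at the origin is labelled by its block, which extends to the next
  growing letter, together with the neighbouring growing letters and what lies in between. The
  neighbours are included because their images extend a path to a whole point in both directions,
  whereas the blocks alone need not determine a point whose path is maximal or minimal. The window is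
  split at the origin to make the position of the origin part of the label.\<close>

definition label :: "(int \<Rightarrow> 'a) \<Rightarrow> nat" where
  "label x = to_nat (window x (prv x) 0, window x 0 (nxt x + 1))"

lemma label_eqD:
  assumes "x \<in> X" "x' \<in> X" "label x = label x'"
  shows "nxt x' = nxt x" "prv x' = prv x" "prv x \<le> i \<Longrightarrow> i \<le> nxt x \<Longrightarrow> x i = x' i"
proof -
  have eq: "window x (prv x) 0 = window x' (prv x') 0" "window x 0 (nxt x + 1) = window x' 0 (nxt x' + 1)"
    using assms(3) by (simp_all add: label_def)
  have "nat (0 - prv x) = nat (0 - prv x')" "nat (nxt x + 1 - 0) = nat (nxt x' + 1 - 0)"
    using arg_cong[OF eq(1), of length] arg_cong[OF eq(2), of length] by simp_all
  then show n: "nxt x' = nxt x" and p: "prv x' = prv x"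
    using nxt(1)[OF assms(1)] nxt(1)[OF assms(2)] prv(1)[OF assms(1)] prv(1)[OF assms(2)] by linarith+
  show "x i = x' i" if "prv x \<le> i" "i \<le> nxt x"
  proof (cases "i < 0")
    case True
    show ?thesis by (rule window_eqD[OF eq(1)[unfolded p]]) (use that True in auto)
  next
    case False
    show ?thesis by (rule window_eqD[OF eq(2)[unfolded n]]) (use that False in auto)
  qed
qed

lemma label_eqI:
  assumes x: "x \<in> X" "x' \<in> X" and eq: "\<And>i. prv x \<le> i \<Longrightarrow> i \<le> nxt x \<Longrightarrow> x i = x' i"
  shows "label x = label x'"
proof -
  note px = prv[OF x(1)] and nx = nxt[OF x(1)] and px' = prv[OF x(2)] and nx' = nxt[OF x(2)]
  have "x' (nxt x) \<in> G" "x' (prv x) \<in> G" using eq[of "nxt x"] eq[of "prv x"] px nx by auto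
  then have le: "nxt x' \<le> nxt x" "prv x \<le> prv x'" using nxt_le[of "nxt x" x'] prv_ge[of "prv x" x'] px nx by auto
  then have "x (nxt x') \<in> G" "x (prv x') \<in> G" using eq[of "nxt x'"] eq[of "prv x'"] px' nx' px nx by auto
  then have "nxt x = nxt x'" "prv x = prv x'"
    using nxt_le[of "nxt x'" x] prv_ge[of "prv x'" x] px' nx' le by auto
  moreover have "window x (prv x) 0 = window x' (prv x) 0" "window x 0 (nxt x + 1) = window x' 0 (nxt x + 1)"
    using px nx by (auto intro!: window_cong eq)
  ultimately show ?thesis by (simp add: label_def)
qed

definition Y :: "(int \<Rightarrow> 'a) set" where
  "Y = {x \<in> X. x 0 \<in> G}"

lemma Y_X: "y \<in> Y \<Longrightarrow> y \<in> X"
  by (simp add: Y_def)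

lemma finite_labels: "finite (label ` Y)"
proof -
  let ?S = "{w :: 'a list. set w \<subseteq> UNIV \<and> length w \<le> gap + 1}"
  have "finite ?S" by (rule finite_lists_length_le) simp
  moreover have "label ` Y \<subseteq> to_nat ` (?S \<times> ?S)"
  proof
    fix v assume "v \<in> label ` Y"
    then obtain y where y: "y \<in> X" "v = label y" using Y_X by blast
    have "(window y (prv y) 0, window y 0 (nxt y + 1)) \<in> ?S \<times> ?S"
      using nxt[OF y(1)] prv[OF y(1)] by auto
    then show "v \<in> to_nat ` (?S \<times> ?S)" using y(2) unfolding label_def by blast
  qed
  ultimately show ?thesis by (meson finite_SigmaI finite_imageI finite_subset)
qed

text \<open>Level \<open>0\<close> consists of the points of \<open>X\<close>, the levels above of the points with a growing letter at the
  origin. A point \<open>x\<close> of level \<open>n\<close> lies over the point \<open>y\<close> of level \<open>n + 1\<close>, at height \<open>q\<close>, if it is the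
  image of \<open>y\<close> shifted by \<open>q\<close>, and the origin lies in the image of the block of \<open>y\<close> that starts at
  the origin and extends to the next growing letter.\<close>

definition lvl :: "nat \<Rightarrow> 'a \<Rightarrow> 'a list" where
  "lvl n = (if n = 0 then (\<lambda>a. [a]) else \<sigma>)"

definition Z :: "nat \<Rightarrow> (int \<Rightarrow> 'a) set" where
  "Z n = (if n = 0 then X else Y)"

definition over :: "nat \<Rightarrow> (int \<Rightarrow> 'a) \<Rightarrow> (int \<Rightarrow> 'a) \<Rightarrow> nat \<Rightarrow> bool" where
  "over n x y q \<longleftrightarrow> y \<in> Y \<and> (\<exists>c. parse (lvl n) x y c \<and> c 0 = - int q \<and> 0 < c (nxt y))"

lemma Z_simps [simp]: "Z 0 = X" "Z (Suc n) = Y"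
  by (simp_all add: Z_def)

lemma Z_X: "x \<in> Z n \<Longrightarrow> x \<in> X"
  using Y_X by (cases n) auto

lemma lvl_nonempty: "lvl n a \<noteq> []"
  by (simp add: lvl_def)

lemma lvl_image: "y \<in> X \<Longrightarrow> parse (lvl n) x y c \<Longrightarrow> x \<in> X"
  using image_in_space subst_space_shift[of y \<sigma> "- _"]
  by (cases "n = 0") (auto simp: lvl_def parse_single_iff)

lemma lvl_preimage: "x \<in> X \<Longrightarrow> \<exists>y\<in>X. \<exists>c. parse (lvl n) x y c"
proof (cases "n = 0")
  case True
  assume "x \<in> X"
  moreover have "parse (lvl n) x x (\<lambda>m. m + 0)"
    unfolding lvl_def using True by (simp add: parse_single_iff) (rule exI[of _ 0], simp)
  ultimately show ?thesis by blast
qed (simp add: lvl_def preimage_exists)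

lemma lvl_unique:
  assumes y: "y \<in> X" "y' \<in> X" and p: "parse (lvl n) x y c" "parse (lvl n) x y' c'"
  obtains d where "\<And>m. y' m = y (m + d)" "\<And>m. c' m = c (m + d)"
proof (cases "n = 0")
  case True
  then obtain k k' where k: "c = (\<lambda>m. m + k)" "x = (\<lambda>i. y (i - k))" "c' = (\<lambda>m. m + k')" "x = (\<lambda>i. y' (i - k'))"
    using p by (auto simp: lvl_def parse_single_iff)
  have "y' m = y (m + (k' - k))" for m
    using fun_cong[OF k(2), of "m + k'"] fun_cong[OF k(4), of "m + k'"] by (simp add: algebra_simps)
  then show ?thesis using that[of "k' - k"] k by simp
next
  case False
  have "recognizable \<sigma> X"
    by (rule aperiodic_recognizable[OF nonempty subst_invariant]) (use aperiodic_substD[OF aperiodic] in blast)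
  then show ?thesis using recognizableD[OF _ y, of \<sigma> x c c'] p False that by (auto simp: lvl_def)
qed

lemma lvl_growing: "parse (lvl n) x y c \<Longrightarrow> y m \<in> G \<Longrightarrow> x (c m) \<in> G"
proof -
  assume p: "parse (lvl n) x y c" and "y m \<in> G"
  then have "hd (lvl n (y m)) \<in> G" using hd_growing by (simp add: lvl_def)
  moreover have "hd (window x (c m) (c (m + 1))) = x (c m)" using parse_less[OF p] by (simp add: window_Cons)
  ultimately show ?thesis using p by (simp add: parse_def)
qed

text \<open>The origin lies in the image of some letter of a preimage of \<open>x\<close>; the last growing letter up to
  there becomes the origin of \<open>y\<close>.\<close>

lemma over_exists:
  assumes "x \<in> X" shows "\<exists>y q. over n x y q"
proof -
  obtain z e where z: "z \<in> X" "parse (lvl n) x z e" using lvl_preimage[OF assms] by blast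
  obtain m where m: "e m \<le> 0" "0 < e (m + 1)" using parse_covers[OF z(2)] by blast
  define z' where "z' = (\<lambda>i. z (i + m))"
  have z': "z' \<in> X" unfolding z'_def by (rule subst_space_shift[OF z(1)])
  define d where "d = (if z m \<in> G then m else m + prv z')"
  define y where "y = (\<lambda>i. z (i + d))"
  define c where "c = (\<lambda>i. e (i + d))"
  have par: "parse (lvl n) x y c" unfolding y_def c_def by (rule parse_reindex[OF z(2)])
  have yX: "y \<in> X" unfolding y_def by (rule subst_space_shift[OF z(1)])
  have "y 0 \<in> G" using prv(3)[OF z'] by (simp add: y_def d_def z'_def add.commute)
  then have yY: "y \<in> Y" using yX by (simp add: Y_def)
  have dm: "d \<le> m" using prv(1)[OF z'] by (simp add: d_def)
  then have c0: "c 0 \<le> 0" using m(1) parse_le_iff[OF z(2), of d m] by (simp add: c_def)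
  have "m < d + nxt y"
  proof (rule ccontr)
    assume le: "\<not> m < d + nxt y"
    have g: "z (d + nxt y) \<in> G" using nxt(3)[OF yX] by (simp add: y_def add.commute)
    have "z m \<notin> G" using le nxt(1)[OF yX] by (auto simp: d_def)
    have "d + nxt y \<noteq> m" using g \<open>z m \<notin> G\<close> by auto
    then have "d + nxt y - m < 0" using le by simp
    moreover have "z' (d + nxt y - m) \<in> G" using g by (simp add: z'_def)
    ultimately have "d + nxt y - m \<le> prv z'" by (rule prv_ge)
    then show False using \<open>z m \<notin> G\<close> nxt(1)[OF yX] by (simp add: d_def)
  qed
  then have "e (m + 1) \<le> c (nxt y)" using parse_le_iff[OF z(2), of "m + 1" "nxt y + d"] by (simp add: c_def)
  then have "over n x y (nat (- c 0))" unfolding over_def using yY par c0 m(2) by auto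
  then show ?thesis by blast
qed

text \<open>By recognizability two candidates differ by an index shift, which would place a second growing
  letter within the block covering the origin.\<close>

lemma over_unique:
  assumes "over n x y q" "over n x y' q'" shows "y = y' \<and> q = q'"
proof -
  obtain c c' where c: "y \<in> Y" "parse (lvl n) x y c" "c 0 = - int q" "0 < c (nxt y)"
    and c': "y' \<in> Y" "parse (lvl n) x y' c'" "c' 0 = - int q'" "0 < c' (nxt y')"
    using assms unfolding over_def by blast
  obtain d where d: "\<And>m. y' m = y (m + d)" "\<And>m. c' m = c (m + d)"
    using lvl_unique[OF Y_X[OF c(1)] Y_X[OF c'(1)] c(2) c'(2)] by blast
  have "\<not> 0 < d"
  proof
    assume "0 < d"
    moreover have "y d \<in> G" using d(1)[of 0] c'(1) by (simp add: Y_def)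
    ultimately have "c (nxt y) \<le> c d" using nxt_le[of d y] parse_le_iff[OF c(2)] by simp
    then show False using c(4) d(2)[of 0] c'(3) by simp
  qed
  moreover have "\<not> d < 0"
  proof
    assume "d < 0"
    moreover have "y' (- d) \<in> G" using d(1)[of "- d"] c(1) by (simp add: Y_def)
    ultimately have "c' (nxt y') \<le> c' (- d)" using nxt_le[of "- d" y'] parse_le_iff[OF c'(2)] by simp
    then show False using c'(4) d(2)[of "- d"] c(3) by simp
  qed
  ultimately have "d = 0" by simp
  then show ?thesis using d(1) d(2)[of 0] c(3) c'(3) by auto
qed

definition up :: "nat \<Rightarrow> (int \<Rightarrow> 'a) \<Rightarrow> int \<Rightarrow> 'a" where
  "up n x = (THE y. \<exists>q. over n x y q)"

definition off :: "nat \<Rightarrow> (int \<Rightarrow> 'a) \<Rightarrow> nat" where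
  "off n x = (THE q. \<exists>y. over n x y q)"

lemma over_up_off: "over n x y q \<Longrightarrow> up n x = y \<and> off n x = q"
  unfolding up_def off_def using over_unique by blast

lemma over_canonical: "x \<in> X \<Longrightarrow> over n x (up n x) (off n x)"
  using over_exists over_up_off by blast

lemma up_Y: "x \<in> X \<Longrightarrow> up n x \<in> Y"
  using over_canonical unfolding over_def by blast

text \<open>The following two lemmas make a finite alphabet of labels possible: what the label of \<open>y\<close> records
  determines the image of the block of \<open>y\<close> together with the growing letters next to it, hence the labels
  of all points below \<open>y\<close>. That the neighbouring growing letters of a point below do not lie
  further out is due to the nesting property.\<close>

lemma parse_label:
  assumes y: "y \<in> X" "y' \<in> X" "label y = label y'"
    and p: "parse (lvl n) x y c" "parse (lvl n) x' y' c'" "c 0 = c' 0"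
  shows "prv y \<le> m \<Longrightarrow> m \<le> nxt y + 1 \<Longrightarrow> c m = c' m"
    and "c (prv y) \<le> i \<Longrightarrow> i < c (nxt y + 1) \<Longrightarrow> x i = x' i"
proof -
  have eq: "y m = y' m" if "prv y \<le> m" "m < nxt y + 1" for m
    using label_eqD(3)[OF y] that by simp
  have b: "prv y \<le> 0" "0 \<le> nxt y + 1" using prv(1)[OF y(1)] nxt(1)[OF y(1)] by simp_all
  show "c m = c' m" if "prv y \<le> m" "m \<le> nxt y + 1"
    by (rule parse_agree_cut[OF p b that eq])
  show "x i = x' i" if "c (prv y) \<le> i" "i < c (nxt y + 1)"
    by (rule parse_agree_image[OF p b eq that])
qed

lemma over_nxt_le:
  assumes "y \<in> X" "parse (lvl n) x y c" "0 < c (nxt y)" shows "nxt x \<le> c (nxt y)"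
  using assms lvl_growing nxt(3) nxt_le by blast

lemma over_label:
  assumes y: "y \<in> X" "y' \<in> X" "label y = label y'" and x: "x \<in> Y" "x' \<in> X"
    and p: "parse (lvl n) x y c" "parse (lvl n) x' y' c'" "c 0 = c' 0"
    and o: "c 0 \<le> 0" "0 < c (nxt y)"
  shows "x' \<in> Y" "label x = label x'"
proof -
  have lt: "c (prv y) < c 0" "c (nxt y) < c (nxt y + 1)"
    using prv(1)[OF y(1)] by (simp_all add: parse_less_iff[OF p(1)])
  have eq: "x i = x' i" if "c (prv y) \<le> i" "i \<le> c (nxt y)" for i
    using parse_label(2)[OF y p, of i] that lt by simp
  have "x 0 = x' 0" using eq[of 0] lt o by simp
  then show "x' \<in> Y" using x by (simp add: Y_def)
  have "c (prv y) \<le> prv x"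
    using lvl_growing[OF p(1) prv(3)[OF y(1)]] lt(1) o(1) by (intro prv_ge) auto
  moreover have "nxt x \<le> c (nxt y)" by (rule over_nxt_le[OF y(1) p(1) o(2)])
  ultimately show "label x = label x'" using x by (intro label_eqI eq) (auto simp: Y_X)
qed

lemma over_labelD:
  assumes "over n x y q" "over n x' y' q" "label y = label y'" "x \<in> Y" "x' \<in> X"
  shows "x' \<in> Y" "label x = label x'"
proof -
  obtain c c' where "y \<in> Y" "parse (lvl n) x y c" "c 0 = - int q" "0 < c (nxt y)"
    "y' \<in> Y" "parse (lvl n) x' y' c'" "c' 0 = - int q"
    using assms(1,2) unfolding over_def by blast
  then show "x' \<in> Y" "label x = label x'"
    using over_label[of y y' x x' n c c'] assms(3-5) by (auto simp: Y_X)
qed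

lemma over_lift:
  assumes y: "y \<in> Y" "label y = label y0" and x0: "over n x0 y0 q" "x0 \<in> Z n"
  obtains x where "x \<in> Z n" "over n x y q" "n \<noteq> 0 \<Longrightarrow> label x = label x0"
proof -
  obtain c0 where c0: "y0 \<in> Y" "parse (lvl n) x0 y0 c0" "c0 0 = - int q" "0 < c0 (nxt y0)"
    using x0(1) unfolding over_def by blast
  obtain x c where c: "parse (lvl n) x y c" "c 0 = - int q" using parse_exists[of "lvl n" y] lvl_nonempty by blast
  have xX: "x \<in> X" using lvl_image[OF _ c(1)] y(1) Y_X by blast
  have lab: "label y0 = label y" using y(2) by simp
  note X = Y_X[OF c0(1)] Y_X[OF y(1)]
  have c0c: "c0 0 = c 0" using c c0 by simp
  have "c (nxt y) = c0 (nxt y0)"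
    using parse_label(1)[OF X lab c0(2) c(1) c0c, of "nxt y0"] label_eqD(1)[OF X lab] prv(1)[OF X(1)] nxt(1)[OF X(1)]
    by simp
  then have ov: "over n x y q" unfolding over_def using y(1) c c0(4) by auto
  show ?thesis
  proof (cases "n = 0")
    case True
    then show ?thesis using that[of x] xX ov by (simp add: Z_def)
  next
    case False
    then have "x0 \<in> Y" using x0(2) by (simp add: Z_def)
    from over_labelD[OF x0(1) ov lab this xX] show ?thesis using that[of x] ov False by (simp add: Z_def)
  qed
qed

subsection \<open>The successor\<close>

definition step :: "nat \<Rightarrow> (int \<Rightarrow> 'a) \<Rightarrow> int" where
  "step n x = (if n = 0 then 1 else nxt x)"

definition adv :: "nat \<Rightarrow> (int \<Rightarrow> 'a) \<Rightarrow> int \<Rightarrow> 'a" where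
  "adv n x = (\<lambda>i. x (i + step n x))"

lemma step_pos: "x \<in> X \<Longrightarrow> 0 < step n x"
  using nxt(1) by (simp add: step_def)

lemma adv_Z: "x \<in> Z n \<Longrightarrow> adv n x \<in> Z n"
  using subst_space_shift[of x \<sigma>] nxt(3)[of x] by (cases n) (auto simp: adv_def step_def Y_def)

lemma over_total:
  assumes "x \<in> Z n" "y \<in> X" "parse (lvl n) x y c" "0 < c (nxt y)"
  shows "step n x \<le> c (nxt y)"
  using over_nxt_le[OF assms(2-4)] assms(4) by (simp add: step_def)

lemma over_advance:
  assumes x: "x \<in> Z n" and c: "y \<in> Y" "parse (lvl n) x y c" "c 0 = - int q" "0 < c (nxt y)"
  shows "step n x < c (nxt y) \<Longrightarrow> over n (adv n x) y (q + nat (step n x))"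
    and "step n x = c (nxt y) \<Longrightarrow> over n (adv n x) (adv (Suc n) y) 0"
proof -
  have pos: "0 < step n x" using step_pos Z_X[OF x] .
  have par: "parse (lvl n) (adv n x) y (\<lambda>m. c m - step n x)"
    unfolding adv_def by (rule parse_translate[OF c(2)])
  show "over n (adv n x) y (q + nat (step n x))" if "step n x < c (nxt y)"
    unfolding over_def using c par pos that by (intro conjI exI[of _ "\<lambda>m. c m - step n x"]) auto
  show "over n (adv n x) (adv (Suc n) y) 0" if eq: "step n x = c (nxt y)"
  proof -
    have ay: "adv (Suc n) y = (\<lambda>i. y (i + nxt y))" by (simp add: adv_def step_def)
    have Yy: "adv (Suc n) y \<in> Y" using adv_Z[of y "Suc n"] c(1) by simp
    have "parse (lvl n) (adv n x) (adv (Suc n) y) (\<lambda>m. c (m + nxt y) - step n x)"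
      unfolding ay by (rule parse_reindex[OF par])
    moreover have "0 < c (nxt (adv (Suc n) y) + nxt y) - step n x"
      using nxt(1)[OF Y_X[OF Yy]] eq parse_less_iff[OF c(2)] by simp
    ultimately show ?thesis unfolding over_def using Yy eq
      by (intro conjI exI[of _ "\<lambda>m. c (m + nxt y) - step n x"]) auto
  qed
qed

text \<open>If the tower with the label of \<open>y\<close> is met at a height \<open>q'\<close> above \<open>q\<close>, then shifting \<open>x\<close> by \<open>q' - q\<close> leads
  to that height over the same \<open>y\<close>, so the shifted point has a growing letter at the origin.\<close>

lemma over_no_between:
  assumes x: "x \<in> Z n" "x' \<in> Z n" and o: "over n x y q" "over n x' y' q'"
    and lab: "label y = label y'" and lt: "q < q'"
  shows "q + nat (step n x) \<le> q'" "over n (adv n x) y (q + nat (step n x))"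
proof -
  obtain c c' where c: "y \<in> Y" "parse (lvl n) x y c" "c 0 = - int q" "0 < c (nxt y)"
    and c': "y' \<in> Y" "parse (lvl n) x' y' c'" "c' 0 = - int q'" "0 < c' (nxt y')"
    using o unfolding over_def by blast
  note X = Y_X[OF c(1)] Y_X[OF c'(1)]
  define k where "k = int q' - int q"
  define x'' where "x'' = (\<lambda>i. x (i + k))"
  have par: "parse (lvl n) x'' y (\<lambda>m. c m - k)" unfolding x''_def by (rule parse_translate[OF c(2)])
  have x''X: "x'' \<in> X" unfolding x''_def using subst_space_shift Z_X[OF x(1)] by blast
  have c0: "c' 0 = c 0 - k" using c(3) c'(3) by (simp add: k_def)
  have tot: "c' (nxt y') = c (nxt y) - k"
    using parse_label(1)[OF X(2,1) lab[symmetric] c'(2) par c0, of "nxt y'"] label_eqD(1)[OF X lab]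
      prv(1)[OF X(2)] nxt(1)[OF X(2)] by simp
  have kstep: "step n x \<le> k"
  proof (cases "n = 0")
    case True then show ?thesis using lt by (simp add: step_def k_def)
  next
    case False
    then have "x' \<in> Y" using x(2) by (simp add: Z_def)
    then have "x'' \<in> Y"
      using over_label(1)[OF X(2,1) lab[symmetric] _ x''X c'(2) par c0] c' by simp
    then have "x k \<in> G" by (simp add: Y_def x''_def)
    moreover have "0 < k" using lt by (simp add: k_def)
    ultimately have "nxt x \<le> k" by (intro nxt_le)
    then show ?thesis using False by (simp add: step_def)
  qed
  then show "q + nat (step n x) \<le> q'" using lt by (simp add: k_def)
  have "step n x < c (nxt y)" using kstep tot c'(4) by simp
  then show "over n (adv n x) y (q + nat (step n x))" by (rule over_advance(1)[OF x(1) c])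
qed

text \<open>The heights will index the edges into the vertex \<open>v\<close>, in their natural order. On level \<open>0\<close> they are all positions in the block labelled
  \<open>v\<close>, on higher levels the positions of the growing letters in its image.\<close>

definition heights :: "nat \<Rightarrow> nat \<Rightarrow> nat set" where
  "heights n v = {q. \<exists>x\<in>Z n. \<exists>y. label y = v \<and> over n x y q}"

lemma heights_finite: "finite (heights n v)"
proof (rule finite_subset)
  show "heights n v \<subseteq> {..<Suc maxlen * gap}"
  proof
    fix q assume "q \<in> heights n v"
    then obtain x y c where c: "y \<in> Y" "parse (lvl n) x y c" "c 0 = - int q" "0 < c (nxt y)"
      unfolding heights_def over_def by blast
    note yX = Y_X[OF c(1)]
    have "int q < c (nxt y) - c 0" using c by simp
    also have "\<dots> \<le> int (Suc maxlen) * nxt y"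
    proof (cases "n = 0")
      case True
      then have "c (nxt y) - c 0 = nxt y" using c(2) by (auto simp: lvl_def parse_single_iff)
      then show ?thesis using nxt(1)[OF yX] by (simp add: algebra_simps)
    next
      case False
      then have "parse \<sigma> x y c" using c(2) by (simp add: lvl_def)
      from parse_expand_le[OF this, of 0 "nxt y"] show ?thesis using nxt(1)[OF yX] by (simp add: algebra_simps)
    qed
    also have "\<dots> \<le> int (Suc maxlen) * int gap" using nxt(2)[OF yX] by (intro mult_left_mono) auto
    finally show "q \<in> {..<Suc maxlen * gap}" by (simp flip: of_nat_mult of_nat_Suc)
  qed
qed simp

lemma heights_Suc: "heights (Suc n) v = heights 1 v"
  by (simp add: heights_def over_def lvl_def)

lemma off_in_heights: "x \<in> Z n \<Longrightarrow> off n x \<in> heights n (label (up n x))"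
  unfolding heights_def using over_canonical Z_X by blast

lemma zero_in_heights:
  assumes "y \<in> Y" shows "0 \<in> heights n (label y)"
proof -
  obtain x c where c: "parse (lvl n) x y c" "c 0 = 0" using parse_exists[of "lvl n" y] lvl_nonempty by blast
  have "x \<in> X" using lvl_image[OF _ c(1)] assms Y_X by blast
  moreover have "x 0 \<in> G" using lvl_growing[OF c(1), of 0] c(2) assms by (simp add: Y_def)
  moreover have "0 < c (nxt y)" using nxt(1)[OF Y_X[OF assms]] c parse_less_iff[OF c(1), of 0 "nxt y"] by simp
  ultimately show ?thesis unfolding heights_def over_def using assms c by (force simp: Z_def Y_def)
qed

definition child :: "nat \<Rightarrow> nat \<Rightarrow> nat" where
  "child v q = (SOME u. \<exists>x\<in>Y. \<exists>y. label y = v \<and> over 1 x y q \<and> u = label x)"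

lemma over_Suc: "over (Suc n) = over 1"
  by (intro ext) (simp add: over_def lvl_def)

lemma child_eq:
  assumes "x \<in> Y" "over (Suc n) x y q" shows "child (label y) q = label x"
proof -
  have o: "over 1 x y q" using assms(2) over_Suc[of n] by simp
  have "\<exists>u. \<exists>x\<in>Y. \<exists>y'. label y' = label y \<and> over 1 x y' q \<and> u = label x"
    by (intro exI[of _ "label x"] bexI[of _ x] exI[of _ y] conjI refl o assms(1))
  from someI_ex[OF this] obtain x' y' where "x' \<in> Y" "label y' = label y" "over 1 x' y' q"
      "child (label y) q = label x'"
    unfolding child_def by blast
  moreover from this have "label x' = label x" using over_labelD(2)[of 1 x' y' q x y] o assms(1) Y_X by blast
  ultimately show ?thesis by simp
qed

fun lev :: "nat \<Rightarrow> (int \<Rightarrow> 'a) \<Rightarrow> int \<Rightarrow> 'a" where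
  "lev 0 x = x"
| "lev (Suc n) x = up n (lev n x)"

lemma lev_Z: "x \<in> X \<Longrightarrow> lev n x \<in> Z n"
  using up_Y Z_X by (induction n) auto

lemma lev_over: "x \<in> X \<Longrightarrow> over n (lev n x) (lev (Suc n) x) (off n (lev n x))"
  using over_canonical[OF Z_X[OF lev_Z[of x n]]] by simp

definition top_at :: "(int \<Rightarrow> 'a) \<Rightarrow> nat \<Rightarrow> bool" where
  "top_at x n \<longleftrightarrow> (\<forall>q\<in>heights n (label (lev (Suc n) x)). q \<le> off n (lev n x))"

text \<open>Shifting a point carries over to the next level precisely when it is at the top of its tower.\<close>

lemma lev_adv:
  assumes x: "x \<in> X" and top: "\<And>i. i < n \<Longrightarrow> top_at x i"
  shows "lev n (adv 0 x) = adv n (lev n x)" "i < n \<Longrightarrow> off i (lev i (adv 0 x)) = 0"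
proof -
  have "lev n (adv 0 x) = adv n (lev n x) \<and> (\<forall>i<n. off i (lev i (adv 0 x)) = 0)"
    using top
  proof (induction n)
    case (Suc n)
    let ?z = "lev n x" and ?y = "lev (Suc n) x"
    have IH: "lev n (adv 0 x) = adv n ?z" "\<forall>i<n. off i (lev i (adv 0 x)) = 0" using Suc by auto
    have zZ: "?z \<in> Z n" by (rule lev_Z[OF x])
    obtain c where c: "?y \<in> Y" "parse (lvl n) ?z ?y c" "c 0 = - int (off n ?z)" "0 < c (nxt ?y)"
      using lev_over[OF x, of n] unfolding over_def by blast
    have "\<not> step n ?z < c (nxt ?y)"
    proof
      assume "step n ?z < c (nxt ?y)"
      then have "over n (adv n ?z) ?y (off n ?z + nat (step n ?z))" by (rule over_advance(1)[OF zZ c])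
      then have "off n ?z + nat (step n ?z) \<in> heights n (label ?y)"
        unfolding heights_def using adv_Z[OF zZ] by blast
      then have "off n ?z + nat (step n ?z) \<le> off n ?z" using Suc.prems[of n] unfolding top_at_def by blast
      then show False using step_pos[OF Z_X[OF zZ], of n] by simp
    qed
    then have "step n ?z = c (nxt ?y)" using over_total[OF zZ Y_X[OF c(1)] c(2,4)] by simp
    from over_advance(2)[OF zZ c this] have "up n (adv n ?z) = adv (Suc n) ?y \<and> off n (adv n ?z) = 0"
      by (rule over_up_off)
    then show ?case using IH by (auto simp: less_Suc_eq)
  qed simp
  then show "lev n (adv 0 x) = adv n (lev n x)" "i < n \<Longrightarrow> off i (lev i (adv 0 x)) = 0" by auto
qed

lemma lev_adv_not_top:
  assumes x: "x \<in> X" and top: "\<And>i. i < n \<Longrightarrow> top_at x i" and ntop: "\<not> top_at x n"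
  shows "m > n \<Longrightarrow> lev m (adv 0 x) = lev m x"
    and "off n (lev n x) < off n (lev n (adv 0 x))"
    and "q \<in> heights n (label (lev (Suc n) x)) \<Longrightarrow> off n (lev n x) < q \<Longrightarrow> off n (lev n (adv 0 x)) \<le> q"
proof -
  let ?z = "lev n x" and ?y = "lev (Suc n) x"
  have zZ: "?z \<in> Z n" by (rule lev_Z[OF x])
  have between: "off n ?z + nat (step n ?z) \<le> q" "over n (adv n ?z) ?y (off n ?z + nat (step n ?z))"
    if q: "q \<in> heights n (label ?y)" "off n ?z < q" for q
  proof -
    obtain x' y' where x': "x' \<in> Z n" "label y' = label ?y" "over n x' y' q" using q(1) unfolding heights_def by blast
    from over_no_between[OF zZ x'(1) lev_over[OF x] x'(3) x'(2)[symmetric] q(2)]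
    show "off n ?z + nat (step n ?z) \<le> q" "over n (adv n ?z) ?y (off n ?z + nat (step n ?z))" .
  qed
  obtain q0 where q0: "q0 \<in> heights n (label ?y)" "off n ?z < q0" using ntop unfolding top_at_def by (meson not_le)
  have eq: "up n (adv n ?z) = ?y" "off n (adv n ?z) = off n ?z + nat (step n ?z)"
    using over_up_off[OF between(2)[OF q0]] by auto
  have lev_n: "lev n (adv 0 x) = adv n ?z" by (rule lev_adv(1)[OF x top])
  show "lev m (adv 0 x) = lev m x" if "m > n" for m
    using that[THEN Suc_leI]
  proof (induction m rule: dec_induct)
    case base then show ?case using eq(1) lev_n by simp
  qed simp
  show "off n (lev n x) < off n (lev n (adv 0 x))" using eq(2) lev_n step_pos[OF Z_X[OF zZ]] by simp
  show "off n (lev n (adv 0 x)) \<le> q" if "q \<in> heights n (label ?y)" "off n ?z < q"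
    using between(1)[OF that] eq(2) lev_n by simp
qed

end

lemma parse_singleD:
  assumes "parse (\<lambda>a. [a]) x y c" shows "x i = y (i - c 0)" "c m = m + c 0"
  using assms by (auto simp: parse_single_iff)

context nested_substitution
begin

subsection \<open>Paths determine points\<close>

text \<open>Two points agree on an interval that contains, on either side of the block at the origin, the
  \<open>k\<close>-fold image of a growing letter. The substitution preserves this with \<open>k + 1\<close> in place of \<open>k\<close>.\<close>

definition agreeing :: "nat \<Rightarrow> (int \<Rightarrow> 'a) \<Rightarrow> (int \<Rightarrow> 'a) \<Rightarrow> bool" where
  "agreeing k z z' \<longleftrightarrow> (\<exists>l r. \<exists>g\<in>G. \<exists>h\<in>G.
     l + int (length (subst_iter \<sigma> k g)) \<le> 0 \<and> nxt z \<le> r \<and>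
     window z l (l + int (length (subst_iter \<sigma> k g))) = subst_iter \<sigma> k g \<and>
     window z r (r + int (length (subst_iter \<sigma> k h))) = subst_iter \<sigma> k h \<and>
     (\<forall>i. l \<le> i \<longrightarrow> i < r + int (length (subst_iter \<sigma> k h)) \<longrightarrow> z i = z' i))"

lemma agreeing_label:
  assumes "z \<in> X" "z' \<in> X" "label z = label z'" shows "agreeing 0 z z'"
  unfolding agreeing_def subst_iter_simps
  using prv[OF assms(1)] nxt[OF assms(1)] label_eqD(3)[OF assms]
  by (intro exI[of _ "prv z"] exI[of _ "nxt z"] bexI[of _ "z (prv z)"] bexI[of _ "z (nxt z)"]) auto

lemma agreeing_step:
  assumes a: "agreeing k z z'" and z: "z \<in> X"
    and p: "parse \<sigma> x z c" "parse \<sigma> x' z' c'" "c 0 = c' 0" and o: "c 0 \<le> 0" "0 < c (nxt z)"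
  shows "agreeing (Suc k) x x'"
proof -
  obtain l r g h where gh: "g \<in> G" "h \<in> G"
    and l: "l + int (length (subst_iter \<sigma> k g)) \<le> 0" and r: "nxt z \<le> r"
    and wl: "window z l (l + int (length (subst_iter \<sigma> k g))) = subst_iter \<sigma> k g"
    and wr: "window z r (r + int (length (subst_iter \<sigma> k h))) = subst_iter \<sigma> k h"
    and eq: "\<And>i. l \<le> i \<Longrightarrow> i < r + int (length (subst_iter \<sigma> k h)) \<Longrightarrow> z i = z' i"
    using a unfolding agreeing_def by blast
  let ?lg = "l + int (length (subst_iter \<sigma> k g))" and ?rh = "r + int (length (subst_iter \<sigma> k h))"
  have img: "window x (c l) (c ?lg) = subst_iter \<sigma> (Suc k) g" "window x (c r) (c ?rh) = subst_iter \<sigma> (Suc k) h"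
    using parse_window[OF p(1), of l ?lg] parse_window[OF p(1), of r ?rh]
    by (simp_all add: wl wr subst_iter_simps)
  have ends: "c ?lg = c l + int (length (subst_iter \<sigma> (Suc k) g))"
    "c ?rh = c r + int (length (subst_iter \<sigma> (Suc k) h))"
    using arg_cong[OF img(1), of length] arg_cong[OF img(2), of length]
      parse_le_iff[OF p(1), of l ?lg] parse_le_iff[OF p(1), of r ?rh] by auto
  have "c ?lg \<le> 0" using l o(1) parse_le_iff[OF p(1), of ?lg 0] by simp
  moreover have "nxt x \<le> c r"
  proof -
    have "x (c (nxt z)) \<in> G" using lvl_growing[of 1 x z c "nxt z"] p(1) nxt(3)[OF z] by (simp add: lvl_def)
    then have "nxt x \<le> c (nxt z)" using o(2) by (intro nxt_le)
    then show ?thesis using r parse_le_iff[OF p(1), of "nxt z" r] by simp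
  qed
  moreover have "x i = x' i" if "c l \<le> i" "i < c ?rh" for i
    by (rule parse_agree_image[OF p _ _ eq that]) (use l r nxt(1)[OF z] in auto)
  ultimately show ?thesis
    unfolding agreeing_def using gh img ends
    by (intro exI[of _ "c l"] exI[of _ "c r"] bexI[of _ g] bexI[of _ h]) auto
qed

lemma agreeing_window:
  assumes a: "agreeing k z z'" and z: "z \<in> X" and M: "\<And>g. g \<in> G \<Longrightarrow> M \<le> length (subst_iter \<sigma> k g)"
    and i: "- int M \<le> i" "i < nxt z + int M"
  shows "z i = z' i"
proof -
  obtain l r g h where "g \<in> G" "h \<in> G" "l + int (length (subst_iter \<sigma> k g)) \<le> 0" "nxt z \<le> r"
    "\<And>i. l \<le> i \<Longrightarrow> i < r + int (length (subst_iter \<sigma> k h)) \<Longrightarrow> z i = z' i"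
    using a unfolding agreeing_def by blast
  then show ?thesis using M[of g] M[of h] i by simp
qed

lemma growth: "\<exists>k0. \<forall>k\<ge>k0. \<forall>g\<in>G. M \<le> length (subst_iter \<sigma> k g)"
proof -
  have "\<forall>g\<in>G. \<exists>k. M < length (subst_iter \<sigma> k g)" by (simp add: growing_iff_unbounded)
  then obtain f where f: "\<And>g. g \<in> G \<Longrightarrow> M < length (subst_iter \<sigma> (f g) g)" by metis
  have "M \<le> length (subst_iter \<sigma> k g)" if "k \<ge> Max (range f)" "g \<in> G" for k g
  proof -
    have "f g \<le> Max (range f)" by (rule Max_ge) auto
    then have "f g \<le> k" using that(1) by simp
    from length_subst_iter_mono[OF this, of g] f[OF that(2)] show ?thesis by simp
  qed
  then show ?thesis by blast
qed

text \<open>This says that the paths of the two points have the same first \<open>N + 1\<close> edges, because the label on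
  level \<open>N + 1\<close> and the heights determine the labels on the levels below.\<close>

definition same_path :: "nat \<Rightarrow> (int \<Rightarrow> 'a) \<Rightarrow> (int \<Rightarrow> 'a) \<Rightarrow> bool" where
  "same_path N x x' \<longleftrightarrow> label (lev (Suc N) x) = label (lev (Suc N) x') \<and>
     (\<forall>i\<le>N. off i (lev i x) = off i (lev i x'))"

lemma lev_X: "x \<in> X \<Longrightarrow> lev n x \<in> X"
  using lev_Z Z_X by blast

lemma lev_agreeing:
  assumes x: "x \<in> X" "x' \<in> X" and s: "same_path N x x'" and "n + k = Suc N" "1 \<le> n"
  shows "agreeing k (lev n x) (lev n x')"
  using assms(4,5)
proof (induction k arbitrary: n)
  case 0
  then have "label (lev n x) = label (lev n x')" using s unfolding same_path_def by simp
  then show ?case using lev_X x by (intro agreeing_label)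
next
  case (Suc k)
  have lvl: "lvl n = \<sigma>" using Suc.prems by (simp add: lvl_def)
  obtain c where c: "parse \<sigma> (lev n x) (lev (Suc n) x) c" "c 0 = - int (off n (lev n x))" "0 < c (nxt (lev (Suc n) x))"
    using lev_over[OF x(1), of n] unfolding over_def lvl by blast
  obtain c' where c': "parse \<sigma> (lev n x') (lev (Suc n) x') c'" "c' 0 = - int (off n (lev n x'))"
    using lev_over[OF x(2), of n] unfolding over_def lvl by blast
  have off: "off n (lev n x) = off n (lev n x')" using s Suc.prems(1) unfolding same_path_def by simp
  show ?case
  proof (rule agreeing_step[OF Suc.IH[of "Suc n"] lev_X[OF x(1)] c(1) c'(1)])
    show "Suc n + k = Suc N" "1 \<le> Suc n" using Suc.prems by simp_all
    show "c 0 = c' 0" "c 0 \<le> 0" "0 < c (nxt (lev (Suc n) x))" using c c' off by simp_all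
  qed
qed

lemma same_path_window:
  assumes x: "x \<in> X" "x' \<in> X" and s: "same_path N x x'"
    and M: "\<And>g. g \<in> G \<Longrightarrow> M \<le> length (subst_iter \<sigma> N g)" and i: "\<bar>i\<bar> \<le> int M"
  shows "x i = x' i"
proof -
  have a: "agreeing N (lev 1 x) (lev 1 x')" using lev_agreeing[OF x s, of 1 N] by simp
  obtain c where c: "parse (\<lambda>a. [a]) x (lev 1 x) c" "c 0 = - int (off 0 x)" "0 < c (nxt (lev 1 x))"
    using lev_over[OF x(1), of 0] unfolding over_def by (auto simp: lvl_def)
  obtain c' where c': "parse (\<lambda>a. [a]) x' (lev 1 x') c'" "c' 0 = - int (off 0 x)"
    using lev_over[OF x(2), of 0] s unfolding over_def same_path_def by (auto simp: lvl_def)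
  have "x i = lev 1 x (i + int (off 0 x))" "x' i = lev 1 x' (i + int (off 0 x))"
    using parse_singleD(1)[OF c(1), of i] parse_singleD(1)[OF c'(1), of i] c(2) c'(2) by simp_all
  moreover have "int (off 0 x) < nxt (lev 1 x)" using parse_singleD(2)[OF c(1)] c(2,3) by simp
  then have "lev 1 x (i + int (off 0 x)) = lev 1 x' (i + int (off 0 x))"
    using i by (intro agreeing_window[OF a lev_X[OF x(1)] M]) auto
  ultimately show ?thesis by simp
qed

text \<open>The images of growing letters become arbitrarily long, so a path determines all windows.\<close>

lemma path_inj:
  assumes x: "x \<in> X" "x' \<in> X" and s: "\<And>N. same_path N x x'"
  shows "x = x'"
proof
  fix i
  obtain k where "\<forall>g\<in>G. nat \<bar>i\<bar> \<le> length (subst_iter \<sigma> k g)" using growth by blast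
  then show "x i = x' i" by (intro same_path_window[OF x s[of k], of "nat \<bar>i\<bar>"]) auto
qed

lemma lev_window:
  assumes M: "\<And>g. g \<in> G \<Longrightarrow> M \<le> length (subst_iter \<sigma> k g)"
    and x: "x \<in> X" "x' \<in> X" and s: "\<And>N. N \<le> n + k \<Longrightarrow> same_path N x x'" and i: "\<bar>i\<bar> \<le> int M"
  shows "lev n x i = lev n x' i"
proof (cases n)
  case 0
  then show ?thesis using same_path_window[OF x s[of k] M i] by simp
next
  case (Suc m)
  have "agreeing k (lev n x) (lev n x')" using lev_agreeing[OF x s[of "m + k"], of n k] Suc by (simp del: lev.simps)
  from agreeing_window[OF this lev_X[OF x(1)] M] show ?thesis
    using i nxt(1)[OF lev_X[OF x(1), of n]] by auto
qed

subsection \<open>Every path is realised\<close>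

context
  fixes v :: "nat \<Rightarrow> nat" and q :: "nat \<Rightarrow> nat"
  assumes v: "v n \<in> label ` Y" and q: "q n \<in> heights n (v n)" and vq: "child (v (Suc n)) (q (Suc n)) = v n"
begin

lemma realize_finite:
  assumes "y \<in> Y" "label y = v N"
  shows "\<exists>x\<in>X. lev (Suc N) x = y \<and> (\<forall>n\<le>N. off n (lev n x) = q n \<and> label (lev (Suc n) x) = v n)"
  using assms
proof (induction N arbitrary: y)
  case 0
  obtain x0 y0 where o: "x0 \<in> Z 0" "label y0 = v 0" "over 0 x0 y0 (q 0)" using q[of 0] unfolding heights_def by blast
  then have "label y = label y0" using 0 by simp
  from over_lift[OF 0(1) this o(3,1)] obtain x where "x \<in> X" "over 0 x y (q 0)" by auto
  then show ?case using over_up_off 0(2) by (intro bexI[of _ x]) auto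
next
  case (Suc N)
  obtain x0 y0 where o: "x0 \<in> Z (Suc N)" "label y0 = v (Suc N)" "over (Suc N) x0 y0 (q (Suc N))"
    using q[of "Suc N"] unfolding heights_def by blast
  then have "label y = label y0" using Suc.prems by simp
  from over_lift[OF Suc.prems(1) this o(3,1)] obtain z where z: "z \<in> Y" "over (Suc N) z y (q (Suc N))" by auto
  have "label z = v N" using child_eq[OF z] Suc.prems(2) vq by simp
  from Suc.IH[OF z(1) this] obtain x where x: "x \<in> X" "lev (Suc N) x = z"
    "\<forall>n\<le>N. off n (lev n x) = q n \<and> label (lev (Suc n) x) = v n" by blast
  have "lev (Suc (Suc N)) x = y" "off (Suc N) (lev (Suc N) x) = q (Suc N)"
    using over_up_off[OF z(2)] x(2) by simp_all
  then show ?case using x Suc.prems(2) by (intro bexI[of _ x]) (auto simp: le_Suc_eq simp del: lev.simps)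
qed

text \<open>Points realising longer and longer initial segments of a path converge, on every level, and the
  limits on the different levels fit together by continuity of the substitution.\<close>

lemma realize:
  "\<exists>x\<in>X. \<forall>n. off n (lev n x) = q n \<and> label (lev (Suc n) x) = v n"
proof -
  have "\<exists>x\<in>X. \<forall>n\<le>N. off n (lev n x) = q n \<and> label (lev (Suc n) x) = v n" for N
    using realize_finite v[of N] by (metis imageE)
  then obtain xs where xs: "\<And>N. xs N \<in> X"
    and path: "\<And>N n. n \<le> N \<Longrightarrow> off n (lev n (xs N)) = q n \<and> label (lev (Suc n) (xs N)) = v n" by metis
  define a where "a N n = lev n (xs N)" for N n
  have aX: "a N n \<in> X" for N n unfolding a_def using xs by (rule lev_X)
  have same: "same_path K (xs N) (xs N')" if "K \<le> N" "K \<le> N'" for K N N'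
    using path that unfolding same_path_def by (simp del: lev.simps)
  define stable where "stable n M K \<longleftrightarrow> (\<forall>N\<ge>K. \<forall>N'\<ge>K. \<forall>i. \<bar>i\<bar> \<le> int M \<longrightarrow> a N n i = a N' n i)" for n M K
  have ex: "\<exists>K. stable n M K" for n M
  proof -
    obtain k where k: "\<forall>g\<in>G. M \<le> length (subst_iter \<sigma> k g)" using growth by blast
    have *: "a N n i = a N' n i" if "N \<ge> n + k" "N' \<ge> n + k" "\<bar>i\<bar> \<le> int M" for N N' i
      unfolding a_def by (rule lev_window[where k = k and M = M, OF _ xs xs]) (use k that same in auto)
    show ?thesis unfolding stable_def by (intro exI[of _ "n + k"] allI impI) (rule *)
  qed
  define N0 where "N0 n M = (SOME K. stable n M K)" for n M
  have "stable n M (N0 n M)" for n M unfolding N0_def by (rule someI_ex[OF ex])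
  then have N0: "a N n i = a N' n i" if "N \<ge> N0 n M" "N' \<ge> N0 n M" "\<bar>i\<bar> \<le> int M" for n M N N' i
    using that unfolding stable_def by blast
  define z where "z n i = a (N0 n (nat \<bar>i\<bar>)) n i" for n i
  have conv: "a N n i = z n i" if "N \<ge> N0 n M" "\<bar>i\<bar> \<le> int M" for N n M i
  proof -
    let ?N = "max N (N0 n (nat \<bar>i\<bar>))"
    have "a N n i = a ?N n i" by (rule N0[of n M]) (use that in auto)
    also have "\<dots> = a (N0 n (nat \<bar>i\<bar>)) n i" by (rule N0[of n "nat \<bar>i\<bar>"]) auto
    finally show ?thesis by (simp add: z_def)
  qed
  have zX: "z n \<in> X" for n
  proof (rule subst_spaceI)
    fix M
    have "window (z n) (- int M) (int M) = window (a (N0 n M) n) (- int M) (int M)"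
      by (rule window_cong) (use conv[of n M "N0 n M"] in auto)
    moreover have "window (a (N0 n M) n) (- int M) (int M) \<in> L" using aX by (simp add: subst_space_iff)
    ultimately show "\<exists>i j. i \<le> - int M \<and> int M \<le> j \<and> window (z n) i j \<in> L"
      by (intro exI[of _ "- int M"] exI[of _ "int M"]) simp
  qed
  have lab: "label (a N (Suc n)) = label (z (Suc n))" if "N \<ge> N0 (Suc n) (gap + 1)" for N n
  proof (rule label_eqI[OF aX zX])
    fix i assume "prv (a N (Suc n)) \<le> i" "i \<le> nxt (a N (Suc n))"
    then have "\<bar>i\<bar> \<le> int (gap + 1)" using prv(2)[OF aX, of N "Suc n"] nxt(2)[OF aX, of N "Suc n"] by simp
    then show "a N (Suc n) i = z (Suc n) i" by (rule conv[OF that])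
  qed
  have zv: "label (z (Suc n)) = v n" for n
    using lab[of n "max n (N0 (Suc n) (gap + 1))"] path[of n "max n (N0 (Suc n) (gap + 1))"]
    by (simp add: a_def del: lev.simps)
  have zY: "z (Suc n) \<in> Y" for n
  proof -
    have "a (N0 (Suc n) 0) (Suc n) 0 = z (Suc n) 0" by (rule conv[of "Suc n" 0]) auto
    moreover have "a (N0 (Suc n) 0) (Suc n) \<in> Y" unfolding a_def using lev_Z[OF xs, of "Suc n"] by simp
    ultimately show ?thesis using zX by (simp add: Y_def)
  qed
  have ov: "over n (z n) (z (Suc n)) (q n)" for n
  proof -
    have aover: "over n (a N n) (a N (Suc n)) (q n)" if "N \<ge> n" for N
      using lev_over[OF xs, of n N] path[OF that] unfolding a_def by simp
    obtain u c where u: "parse (lvl n) u (z (Suc n)) c" "c 0 = - int (q n)"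
      using parse_exists[of "lvl n" "z (Suc n)"] lvl_nonempty by blast
    have "u = z n"
    proof
      fix i
      define M where "M = nat (\<bar>i\<bar> + int (q n) + 1)"
      have M: "int M = \<bar>i\<bar> + int (q n) + 1" by (simp add: M_def)
      define N where "N = max n (max (N0 (Suc n) M) (N0 n M))"
      obtain c' where c': "parse (lvl n) (a N n) (a N (Suc n)) c'" "c' 0 = - int (q n)"
        using aover[of N] unfolding over_def N_def by auto
      have "u i = a N n i"
      proof (rule parse_agree_image[OF u(1) c'(1), where k = 0 and i = "- int M" and j = "int M"])
        show "c 0 = c' 0" using u c' by simp
        show "z (Suc n) m = a N (Suc n) m" if "- int M \<le> m" "m < int M" for m
          by (rule conv[of "Suc n" M, symmetric]) (use that in \<open>auto simp: N_def\<close>)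
        have "0 - (- int M) \<le> c 0 - c (- int M)" "int M - 0 \<le> c (int M) - c 0"
          by (rule parse_expand[OF u(1)]; simp)+
        then show "c (- int M) \<le> i" "i < c (int M)" using M u(2) by linarith+
      qed auto
      also have "\<dots> = z n i" by (rule conv[of n M]) (use M in \<open>auto simp: N_def\<close>)
      finally show "u i = z n i" .
    qed
    moreover have "0 < c (nxt (z (Suc n)))"
    proof -
      define N where "N = max n (N0 (Suc n) (gap + 1))"
      obtain c' where c': "parse (lvl n) (a N n) (a N (Suc n)) c'" "c' 0 = - int (q n)" "0 < c' (nxt (a N (Suc n)))"
        using aover[of N] unfolding over_def N_def by auto
      have l: "label (a N (Suc n)) = label (z (Suc n))" by (rule lab) (simp add: N_def)
      have "c' (nxt (a N (Suc n))) = c (nxt (a N (Suc n)))"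
        by (rule parse_label(1)[OF aX zX l c'(1) u(1)])
          (use u c' prv(1)[OF aX, of N "Suc n"] nxt(1)[OF aX, of N "Suc n"] in auto)
      then show ?thesis using c'(3) label_eqD(1)[OF aX zX l] by simp
    qed
    ultimately show ?thesis unfolding over_def using zY u by blast
  qed
  have "lev n (z 0) = z n" for n using over_up_off[OF ov] by (induction n) auto
  then show ?thesis using zX[of 0] over_up_off[OF ov] zv by (intro bexI[of _ "z 0"]) auto
qed

end

end

section \<open>Bratteli diagrams of towers\<close>

text \<open>The path space is a closed subset of a product of finite discrete spaces.\<close>

lemma topspace_path_topology [simp]: "topspace (path_topology B) = inf_paths B"
proof -
  have "cylinder B [] = inf_paths B" "\<And>p. cylinder B p \<subseteq> inf_paths B" by (auto simp: cylinder_def)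
  then show ?thesis unfolding path_topology_def topology_generated_by_topspace by blast
qed

lemma finite_edges: "bratteli_diagram B \<Longrightarrow> 1 \<le> i \<Longrightarrow> finite (edges B i)"
  unfolding bratteli_diagram_def by (drule conjunct2, drule conjunct1) blast

lemma openin_cylinder: "openin (path_topology B) (cylinder B p)"
  unfolding path_topology_def by (rule topology_generated_by_Basis) blast

lemma compact_path_topology:
  assumes fin: "\<And>i. i \<ge> 1 \<Longrightarrow> finite (edges B i)"
  shows "compact_space (path_topology B)"
proof -
  let ?P = "product_topology (\<lambda>n. discrete_topology (edges B (Suc n))) UNIV"
  have top: "topspace ?P = {x. \<forall>n. x n \<in> edges B (Suc n)}" by (auto simp: PiE_def)
  have comp: "compact_space ?P"
    using fin by (simp add: compact_space_product_topology compact_space_discrete_topology)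
  define cyl1 where "cyl1 n e = {x \<in> topspace ?P. x n = e}" for n e
  have open1: "openin ?P (cyl1 n e)" if "e \<in> edges B (Suc n)" for n e
  proof -
    have "openin ?P {x \<in> topspace ?P. x n \<in> {e}}"
      by (rule openin_continuous_map_preimage[OF continuous_map_product_projection]) (use that in auto)
    then show ?thesis by (simp add: cyl1_def)
  qed
  let ?I = "{(n, e, e'). e \<in> edges B (Suc n) \<and> e' \<in> edges B (Suc (Suc n)) \<and> rng B e \<noteq> src B e'}"
  have "openin ?P (\<Union>(n, e, e')\<in>?I. cyl1 n e \<inter> cyl1 (Suc n) e')"
    by (rule openin_Union) (auto intro!: openin_Int open1)
  moreover have "topspace ?P - inf_paths B = (\<Union>(n, e, e')\<in>?I. cyl1 n e \<inter> cyl1 (Suc n) e')"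
    unfolding top inf_paths_def cyl1_def by auto
  moreover have "inf_paths B \<subseteq> topspace ?P" unfolding top inf_paths_def by auto
  ultimately have "closedin ?P (inf_paths B)" by (simp add: closedin_def)
  then have "compactin ?P (inf_paths B)" by (rule closedin_compact_space[OF comp])
  then have cs: "compact_space (subtopology ?P (inf_paths B))"
    by (simp add: compact_space_subtopology)
  have ts: "topspace (subtopology ?P (inf_paths B)) = inf_paths B"
    using \<open>inf_paths B \<subseteq> topspace ?P\<close> by auto
  have "continuous_map (subtopology ?P (inf_paths B)) (path_topology B) (\<lambda>x. x)"
    unfolding path_topology_def
  proof (rule continuous_on_generated_topo)
    fix U assume "U \<in> range (cylinder B)"
    then obtain p where U: "U = cylinder B p" by blast
    have "openin (subtopology ?P (inf_paths B)) U"
    proof (cases "p = []")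
      case True
      then have "U = inf_paths B" by (simp add: U cylinder_def)
      then show ?thesis using openin_topspace ts by metis
    next
      case ne: False
      show ?thesis
      proof (cases "\<forall>i<length p. p ! i \<in> edges B (Suc i)")
        case True
        then have "openin ?P (\<Inter>i\<in>{..<length p}. cyl1 i (p ! i))"
          using ne by (intro openin_Inter) (auto intro!: open1)
        moreover have "U = (\<Inter>i\<in>{..<length p}. cyl1 i (p ! i)) \<inter> inf_paths B"
          using ne \<open>inf_paths B \<subseteq> topspace ?P\<close> unfolding U cylinder_def cyl1_def by auto
        ultimately show ?thesis unfolding openin_subtopology by blast
      next
        case False
        then have "U = {}" unfolding U cylinder_def inf_paths_def by auto metis
        then show ?thesis by simp
      qed
    qed
    moreover have "(\<lambda>x. x) -` U \<inter> topspace (subtopology ?P (inf_paths B)) = U"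
      unfolding ts by (auto simp: U cylinder_def)
    ultimately show "openin (subtopology ?P (inf_paths B)) ((\<lambda>x. x) -` U \<inter> topspace (subtopology ?P (inf_paths B)))"
      by simp
  next
    show "(\<lambda>x. x) ` topspace (subtopology ?P (inf_paths B)) \<subseteq> \<Union> (range (cylinder B))"
      using topspace_path_topology[of B] unfolding path_topology_def topology_generated_by_topspace ts by simp
  qed
  from image_compactin[OF cs[unfolded compact_space_def] this] show ?thesis
    unfolding ts compact_space_def by simp
qed

lemma continuous_map_path_discrete:
  assumes "\<And>x. x \<in> inf_paths B \<Longrightarrow> \<exists>n. \<forall>y\<in>inf_paths B. (\<forall>i<n. y i = x i) \<longrightarrow> f y = f x"
  shows "continuous_map (path_topology B) (discrete_topology UNIV) f"
  unfolding continuous_map_def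
proof (intro conjI allI impI)
  fix U
  show "openin (path_topology B) {x \<in> topspace (path_topology B). f x \<in> U}"
    unfolding topspace_path_topology
  proof (subst openin_subopen, safe)
    fix x assume x: "x \<in> inf_paths B" "f x \<in> U"
    obtain n where n: "\<forall>y\<in>inf_paths B. (\<forall>i<n. y i = x i) \<longrightarrow> f y = f x" using assms[OF x(1)] by blast
    let ?T = "cylinder B (map x [0..<n])"
    have "x \<in> ?T" using x by (simp add: cylinder_def)
    moreover have "?T \<subseteq> {x \<in> inf_paths B. f x \<in> U}"
    proof
      fix y assume "y \<in> ?T"
      then have y: "y \<in> inf_paths B" "\<forall>i<n. y i = x i" by (simp_all add: cylinder_def)
      then have "f y = f x" using n by blast
      then show "y \<in> {x \<in> inf_paths B. f x \<in> U}" using x(2) y(1) by simp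
    qed
    ultimately show "\<exists>T. openin (path_topology B) T \<and> x \<in> T \<and> T \<subseteq> {x \<in> inf_paths B. f x \<in> U}"
      using openin_cylinder by blast
  qed
qed auto

text \<open>The stationary diagram of a system of towers. \<open>W\<close> is the set of labels of the towers of each
  level, \<open>H n v\<close> the set of heights at which the tower with label \<open>v\<close> on level \<open>n + 1\<close> meets the level
  below, and \<open>ch v q\<close> the label of the tower that is met at height \<open>q\<close>.\<close>

locale towers =
  fixes W :: "nat set" and H :: "nat \<Rightarrow> nat \<Rightarrow> nat set" and ch :: "nat \<Rightarrow> nat \<Rightarrow> nat"
  assumes finW: "finite W" and neW: "W \<noteq> {}"
    and finH: "finite (H n v)" and zeroH: "v \<in> W \<Longrightarrow> 0 \<in> H n v" and H_Suc: "H (Suc n) v = H (Suc 0) v"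
    and ch_W: "v \<in> W \<Longrightarrow> q \<in> H (Suc 0) v \<Longrightarrow> ch v q \<in> W"
    and ch_surj: "u \<in> W \<Longrightarrow> \<exists>v\<in>W. \<exists>q\<in>H (Suc 0) v. ch v q = u"
begin

definition vertex :: "nat \<Rightarrow> nat \<Rightarrow> nat" where
  "vertex i v = prod_encode (i, v)"

definition edge :: "nat \<Rightarrow> nat \<Rightarrow> nat \<Rightarrow> nat" where
  "edge i v q = prod_encode (i, prod_encode (v, q))"

definition edge_level :: "nat \<Rightarrow> nat" where "edge_level e = fst (prod_decode e)"
definition edge_label :: "nat \<Rightarrow> nat" where "edge_label e = fst (prod_decode (snd (prod_decode e)))"
definition edge_height :: "nat \<Rightarrow> nat" where "edge_height e = snd (prod_decode (snd (prod_decode e)))"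

lemma edge_sel [simp]: "edge_level (edge i v q) = i" "edge_label (edge i v q) = v" "edge_height (edge i v q) = q"
  by (simp_all add: edge_level_def edge_label_def edge_height_def edge_def)

lemma edge_eq_iff [simp]: "edge i v q = edge i' v' q' \<longleftrightarrow> i = i' \<and> v = v' \<and> q = q'"
  by (simp add: edge_def)

lemma vertex_eq_iff [simp]: "vertex i v = vertex i' v' \<longleftrightarrow> i = i' \<and> v = v'"
  by (simp add: vertex_def)

definition diagram :: "(nat, nat) ord_bratteli" where
  "diagram = \<lparr>verts = (\<lambda>i. if i = 0 then {vertex 0 0} else vertex i ` W),
     edges = (\<lambda>i. {edge i v q |v q. v \<in> W \<and> q \<in> H (i - 1) v}),
     rng = (\<lambda>e. vertex (edge_level e) (edge_label e)),
     src = (\<lambda>e. if edge_level e = 1 then vertex 0 0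
        else vertex (edge_level e - 1) (ch (edge_label e) (edge_height e))),
     edge_le = {(e, e'). edge_level e = edge_level e' \<and> edge_label e = edge_label e' \<and>
        edge_height e \<le> edge_height e'}\<rparr>"

lemma verts_diagram: "verts diagram i = (if i = 0 then {vertex 0 0} else vertex i ` W)"
  by (simp add: diagram_def)

lemma edges_diagram: "edges diagram i = {edge i v q |v q. v \<in> W \<and> q \<in> H (i - 1) v}"
  by (simp add: diagram_def)

lemma rng_edge [simp]: "rng diagram (edge i v q) = vertex i v"
  by (simp add: diagram_def)

lemma src_edge: "src diagram (edge i v q) = (if i = 1 then vertex 0 0 else vertex (i - 1) (ch v q))"
  by (simp add: diagram_def)

lemma edge_le_iff [simp]:
  "(edge i v q, edge i' v' q') \<in> edge_le diagram \<longleftrightarrow> i = i' \<and> v = v' \<and> q \<le> q'"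
  by (simp add: diagram_def)

lemma edge_in_edges [simp]: "edge j v q \<in> edges diagram i \<longleftrightarrow> j = i \<and> v \<in> W \<and> q \<in> H (i - 1) v"
  by (auto simp: edges_diagram)

lemma edgesE:
  assumes "e \<in> edges diagram i" obtains v q where "e = edge i v q" "v \<in> W" "q \<in> H (i - 1) v"
  using assms by (auto simp: edges_diagram)

lemma all_edges_diagram: "edge i v q \<in> all_edges diagram \<longleftrightarrow> 1 \<le> i \<and> v \<in> W \<and> q \<in> H (i - 1) v"
  by (auto simp: all_edges_def)

lemma all_edgesE:
  assumes "e \<in> all_edges diagram" obtains i v q where "e = edge (Suc i) v q" "v \<in> W" "q \<in> H i v"
proof -
  obtain i where "1 \<le> i" "e \<in> edges diagram i" using assms by (auto simp: all_edges_def)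
  then show ?thesis using that by (cases i) (auto elim!: edgesE)
qed

lemma in_edges_diagram: "in_edges diagram (vertex (Suc i) v) = {edge (Suc i) v q |q. v \<in> W \<and> q \<in> H i v}"
  unfolding in_edges_def by (auto elim!: all_edgesE simp: all_edges_diagram)

lemma H_pos: "i \<ge> 1 \<Longrightarrow> H i v = H (Suc 0) v"
  using H_Suc[of "i - 1" v] by simp

lemma bratteli: "bratteli_diagram diagram"
  unfolding bratteli_diagram_def
proof (intro conjI allI impI ballI)
  show "finite (verts diagram i)" for i using finW by (simp add: verts_diagram)
  show "finite (edges diagram i)" for i
  proof -
    have "edges diagram i = (\<Union>v\<in>W. edge i v ` H (i - 1) v)" by (auto simp: edges_diagram)
    then show ?thesis using finW finH by simp
  qed
  show "verts diagram i \<inter> verts diagram j = {}" if "i \<noteq> j" for i j using that by (auto simp: verts_diagram)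
  show "edges diagram i \<inter> edges diagram j = {}" if "i \<noteq> j" for i j using that by (auto simp: edges_diagram)
  show "\<exists>v0. verts diagram 0 = {v0}" by (simp add: verts_diagram)
  show "rng diagram ` edges diagram i = verts diagram i" if i1: "1 \<le> i" for i
  proof (intro equalityI subsetI)
    fix u assume "u \<in> rng diagram ` edges diagram i"
    then show "u \<in> verts diagram i" using that by (auto elim!: edgesE simp: verts_diagram)
  next
    fix u assume "u \<in> verts diagram i"
    then obtain v where v: "v \<in> W" "u = vertex i v" using i1 by (auto simp: verts_diagram)
    show "u \<in> rng diagram ` edges diagram i"
      by (rule image_eqI[of _ _ "edge i v 0"]) (use v zeroH in auto)
  qed
  show "src diagram ` edges diagram i = verts diagram (i - 1)" if i1: "1 \<le> i" for i
  proof (intro equalityI subsetI)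
    fix u assume "u \<in> src diagram ` edges diagram i"
    then show "u \<in> verts diagram (i - 1)" using that ch_W H_pos[of "i - 1"]
      by (auto elim!: edgesE simp: verts_diagram src_edge)
  next
    fix u assume u: "u \<in> verts diagram (i - 1)"
    show "u \<in> src diagram ` edges diagram i"
    proof (cases "i = 1")
      case True
      obtain v where "v \<in> W" using neW by blast
      then show ?thesis using u True zeroH
        by (intro image_eqI[of _ _ "edge 1 v 0"]) (auto simp: verts_diagram src_edge)
    next
      case False
      then obtain w where w: "w \<in> W" "u = vertex (i - 1) w" using u i1 by (auto simp: verts_diagram)
      obtain v q where "v \<in> W" "q \<in> H (Suc 0) v" "ch v q = w" using ch_surj[OF w(1)] by blast
      then show ?thesis using w False that H_pos[of "i - 1" v]
        by (intro image_eqI[of _ _ "edge i v q"]) (auto simp: src_edge)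
    qed
  qed
  show "out_edges diagram u \<noteq> {}" if u: "u \<in> all_verts diagram" for u
  proof -
    obtain i where i: "u \<in> verts diagram i" using u by (auto simp: all_verts_def)
    show ?thesis
    proof (cases "i = 0")
      case True
      obtain v where "v \<in> W" using neW by blast
      then have "edge 1 v 0 \<in> out_edges diagram u"
        using True i zeroH by (simp add: out_edges_def all_edges_diagram src_edge verts_diagram)
      then show ?thesis by blast
    next
      case False
      then obtain w where w: "w \<in> W" "u = vertex i w" using i by (auto simp: verts_diagram)
      obtain v q where "v \<in> W" "q \<in> H (Suc 0) v" "ch v q = w" using ch_surj[OF w(1)] by blast
      then have "edge (Suc i) v q \<in> out_edges diagram u"
        using w False H_pos[of i v] by (simp add: out_edges_def all_edges_diagram src_edge)
      then show ?thesis by blast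
    qed
  qed
  show "in_edges diagram u \<noteq> {}" if u: "u \<in> all_verts diagram - verts diagram 0" for u
  proof -
    obtain i where i: "u \<in> verts diagram i" using u by (auto simp: all_verts_def)
    have "i \<noteq> 0" using i u by (metis Diff_iff)
    then obtain k w where w: "w \<in> W" "u = vertex (Suc k) w" using i by (cases i) (auto simp: verts_diagram)
    then have "edge (Suc k) w 0 \<in> in_edges diagram u" using zeroH by (simp add: in_edges_diagram)
    then show ?thesis by blast
  qed
qed

lemma ordered: "ordered_bratteli_diagram diagram"
  unfolding ordered_bratteli_diagram_def
proof (intro conjI allI impI ballI bratteli)
  show "partial_order_on (edges diagram i) (edge_le diagram \<inter> edges diagram i \<times> edges diagram i)" for i
    unfolding partial_order_on_def preorder_on_def
  proof (intro conjI)
    show "refl_on (edges diagram i) (edge_le diagram \<inter> edges diagram i \<times> edges diagram i)"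
      by (auto simp: refl_on_def elim!: edgesE)
    show "trans (edge_le diagram \<inter> edges diagram i \<times> edges diagram i)"
      by (rule transI) (auto elim!: edgesE)
    show "antisym (edge_le diagram \<inter> edges diagram i \<times> edges diagram i)"
      by (rule antisymI) (auto elim!: edgesE)
  qed auto
  show "((e, e') \<in> edge_le diagram \<or> (e', e) \<in> edge_le diagram) \<longleftrightarrow> rng diagram e = rng diagram e'"
    if "e \<in> edges diagram i" "e' \<in> edges diagram i" for i e e'
    using that by (auto elim!: edgesE)
qed

lemma stationary: "stationary_ordered_bratteli_diagram diagram"
  unfolding stationary_ordered_bratteli_diagram_def
proof (intro conjI ordered exI)
  show "stationary_labeling diagram W vertex"
    unfolding stationary_labeling_def
  proof (intro conjI finW allI impI ballI)
    show "bij_betw (vertex n) W (verts diagram n)" if "1 \<le> n" for n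
      using that by (auto simp: bij_betw_def inj_on_def verts_diagram)
    have "incidence diagram vertex n c d = card {q \<in> H (Suc 0) c. ch c q = d}" if "1 \<le> n" "c \<in> W" for n c d
    proof -
      have "{e \<in> edges diagram (n + 1). rng diagram e = vertex (n + 1) c \<and> src diagram e = vertex n d} =
          edge (n + 1) c ` {q \<in> H (Suc 0) c. ch c q = d}"
        using that H_pos[of n c] by (auto elim!: edgesE simp: src_edge)
      moreover have "inj_on (edge (n + 1) c) {q \<in> H (Suc 0) c. ch c q = d}" by (auto simp: inj_on_def)
      ultimately show ?thesis unfolding incidence_def by (simp add: card_image)
    qed
    then show "incidence diagram vertex m c d = incidence diagram vertex n c d"
      if "1 \<le> m" "1 \<le> n" "c \<in> W" "d \<in> W" for m n c d using that by simp
  qed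
  show "stationary_order_labeling diagram W vertex"
    unfolding stationary_order_labeling_def
  proof (intro ballI allI impI)
    fix c m n :: nat assume c: "c \<in> W" and mn: "1 \<le> m" "1 \<le> n"
    let ?f = "\<lambda>e. edge (n + 1) (edge_label e) (edge_height e)"
    have ine: "in_edges diagram (vertex (k + 1) c) = edge (k + 1) c ` H (Suc 0) c" if "1 \<le> k" for k
      using c H_pos[OF that, of c] in_edges_diagram[of k c] by auto
    have "bij_betw ?f (in_edges diagram (vertex (m + 1) c)) (in_edges diagram (vertex (n + 1) c))"
      unfolding ine[OF mn(1)] ine[OF mn(2)] by (auto simp: bij_betw_def inj_on_def image_image)
    moreover have "\<forall>e\<in>in_edges diagram (vertex (m + 1) c). \<forall>e'\<in>in_edges diagram (vertex (m + 1) c).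
        (e, e') \<in> edge_le diagram \<longleftrightarrow> (?f e, ?f e') \<in> edge_le diagram"
      unfolding ine[OF mn(1)] by auto
    moreover have "\<forall>e\<in>in_edges diagram (vertex (m + 1) c). \<forall>d\<in>W.
        src diagram e = vertex m d \<longleftrightarrow> src diagram (?f e) = vertex n d"
      unfolding ine[OF mn(1)] using mn by (auto simp: src_edge)
    ultimately show "\<exists>f. bij_betw f (in_edges diagram (vertex (m + 1) c)) (in_edges diagram (vertex (n + 1) c)) \<and>
        (\<forall>e\<in>in_edges diagram (vertex (m + 1) c). \<forall>e'\<in>in_edges diagram (vertex (m + 1) c).
          (e, e') \<in> edge_le diagram \<longleftrightarrow> (f e, f e') \<in> edge_le diagram) \<and>
        (\<forall>e\<in>in_edges diagram (vertex (m + 1) c). \<forall>d\<in>W.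
          src diagram e = vertex m d \<longleftrightarrow> src diagram (f e) = vertex n d)"
      by (intro exI[of _ ?f] conjI)
  qed
qed

lemma inf_paths_iff:
  "(\<lambda>n. edge (Suc n) (v n) (q n)) \<in> inf_paths diagram \<longleftrightarrow>
    (\<forall>n. v n \<in> W \<and> q n \<in> H n (v n) \<and> ch (v (Suc n)) (q (Suc n)) = v n)"
  by (simp add: inf_paths_def src_edge eq_commute[of "ch _ _"] conj_assoc)

lemma inf_pathsE:
  assumes "x \<in> inf_paths diagram" obtains v q where "x = (\<lambda>n. edge (Suc n) (v n) (q n))"
proof -
  have "\<exists>v q. x n = edge (Suc n) v q" for n
  proof -
    have "x n \<in> edges diagram (Suc n)" using assms by (simp add: inf_paths_def)
    then show ?thesis by (auto elim!: edgesE)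
  qed
  then obtain v q where "\<forall>n. x n = edge (Suc n) (v n) (q n)" by metis
  then show ?thesis using that[of v q] by blast
qed

lemma in_edges_image: "v \<in> W \<Longrightarrow> in_edges diagram (vertex (Suc n) v) = edge (Suc n) v ` H n v"
  by (auto simp: in_edges_diagram)

lemma max_edge_iff:
  assumes "v \<in> W" shows "max_edge diagram (edge (Suc n) v q) \<longleftrightarrow> (\<forall>p\<in>H n v. p \<le> q)"
proof -
  have "max_edge diagram (edge (Suc n) v q) \<longleftrightarrow> (\<forall>p\<in>H n v. q \<le> p \<longrightarrow> p = q)"
    unfolding max_edge_def rng_edge in_edges_image[OF assms] by simp
  also have "\<dots> \<longleftrightarrow> (\<forall>p\<in>H n v. p \<le> q)" by (metis nat_le_linear order_antisym order_refl)
  finally show ?thesis .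
qed

lemma min_edge_iff:
  assumes "v \<in> W" shows "min_edge diagram (edge (Suc n) v q) \<longleftrightarrow> q = 0"
  unfolding min_edge_def rng_edge in_edges_image[OF assms] using zeroH[OF assms, of n] by auto

lemma succ_edgeI:
  assumes "v \<in> W" "q' \<in> H n v" "q < q'" "\<And>p. p \<in> H n v \<Longrightarrow> q < p \<Longrightarrow> q' \<le> p"
  shows "succ_edge diagram (edge (Suc n) v q) (edge (Suc n) v q')"
proof -
  have "p = q \<or> p = q'" if "p \<in> H n v" "q \<le> p" "p \<le> q'" for p
    using assms(4)[of p] that by linarith
  then show ?thesis
    unfolding succ_edge_def rng_edge in_edges_image[OF assms(1)] using assms(2,3) by simp
qed

end

lemma inf_path_prefix:
  assumes x: "x \<in> inf_paths B" and B: "bratteli_diagram B"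
  shows "map x [0..<k] \<in> fin_paths B (src B (x k))"
proof -
  have "src B (x 0) \<in> verts B 0"
    using B x unfolding bratteli_diagram_def inf_paths_def by (metis (mono_tags, lifting) One_nat_def diff_Suc_1 image_eqI le_refl mem_Collect_eq)
  then show ?thesis using x unfolding fin_paths_def inf_paths_def
    by (cases k) (auto simp: last_map simp del: upt_Suc)
qed

lemma topspace_subst_topology [simp]: "topspace (subst_topology s) = subst_space s"
  by (simp add: subst_topology_def)

lemma Hausdorff_subst_topology: "Hausdorff_space (subst_topology s)"
  unfolding subst_topology_def
  by (intro Hausdorff_space_subtopology) (simp add: Hausdorff_space_product_topology)

lemma continuous_map_subst_topology:
  "continuous_map T (subst_topology s) f \<longleftrightarrow>
    (\<forall>i. continuous_map T (discrete_topology UNIV) (\<lambda>x. f x i)) \<and> (\<forall>x\<in>topspace T. f x \<in> subst_space s)"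
  unfolding subst_topology_def
  by (auto simp: continuous_map_in_subtopology continuous_map_componentwise_UNIV)

lemma continuous_map_coordinate: "continuous_map (subst_topology s) (discrete_topology UNIV) (\<lambda>x. x i)"
  unfolding subst_topology_def
  by (intro continuous_map_from_subtopology continuous_map_product_projection) simp

lemma homeomorphic_map_left_shift: "homeomorphic_map (subst_topology s) (subst_topology s) left_shift"
  unfolding homeomorphic_map_maps
proof (rule exI, unfold homeomorphic_maps_def, intro conjI)
  show "continuous_map (subst_topology s) (subst_topology s) left_shift"
    unfolding continuous_map_subst_topology left_shift_def
    using subst_space_shift[of _ s 1] continuous_map_coordinate by auto
  show "continuous_map (subst_topology s) (subst_topology s) (\<lambda>x i. x (i + - 1))"
    unfolding continuous_map_subst_topology
    using subst_space_shift[of _ s "- 1"] continuous_map_coordinate[of s] by auto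
qed (auto simp: left_shift_def)

context nested_substitution
begin

context
  assumes ne: "X \<noteq> {}"
begin

lemma towers_labels: "towers (label ` Y) heights child"
proof
  show "finite (label ` Y)" by (rule finite_labels)
  show "label ` Y \<noteq> {}" using up_Y[of _ 0] ne by blast
  show "finite (heights n v)" for n v by (rule heights_finite)
  show "0 \<in> heights n v" if "v \<in> label ` Y" for n v using that zero_in_heights by auto
  show "heights (Suc n) v = heights (Suc 0) v" for n v using heights_Suc[of n v] unfolding One_nat_def .
  show "child v q \<in> label ` Y" if "v \<in> label ` Y" and q: "q \<in> heights (Suc 0) v" for v q
  proof -
    obtain x y where "x \<in> Y" "label y = v" "over (Suc 0) x y q" using q unfolding heights_def by auto
    then show ?thesis using child_eq[of x 0 y q] by auto
  qed
  show "\<exists>v\<in>label ` Y. \<exists>q\<in>heights (Suc 0) v. child v q = u" if u: "u \<in> label ` Y" for u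
  proof -
    obtain x where x: "x \<in> Y" "u = label x" using u by blast
    have o: "over (Suc 0) x (up (Suc 0) x) (off (Suc 0) x)" by (rule over_canonical[OF Y_X[OF x(1)]])
    have "off (Suc 0) x \<in> heights (Suc 0) (label (up (Suc 0) x))"
      using off_in_heights[of x "Suc 0"] x(1) by simp
    then show ?thesis using child_eq[OF x(1) o] up_Y[OF Y_X[OF x(1)], of "Suc 0"] x(2) by blast
  qed
qed

interpretation towers "label ` Y" heights child
  by (rule towers_labels)

definition path_of :: "(int \<Rightarrow> 'a) \<Rightarrow> nat \<Rightarrow> nat" where
  "path_of x n = edge (Suc n) (label (lev (Suc n) x)) (off n (lev n x))"

lemma label_lev: "x \<in> X \<Longrightarrow> label (lev (Suc n) x) \<in> label ` Y"
  using lev_Z[of x "Suc n"] by simp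

lemma path_of_in_inf_paths:
  assumes x: "x \<in> X" shows "path_of x \<in> inf_paths diagram"
  unfolding path_of_def[abs_def] inf_paths_iff
proof (intro allI conjI)
  fix n
  show "label (lev (Suc n) x) \<in> label ` Y" by (rule label_lev[OF x])
  show "off n (lev n x) \<in> heights n (label (lev (Suc n) x))" using off_in_heights[OF lev_Z[OF x]] by simp
  have "lev (Suc n) x \<in> Y" using lev_Z[OF x, of "Suc n"] by simp
  from child_eq[OF this lev_over[OF x]]
  show "child (label (lev (Suc (Suc n)) x)) (off (Suc n) (lev (Suc n) x)) = label (lev (Suc n) x)" .
qed

lemma same_pathI: "(\<And>i. i \<le> N \<Longrightarrow> path_of x i = path_of x' i) \<Longrightarrow> same_path N x x'"
  unfolding same_path_def path_of_def by simp

lemma bij_path_of: "bij_betw path_of X (inf_paths diagram)"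
  unfolding bij_betw_def
proof (intro conjI equalityI subsetI)
  show "inj_on path_of X"
  proof (rule inj_onI, rule path_inj)
    fix x x' N assume "path_of x = path_of x'"
    then show "same_path N x x'" by (intro same_pathI) simp
  qed
  fix z assume z: "z \<in> inf_paths diagram"
  then obtain v q where vq: "z = (\<lambda>n. edge (Suc n) (v n) (q n))" by (rule inf_pathsE)
  have "\<forall>n. v n \<in> label ` Y \<and> q n \<in> heights n (v n) \<and> child (v (Suc n)) (q (Suc n)) = v n"
    using z unfolding vq inf_paths_iff .
  then obtain x where "x \<in> X" "\<forall>n. off n (lev n x) = q n \<and> label (lev (Suc n) x) = v n"
    using realize[of v q] by blast
  then show "z \<in> path_of ` X" using vq by (intro image_eqI[of _ _ x]) (auto simp: path_of_def fun_eq_iff)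
qed (use path_of_in_inf_paths in auto)

definition point_of :: "(nat \<Rightarrow> nat) \<Rightarrow> int \<Rightarrow> 'a" where
  "point_of = inv_into X path_of"

lemma point_of_path_of: "x \<in> X \<Longrightarrow> point_of (path_of x) = x"
  using bij_path_of by (simp add: point_of_def bij_betw_def)

lemma point_of_in_space: "z \<in> inf_paths diagram \<Longrightarrow> point_of z \<in> X"
  using bij_path_of by (auto simp: point_of_def bij_betw_def inv_into_into)

lemma path_of_point_of: "z \<in> inf_paths diagram \<Longrightarrow> path_of (point_of z) = z"
  using bij_path_of by (auto simp: point_of_def bij_betw_def f_inv_into_f)

text \<open>It is the inverse of \<open>path_of\<close> whose continuity is evident: a finite path determines a window.
  By compactness of the path space this suffices.\<close>

lemma homeomorphic_map_point_of: "homeomorphic_map (path_topology diagram) (subst_topology \<sigma>) point_of"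
proof (rule continuous_imp_homeomorphic_map)
  show "compact_space (path_topology diagram)"
    by (intro compact_path_topology finite_edges[OF bratteli])
  show "continuous_map (path_topology diagram) (subst_topology \<sigma>) point_of"
    unfolding continuous_map_subst_topology
  proof (intro conjI allI ballI)
    fix i
    obtain k where k: "\<forall>g\<in>G. nat \<bar>i\<bar> \<le> length (subst_iter \<sigma> k g)" using growth by blast
    show "continuous_map (path_topology diagram) (discrete_topology UNIV) (\<lambda>z. point_of z i)"
    proof (rule continuous_map_path_discrete, intro exI ballI impI)
      fix z z' assume z: "z \<in> inf_paths diagram" "z' \<in> inf_paths diagram" and eq: "\<forall>i<Suc k. z' i = z i"
      have "same_path k (point_of z') (point_of z)"
        using eq path_of_point_of[OF z(1)] path_of_point_of[OF z(2)] by (intro same_pathI) simp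
      then show "point_of z' i = point_of z i"
        using k by (intro same_path_window[OF point_of_in_space[OF z(2)] point_of_in_space[OF z(1)], of k "nat \<bar>i\<bar>"]) auto
    qed
  qed (use point_of_in_space in simp)
  show "point_of ` topspace (path_topology diagram) = topspace (subst_topology \<sigma>)"
  proof (intro equalityI subsetI)
    fix x assume "x \<in> topspace (subst_topology \<sigma>)"
    then have "x \<in> X" by simp
    then show "x \<in> point_of ` topspace (path_topology diagram)"
      by (intro image_eqI[of _ _ "path_of x"]) (simp_all add: point_of_path_of path_of_in_inf_paths)
  qed (use point_of_in_space in auto)
  show "inj_on point_of (topspace (path_topology diagram))"
    by (rule inj_on_inverseI[where g = path_of]) (simp add: path_of_point_of)
qed (rule Hausdorff_subst_topology)

lemma homeomorphic_map_path_of: "homeomorphic_map (subst_topology \<sigma>) (path_topology diagram) path_of"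
proof -
  obtain h where "homeomorphic_maps (path_topology diagram) (subst_topology \<sigma>) point_of h"
    using homeomorphic_map_point_of unfolding homeomorphic_map_maps by blast
  then have h: "homeomorphic_map (subst_topology \<sigma>) (path_topology diagram) h"
    "\<And>x. x \<in> X \<Longrightarrow> point_of (h x) = x" "\<And>x. x \<in> X \<Longrightarrow> h x \<in> inf_paths diagram"
    unfolding homeomorphic_maps_map using homeomorphic_imp_surjective_map by fastforce+
  have "h x = path_of x" if "x \<in> X" for x using h(2,3)[OF that] path_of_point_of by metis
  then show ?thesis by (intro homeomorphic_map_eq[OF h(1)]) simp
qed

lemma max_edge_path_of: "x \<in> X \<Longrightarrow> max_edge diagram (path_of x n) \<longleftrightarrow> top_at x n"
  unfolding path_of_def top_at_def by (rule max_edge_iff[OF label_lev])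

lemma min_edge_path_of: "x \<in> X \<Longrightarrow> min_edge diagram (path_of x n) \<longleftrightarrow> off n (lev n x) = 0"
  unfolding path_of_def by (rule min_edge_iff[OF label_lev])

lemma path_of_max_paths: "x \<in> X \<Longrightarrow> path_of x \<in> max_paths diagram \<longleftrightarrow> (\<forall>n. top_at x n)"
  by (simp add: max_paths_def path_of_in_inf_paths max_edge_path_of)

lemma path_of_min_paths: "x \<in> X \<Longrightarrow> path_of x \<in> min_paths diagram \<longleftrightarrow> (\<forall>n. off n (lev n x) = 0)"
  by (simp add: min_paths_def path_of_in_inf_paths min_edge_path_of)

lemma adv_in_space: "x \<in> X \<Longrightarrow> adv 0 x \<in> X"
  using adv_Z[of x 0] by simp

lemma least_not_top:
  assumes "x \<in> X" "path_of x \<notin> max_paths diagram"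
  defines "k \<equiv> LEAST n. \<not> max_edge diagram (path_of x n)"
  shows "i < k \<Longrightarrow> top_at x i" "\<not> top_at x k"
proof -
  have ex: "\<exists>n. \<not> max_edge diagram (path_of x n)"
    using assms(1,2) path_of_max_paths max_edge_path_of by blast
  show "i < k \<Longrightarrow> top_at x i" "\<not> top_at x k"
    using LeastI_ex[OF ex] not_less_Least[of i "\<lambda>n. \<not> max_edge diagram (path_of x n)"]
    unfolding k_def max_edge_path_of[OF assms(1)] by blast+
qed

text \<open>If a point has a minimal path, then its preimage under the shift has a maximal one: otherwise the
  point would have a positive height at the first level at which its preimage is not at the top.\<close>

lemma adv_max_paths:
  "(\<lambda>x. path_of (adv 0 x)) ` {x \<in> X. path_of x \<in> max_paths diagram} = min_paths diagram"
proof (intro equalityI subsetI)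
  fix z assume "z \<in> (\<lambda>x. path_of (adv 0 x)) ` {x \<in> X. path_of x \<in> max_paths diagram}"
  then obtain x where x: "x \<in> X" "path_of x \<in> max_paths diagram" "z = path_of (adv 0 x)" by blast
  have "off n (lev n (adv 0 x)) = 0" for n
    using lev_adv(2)[OF x(1), of "Suc n" n] x(2) path_of_max_paths[OF x(1)] by simp
  then show "z \<in> min_paths diagram" using x path_of_min_paths adv_in_space by simp
next
  fix z assume z: "z \<in> min_paths diagram"
  then have "z \<in> inf_paths diagram" by (simp add: min_paths_def)
  then obtain x' where x': "x' \<in> X" "z = path_of x'" using point_of_in_space path_of_point_of by metis
  define x where "x = (\<lambda>i. x' (i + - 1))"
  have x: "x \<in> X" unfolding x_def by (rule subst_space_shift[OF x'(1)])
  have ax: "adv 0 x = x'" by (simp add: x_def adv_def step_def)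
  have "path_of x \<in> max_paths diagram"
  proof (rule ccontr)
    assume "path_of x \<notin> max_paths diagram"
    from lev_adv_not_top(2)[OF x least_not_top[OF x this]]
    show False using z path_of_min_paths[OF x'(1)] x'(2) ax by simp
  qed
  then show "z \<in> (\<lambda>x. path_of (adv 0 x)) ` {x \<in> X. path_of x \<in> max_paths diagram}"
    using x ax x'(2) by (intro image_eqI[of _ _ x]) auto
qed

lemma vershik_step_path_of:
  assumes x: "x \<in> X" "path_of x \<notin> max_paths diagram"
  shows "vershik_step diagram (path_of x) (path_of (adv 0 x))"
proof -
  define k where "k = (LEAST n. \<not> max_edge diagram (path_of x n))"
  note top = least_not_top(1)[OF x, folded k_def] and ntop = least_not_top(2)[OF x, folded k_def]
  note higher = lev_adv_not_top(1)[OF x(1) top ntop]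
  let ?x' = "adv 0 x"
  let ?z' = "path_of ?x'"
  note x'X = adv_in_space[OF x(1)]
  have lev: "lev (Suc k) ?x' = lev (Suc k) x" by (rule higher) simp_all
  have zk: "?z' k = edge (Suc k) (label (lev (Suc k) x)) (off k (lev k ?x'))"
    unfolding path_of_def lev by (rule refl)
  have "off k (lev k ?x') \<in> heights k (label (lev (Suc k) ?x'))"
    using off_in_heights[OF lev_Z[OF x'X]] by simp
  then have "off k (lev k ?x') \<in> heights k (label (lev (Suc k) x))" unfolding lev .
  then have "succ_edge diagram (path_of x k) (?z' k)"
    unfolding zk unfolding path_of_def
    using lev_adv_not_top(2,3)[OF x(1) top ntop] by (intro succ_edgeI label_lev[OF x(1)]) auto
  moreover have "map ?z' [0..<k] \<in> fin_paths diagram (src diagram (?z' k))"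
    by (rule inf_path_prefix[OF path_of_in_inf_paths[OF x'X] bratteli])
  moreover have "\<forall>d\<in>set (map ?z' [0..<k]). min_edge diagram d"
    using min_edge_path_of[OF x'X] lev_adv(2)[OF x(1) top] by auto
  moreover have "?z' = (\<lambda>i. if i < k then map ?z' [0..<k] ! i else if i = k then ?z' k else path_of x i)"
  proof
    fix i
    have "?z' i = path_of x i" if "k < i"
      using higher[of i] higher[of "Suc i"] that by (simp add: path_of_def del: lev.simps)
    then show "?z' i = (if i < k then map ?z' [0..<k] ! i else if i = k then ?z' k else path_of x i)" by auto
  qed
  ultimately show ?thesis unfolding vershik_step_def Let_def k_def[symmetric] by blast
qed

lemma vershik_model:
  "\<exists>(B :: (nat, nat) ord_bratteli) \<phi>. stationary_ordered_bratteli_diagram B \<and>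
    vershik_homeomorphism B \<phi> \<and> homeomorphic_systems (subst_topology \<sigma>) left_shift (path_topology B) \<phi>"
proof -
  define \<phi> where "\<phi> = path_of \<circ> left_shift \<circ> point_of"
  have \<phi>: "\<phi> (path_of x) = path_of (adv 0 x)" if "x \<in> X" for x
    using point_of_path_of[OF that] by (simp add: \<phi>_def left_shift_def adv_def step_def)
  have max: "max_paths diagram = path_of ` {x \<in> X. path_of x \<in> max_paths diagram}"
    using bij_path_of unfolding bij_betw_def max_paths_def by auto
  have "homeomorphic_map (path_topology diagram) (path_topology diagram) \<phi>"
    unfolding \<phi>_def
    by (intro homeomorphic_map_compose[OF homeomorphic_map_point_of]
        homeomorphic_map_compose[OF homeomorphic_map_left_shift] homeomorphic_map_path_of)
  moreover have "\<phi> ` max_paths diagram = min_paths diagram"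
    by (subst max) (simp add: image_image \<phi> flip: adv_max_paths)
  moreover have "vershik_step diagram z (\<phi> z)" if z: "z \<in> inf_paths diagram - max_paths diagram" for z
  proof -
    obtain x where "x \<in> X" "z = path_of x" using z point_of_in_space path_of_point_of by (metis DiffD1)
    then show ?thesis using vershik_step_path_of[of x] \<phi> z by simp
  qed
  ultimately have "vershik_homeomorphism diagram \<phi>" unfolding vershik_homeomorphism_def by blast
  moreover have "homeomorphic_systems (subst_topology \<sigma>) left_shift (path_topology diagram) \<phi>"
    unfolding homeomorphic_systems_def using homeomorphic_map_path_of point_of_path_of
    by (intro exI[of _ path_of]) (simp add: \<phi>_def)
  ultimately show ?thesis using stationary by blast
qed

end

end

section \<open>Reversing the order\<close>

definition reverse_order :: "('v, 'e) ord_bratteli \<Rightarrow> ('v, 'e) ord_bratteli" where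
  "reverse_order B = B\<lparr>edge_le := (edge_le B)\<inverse>\<rparr>"

lemma reverse_order_sel [simp]:
  "verts (reverse_order B) = verts B" "edges (reverse_order B) = edges B"
  "rng (reverse_order B) = rng B" "src (reverse_order B) = src B"
  "edge_le (reverse_order B) = (edge_le B)\<inverse>"
  by (simp_all add: reverse_order_def)

lemma reverse_order_simps [simp]:
  "all_verts (reverse_order B) = all_verts B" "all_edges (reverse_order B) = all_edges B"
  "in_edges (reverse_order B) = in_edges B" "out_edges (reverse_order B) = out_edges B"
  "inf_paths (reverse_order B) = inf_paths B" "fin_paths (reverse_order B) = fin_paths B"
  "bratteli_diagram (reverse_order B) = bratteli_diagram B"
  "incidence (reverse_order B) = incidence B"
  by (simp_all add: fun_eq_iff all_verts_def all_edges_def in_edges_def out_edges_def inf_paths_def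
      fin_paths_def bratteli_diagram_def incidence_def)

lemma path_topology_reverse_order [simp]: "path_topology (reverse_order B) = path_topology B"
proof -
  have "cylinder (reverse_order B) = cylinder B" by (simp add: fun_eq_iff cylinder_def)
  then show ?thesis by (simp add: path_topology_def)
qed

lemma max_edge_reverse_order [simp]: "max_edge (reverse_order B) = min_edge B"
  by (simp add: fun_eq_iff max_edge_def min_edge_def)

lemma min_edge_reverse_order [simp]: "min_edge (reverse_order B) = max_edge B"
  by (simp add: fun_eq_iff max_edge_def min_edge_def)

lemma paths_reverse_order [simp]:
  "max_paths (reverse_order B) = min_paths B" "min_paths (reverse_order B) = max_paths B"
  by (simp_all add: max_paths_def min_paths_def)

lemma stationary_reverse_order:
  assumes "stationary_ordered_bratteli_diagram B"
  shows "stationary_ordered_bratteli_diagram (reverse_order B)"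
proof -
  obtain C :: "nat set" and lab where o: "ordered_bratteli_diagram B"
    and l: "stationary_labeling B C lab" "stationary_order_labeling B C lab"
    using assms unfolding stationary_ordered_bratteli_diagram_def by blast
  have "ordered_bratteli_diagram (reverse_order B)"
    unfolding ordered_bratteli_diagram_def
  proof (intro conjI allI impI ballI)
    show "bratteli_diagram (reverse_order B)" using o by (simp add: ordered_bratteli_diagram_def)
    show "partial_order_on (edges (reverse_order B) i)
        (edge_le (reverse_order B) \<inter> edges (reverse_order B) i \<times> edges (reverse_order B) i)" if "1 \<le> i" for i
    proof -
      have "edge_le (reverse_order B) \<inter> edges (reverse_order B) i \<times> edges (reverse_order B) i =
          (edge_le B \<inter> edges B i \<times> edges B i)\<inverse>" by auto
      then show ?thesis using o that by (simp add: ordered_bratteli_diagram_def)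
    qed
  next
    fix i e e' assume "1 \<le> i" "e \<in> edges (reverse_order B) i" "e' \<in> edges (reverse_order B) i"
    then have "((e, e') \<in> edge_le B \<or> (e', e) \<in> edge_le B) \<longleftrightarrow> rng B e = rng B e'"
      using o by (simp add: ordered_bratteli_diagram_def)
    then show "((e, e') \<in> edge_le (reverse_order B) \<or> (e', e) \<in> edge_le (reverse_order B)) \<longleftrightarrow>
        rng (reverse_order B) e = rng (reverse_order B) e'" by auto
  qed
  moreover have "stationary_labeling (reverse_order B) C lab"
    using l(1) unfolding stationary_labeling_def reverse_order_sel reverse_order_simps .
  moreover have "stationary_order_labeling (reverse_order B) C lab"
    unfolding stationary_order_labeling_def
  proof (intro ballI allI impI)
    fix c m n :: nat assume "c \<in> C" "1 \<le> m" "1 \<le> n"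
    then obtain f where "bij_betw f (in_edges B (lab (m + 1) c)) (in_edges B (lab (n + 1) c))"
      "\<forall>e\<in>in_edges B (lab (m + 1) c). \<forall>e'\<in>in_edges B (lab (m + 1) c).
          (e, e') \<in> edge_le B \<longleftrightarrow> (f e, f e') \<in> edge_le B"
      "\<forall>e\<in>in_edges B (lab (m + 1) c). \<forall>d\<in>C. src B e = lab m d \<longleftrightarrow> src B (f e) = lab n d"
      using l(2) unfolding stationary_order_labeling_def by blast
    then show "\<exists>f. bij_betw f (in_edges (reverse_order B) (lab (m + 1) c)) (in_edges (reverse_order B) (lab (n + 1) c)) \<and>
        (\<forall>e\<in>in_edges (reverse_order B) (lab (m + 1) c). \<forall>e'\<in>in_edges (reverse_order B) (lab (m + 1) c).
           (e, e') \<in> edge_le (reverse_order B) \<longleftrightarrow> (f e, f e') \<in> edge_le (reverse_order B)) \<and>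
        (\<forall>e\<in>in_edges (reverse_order B) (lab (m + 1) c). \<forall>d\<in>C.
           src (reverse_order B) e = lab m d \<longleftrightarrow> src (reverse_order B) (f e) = lab n d)"
      by (intro exI[of _ f]) auto
  qed
  ultimately show ?thesis unfolding stationary_ordered_bratteli_diagram_def by blast
qed

lemma fin_paths_length:
  assumes B: "bratteli_diagram B" and p: "p \<in> fin_paths B u" and u: "u \<in> verts B k"
  shows "length p = k"
proof (cases "p = []")
  case True
  then have "u \<in> verts B 0" using p by (simp add: fin_paths_def)
  then show ?thesis using B u True unfolding bratteli_diagram_def by (metis disjoint_iff list.size(3))
next
  case False
  then have i: "length p - 1 < length p" "Suc (length p - 1) = length p" by simp_all
  have "p ! (length p - 1) \<in> edges B (Suc (length p - 1))" using p i(1) unfolding fin_paths_def by blast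
  then have "last p \<in> edges B (length p)" using False i(2) by (simp add: last_conv_nth)
  moreover have "rng B (last p) = u" using p False by (simp add: fin_paths_def)
  moreover have "1 \<le> length p" using False by (simp add: Suc_le_eq)
  ultimately have "u \<in> verts B (length p)" using B unfolding bratteli_diagram_def by blast
  then show ?thesis using B u unfolding bratteli_diagram_def by (metis disjoint_iff)
qed

text \<open>The Vershik rule is symmetric: the inverse of the map follows the rule for the reversed order.\<close>

lemma vershik_step_reverse:
  assumes B: "bratteli_diagram B" and x: "x \<in> inf_paths B" "x \<notin> max_paths B" "y \<in> inf_paths B"
    and st: "vershik_step B x y"
  shows "vershik_step (reverse_order B) y x"
proof -
  define k where "k = (LEAST n. \<not> max_edge B (x n))"
  obtain e p where e: "succ_edge B (x k) e" and p: "p \<in> fin_paths B (src B e)" "\<forall>d\<in>set p. min_edge B d"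
    and y: "y = (\<lambda>i. if i < k then p ! i else if i = k then e else x i)"
    using st unfolding vershik_step_def Let_def k_def[symmetric] by blast
  have ex: "\<exists>n. \<not> max_edge B (x n)" using x by (auto simp: max_paths_def)
  have k: "\<not> max_edge B (x k)" "\<And>i. i < k \<Longrightarrow> max_edge B (x i)"
    using LeastI_ex[OF ex] not_less_Least[of _ "\<lambda>n. \<not> max_edge B (x n)"] unfolding k_def by blast+
  have xk: "x k \<in> all_edges B" using x(1) by (auto simp: inf_paths_def all_edges_def)
  have yk: "y k = e" using y by simp
  have "e \<in> edges B (Suc k)" using x(3) yk by (auto simp: inf_paths_def)
  then have "src B e \<in> verts B k" using B unfolding bratteli_diagram_def by (metis One_nat_def diff_Suc_1 image_eqI le_add1 plus_1_eq_Suc)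
  then have len: "length p = k" by (rule fin_paths_length[OF B p(1)])
  have re: "rng B e = rng B (x k)" using e by (simp add: succ_edge_def in_edges_def)
  have least: "(LEAST n. \<not> max_edge (reverse_order B) (y n)) = k"
    unfolding max_edge_reverse_order
  proof (rule Least_equality)
    show "\<not> min_edge B (y k)"
      using e xk re unfolding yk succ_edge_def min_edge_def in_edges_def by auto
    show "k \<le> n" if "\<not> min_edge B (y n)" for n
    proof (rule ccontr)
      assume "\<not> k \<le> n"
      then have "y n = p ! n" "p ! n \<in> set p" using y len by auto
      then show False using that p(2) by simp
    qed
  qed
  have "succ_edge (reverse_order B) (y k) (x k)"
    using e xk re unfolding yk succ_edge_def by (auto simp: in_edges_def)
  moreover have "map x [0..<k] \<in> fin_paths (reverse_order B) (src (reverse_order B) (x k))"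
    using inf_path_prefix[OF x(1) B, of k] by simp
  moreover have "\<forall>d\<in>set (map x [0..<k]). min_edge (reverse_order B) d" using k(2) by auto
  moreover have "x = (\<lambda>i. if i < k then map x [0..<k] ! i else if i = k then x k else y i)"
    using y by auto
  ultimately show ?thesis unfolding vershik_step_def Let_def least by blast
qed

lemma vershik_homeomorphism_reverse:
  assumes B: "bratteli_diagram B" and v: "vershik_homeomorphism B \<phi>"
  obtains \<psi> where "vershik_homeomorphism (reverse_order B) \<psi>" "\<And>x. x \<in> inf_paths B \<Longrightarrow> \<psi> (\<phi> x) = x"
proof -
  have hom: "homeomorphic_map (path_topology B) (path_topology B) \<phi>"
    and mm: "\<phi> ` max_paths B = min_paths B"
    and st: "\<And>x. x \<in> inf_paths B - max_paths B \<Longrightarrow> vershik_step B x (\<phi> x)"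
    using v unfolding vershik_homeomorphism_def by blast+
  obtain \<psi> where "homeomorphic_maps (path_topology B) (path_topology B) \<phi> \<psi>"
    using hom unfolding homeomorphic_map_maps by blast
  then have \<psi>: "homeomorphic_map (path_topology B) (path_topology B) \<psi>"
    "\<And>x. x \<in> inf_paths B \<Longrightarrow> \<psi> (\<phi> x) = x" "\<And>x. x \<in> inf_paths B \<Longrightarrow> \<phi> (\<psi> x) = x"
    unfolding homeomorphic_maps_map by auto
  have \<psi>in: "\<psi> x \<in> inf_paths B" if "x \<in> inf_paths B" for x
    using homeomorphic_imp_surjective_map[OF \<psi>(1)] that by auto
  have sub: "max_paths B \<subseteq> inf_paths B" "min_paths B \<subseteq> inf_paths B" by (auto simp: max_paths_def min_paths_def)
  have "\<psi> ` min_paths B = max_paths B"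
    unfolding mm[symmetric] image_image using \<psi>(2) sub(1) by (auto simp: image_iff subset_iff)
  moreover have "vershik_step (reverse_order B) x (\<psi> x)" if x: "x \<in> inf_paths B - min_paths B" for x
  proof -
    have "\<psi> x \<notin> max_paths B" using x mm \<psi>(3)[of x] by (metis DiffD1 DiffD2 imageI)
    moreover have "vershik_step B (\<psi> x) x" using st[of "\<psi> x"] \<psi>in[of x] \<psi>(3)[of x] x calculation by simp
    ultimately show ?thesis using vershik_step_reverse[OF B \<psi>in] x by blast
  qed
  ultimately have "vershik_homeomorphism (reverse_order B) \<psi>"
    unfolding vershik_homeomorphism_def using \<psi>(1) by simp
  then show ?thesis using that \<psi>(2) by blast
qed

lemma homeomorphic_map_reflect:
  "homeomorphic_map (subst_topology s) (subst_topology (\<lambda>a. rev (s a))) (\<lambda>x i. x (- 1 - i))"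
  unfolding homeomorphic_map_maps
proof (rule exI, unfold homeomorphic_maps_def, intro conjI)
  show "continuous_map (subst_topology s) (subst_topology (\<lambda>a. rev (s a))) (\<lambda>x i. x (- 1 - i))"
    unfolding continuous_map_subst_topology using continuous_map_coordinate[of s] by (auto simp: subst_space_rev)
  show "continuous_map (subst_topology (\<lambda>a. rev (s a))) (subst_topology s) (\<lambda>x i. x (- 1 - i))"
    unfolding continuous_map_subst_topology using continuous_map_coordinate by (auto simp: subst_space_rev)
qed auto

theorem theorem6p6:
  fixes \<sigma> :: "'a::finite \<Rightarrow> 'a list"
  assumes "is_substitution \<sigma>"
    and "aperiodic_subst \<sigma>"
    and "uncountable (subst_space \<sigma>)"
    and "nesting_property \<sigma>"
  shows "\<exists>(B :: (nat, nat) ord_bratteli) \<phi>.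
           stationary_ordered_bratteli_diagram B \<and>
           vershik_homeomorphism B \<phi> \<and>
           homeomorphic_systems (subst_topology \<sigma>) left_shift (path_topology B) \<phi>"
proof -
  have sub: "\<sigma> a \<noteq> []" for a using assms(1) by (simp add: is_substitution_def)
  obtain x0 where x0: "x0 \<in> subst_space \<sigma>" using assms(3) by fastforce
  from assms(4) consider "\<forall>a\<in>growing_letters \<sigma>. hd (\<sigma> a) \<in> growing_letters \<sigma>"
    | "\<forall>a\<in>growing_letters \<sigma>. last (\<sigma> a) \<in> growing_letters \<sigma>"
    unfolding nesting_property_def by blast
  then show ?thesis
  proof cases
    case 1
    interpret nested_substitution \<sigma> by standard (use sub assms(2) 1 in auto)
    show ?thesis using vershik_model x0 by blast
  next
    case 2
    \<comment> \<open>the mirror image of \<open>\<sigma>\<close> falls under the first case, with the shift replaced by its inverse\<close>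
    let ?s = "\<lambda>a. rev (\<sigma> a)" and ?r = "\<lambda>(x :: int \<Rightarrow> 'a) i. x (- 1 - i)"
    interpret nested_substitution ?s
      by standard (use sub aperiodic_subst_rev[OF assms(2)] 2 in \<open>auto simp: growing_letters_rev hd_rev\<close>)
    have "?r x0 \<in> subst_space ?s" using x0 by (simp add: subst_space_rev)
    then obtain B :: "(nat, nat) ord_bratteli" and \<phi> where B: "stationary_ordered_bratteli_diagram B"
      "vershik_homeomorphism B \<phi>" "homeomorphic_systems (subst_topology ?s) left_shift (path_topology B) \<phi>"
      using vershik_model by blast
    have "bratteli_diagram B"
      using B(1) by (simp add: stationary_ordered_bratteli_diagram_def ordered_bratteli_diagram_def)
    then obtain \<psi> where \<psi>: "vershik_homeomorphism (reverse_order B) \<psi>" "\<And>x. x \<in> inf_paths B \<Longrightarrow> \<psi> (\<phi> x) = x"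
      using vershik_homeomorphism_reverse B(2) by blast
    obtain h where h: "homeomorphic_map (subst_topology ?s) (path_topology B) h"
      "\<And>x. x \<in> subst_space ?s \<Longrightarrow> h (left_shift x) = \<phi> (h x)"
      using B(3) unfolding homeomorphic_systems_def by auto
    have h_in: "h x \<in> inf_paths B" if "x \<in> subst_space ?s" for x
      using homeomorphic_imp_surjective_map[OF h(1)] that by auto
    have "(h \<circ> ?r) (left_shift x) = \<psi> ((h \<circ> ?r) x)" if x: "x \<in> subst_space \<sigma>" for x
    proof -
      have "left_shift x \<in> subst_space \<sigma>" using subst_space_shift[OF x, of 1] by (simp add: left_shift_def)
      then have r: "?r (left_shift x) \<in> subst_space ?s" by (simp add: subst_space_rev)
      have "left_shift (?r (left_shift x)) = ?r x" 
        by (rule ext) (simp add: left_shift_def, rule arg_cong[where f = x], simp)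
      then have "h (?r x) = \<phi> (h (?r (left_shift x)))" using h(2)[OF r] by simp
      then show ?thesis using \<psi>(2)[OF h_in[OF r]] by simp
    qed
    moreover have "homeomorphic_map (subst_topology \<sigma>) (path_topology B) (h \<circ> ?r)"
      by (rule homeomorphic_map_compose[OF homeomorphic_map_reflect h(1)])
    ultimately have "homeomorphic_systems (subst_topology \<sigma>) left_shift (path_topology (reverse_order B)) \<psi>"
      unfolding homeomorphic_systems_def by (intro exI[of _ "h \<circ> ?r"]) simp
    then show ?thesis using stationary_reverse_order[OF B(1)] \<psi>(1) by blast
  qed
qed

end
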